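(* Let $k$ be a negative integer, $c>1$, and $p,q,r\ge0$ with $p+q+r=1$. Assume $0<r<p$. (i) If $2c^j\notin\mathbb{N}$ for all integers $j$ satisfying $j\ge|k|$, then $\mu^{(k)}\in ID^0$. (ii) Suppose that $c^j\in\mathbb{N}$ for some $j\in\mathbb{N}$. Let $l$ be the smallest of such $j$, let $\alpha=c^l$ and $\beta=\lceil |k|/l\rceil$. Then $\mu^{(k)}\in ID$ if and only if $q>0$ and $$h_{\alpha,\beta}(q^{\alpha^\beta})\ge r/p.$$ (iii) Suppose that $2c^j\in\mathbb{N}_{\mathrm{odd}}$ for some $j\in\mathbb{N}$ with $j\ge|k|$. Then $c^{j'}\notin\mathbb{N}$ for all $j'\in\mathbb{N}$, and $j\in\mathbb{N}$ satisfying $2c^j\in\mathbb{N}_{\mathrm{odd}}$ is unique. Let $\alpha=c^j$. Then $2\alpha\in\mathbb{N}_{\mathrm{odd}}$ and $2\alpha\ge3$. (iii)$_1$ Suppose (in the situation of (iii)) that $2\alpha\ge5$. Then $\mu^{(k)}\in ID$ if and only if $$q^{2\alpha}+(r/p)^{2\alpha}\ge\alpha\,(r/p)^2.$$ (iii)$_2$ Suppose (in the situation of (iii)) that $2\alpha=3$. For $m\in\mathbb{N}$ denote by $t(m)$ the largest integer $t'$ such that $m$ is an integer multiple of $2^{t'}$, and write $a_m:=m^{-1}(q^m-(-r/p)^m)$. Then $\mu^{(k)}\in ID$ if and only if $$\sum_{s=0}^{t(m)}a_{3^{s+1}2^{-s}m}\ge(2m)^{-1}(r/p)^{2m}\qquad\text{for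 all } m\in\{1,\ldots,149\}.$$
   Context: $\mathbb{N}=\{1,2,\ldots\}$, $\mathbb{N}_{\mathrm{odd}}$ is the set of odd positive integers, $\lceil x\rceil$ is the smallest integer $\ge x$. For $k\in\mathbb{Z}$ let $\{(N_t^{(k)},L_t^{(k)}),t\ge0\}$ be the bivariate compound Poisson process (pure jump, no drift) with $E[e^{i(z_1N_t^{(k)}+z_2L_t^{(k)})}]=\exp[t\int_{\mathbb{R}^2}(e^{i(z_1x_1+z_2x_2)}-1)\nu^{(k)}(dx)]$, where $\nu^{(k)}$ is concentrated on the points $(1,0)$, $(0,1)$, $(1,c^{-k})$ with masses $u,v,w\ge0$ respectively, and $p=u/(u+v+w)$, $q=v/(u+v+w)$, $r=w/(u+v+w)$. Define $\mu^{(k)}$ as the distribution of $\int_0^{\infty-}c^{-N^{(k)}_{s-}}\,dL_s^{(k)}$ (the almost sure limit of $\int_0^t$ as $t\to\infty$, which exists). It depends on $u,v,w$ only through $p,q,r$. The functions $h_{\alpha,\gamma}$. For integers $\alpha\ge2$ and $\gamma\ge1$ let $F_\alpha(x)=\sum_{n=0}^\infty\alpha^{-n}x^{2\alpha^n}$ for $0\le x\le1$ (continuous, strictly increasing, $F_\alpha(0)=0$); for $0<x\le1$ let $h_{\alpha,\gamma}(x)\in(0,x)$ be the unique number with $\alpha^{-\gamma}F_\alpha(x)=F_\alpha(h_{\alpha,\gamma}(x))$. Quasi-infinite divisibility. A distribution $\sigma$ on $\mathbb{R}$ is quasi-infinitely divisible if its characteristic function is $\widehat\sigma(z)=\exp[i\gamma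 z-az^2+\int_{\mathbb{R}}(e^{izx}-1-izx1_{[-1,1]}(x))\,\nu_\sigma(dx)]$, where $\gamma,a\in\mathbb{R}$ and $\nu_\sigma$ is a signed measure (a difference $\nu_\sigma^+-\nu_\sigma^-$ of mutually singular measures, possibly both of infinite mass near $0$) with total variation measure $|\nu_\sigma|$ satisfying $\nu_\sigma(\{0\})=0$ and $\int(x^2\wedge1)\,|\nu_\sigma|(dx)<\infty$. $ID$ is the class of infinitely divisible distributions on $\mathbb{R}$; $ID^0$ is the class of quasi-infinitely divisible distributions that are not infinitely divisible. *)

theory Defs
  imports "HOL-Probability.Probability"
begin

text \<open>Processes are indexed by \<^typ>\<open>real\<close>; only the times \<open>t \<ge> 0\<close> matter.\<close>

definition levy_process ::
    "'a measure \<Rightarrow> (real \<Rightarrow> 'a \<Rightarrow> 'b :: euclidean_space) \<Rightarrow> bool" where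
  "levy_process M X \<longleftrightarrow>
     prob_space M \<and>
     (\<forall>t\<ge>0. X t \<in> borel_measurable M) \<and>
     (AE \<omega> in M. X 0 \<omega> = 0) \<and>
     (\<forall>(n::nat) t. 0 \<le> t 0 \<and> strict_mono_on {..n} t \<longrightarrow>
        prob_space.indep_vars M (\<lambda>_. borel) (\<lambda>i \<omega>. X (t (Suc i)) \<omega> - X (t i) \<omega>) {..<n}) \<and>
     (\<forall>s\<ge>0. \<forall>t\<ge>0. distr M borel (\<lambda>\<omega>. X (s + t) \<omega> - X s \<omega>) = distr M borel (X t)) \<and>
     (\<forall>t\<ge>0. \<forall>e>0.
        ((\<lambda>s. measure M {\<omega> \<in> space M. dist (X s \<omega>) (X t \<omega>) > e}) \<longlongrightarrow> 0) (at t within {0..})) \<and>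
     (AE \<omega> in M. \<forall>t\<ge>0.
        continuous (at_right t) (\<lambda>s. X s \<omega>) \<and>
        (t > 0 \<longrightarrow> (\<exists>l. ((\<lambda>s. X s \<omega>) \<longlongrightarrow> l) (at_left t))))"

definition compound_poisson_process ::
    "'a measure \<Rightarrow> 'b measure \<Rightarrow> (real \<Rightarrow> 'a \<Rightarrow> 'b :: euclidean_space) \<Rightarrow> bool" where
  "compound_poisson_process M \<nu> X \<longleftrightarrow>
     levy_process M X \<and>
     sets \<nu> = sets borel \<and> finite_measure \<nu> \<and> emeasure \<nu> {0} = 0 \<and>
     (\<forall>t\<ge>0. \<forall>z. (LINT \<omega>|M. iexp (z \<bullet> X t \<omega>)) =
        exp (complex_of_real t * (LINT x|\<nu>. iexp (z \<bullet> x) - 1)))"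

text \<open>The identity pushforward turns the discrete \<sigma>-algebra of \<^const>\<open>point_measure\<close> into
  the Borel one; the three points are distinct for \<open>c \<noteq> 0\<close>.\<close>

definition jump_measure ::
    "real \<Rightarrow> int \<Rightarrow> real \<Rightarrow> real \<Rightarrow> real \<Rightarrow> (real \<times> real) measure" where
  "jump_measure c k u v w =
     distr
       (point_measure {(1, 0), (0, 1), (1, c powi (- k))}
         (\<lambda>x. if x = (1, 0) then ennreal u else if x = (0, 1) then ennreal v else ennreal w))
       borel (\<lambda>x. x)"

text \<open>
  The pathwise Lebesgue--Stieltjes integral of \<open>c\<close> to the power \<open>- N\<^sub>s\<^sub>-\<close> against \<open>dL\<^sub>s\<close> over
  \<open>(0, t]\<close>. Almost every path of \<open>L\<close> is nondecreasing and right continuous when \<open>(N, L)\<close> is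
  compound Poisson with a \<^const>\<open>jump_measure\<close>, so that \<^const>\<open>interval_measure\<close> is
  its Stieltjes measure; the path is extended by its value at \<open>0\<close> to negative times.\<close>

definition exp_integral_upto ::
    "real \<Rightarrow> (real \<Rightarrow> 'a \<Rightarrow> real) \<Rightarrow> (real \<Rightarrow> 'a \<Rightarrow> real) \<Rightarrow> real \<Rightarrow> 'a \<Rightarrow> real" where
  "exp_integral_upto c N L t \<omega> =
     (LINT s:{0<..t}|interval_measure (\<lambda>s. L (max 0 s) \<omega>).
        c powr (- Lim (at_left s) (\<lambda>r. N r \<omega>)))"

text \<open>
  The limit as \<open>t \<rightarrow> \<infinity>\<close> exists almost surely, but \<^const>\<open>Lim\<close> is an arbitrary
  value on an exceptional null set that need not be measurable in \<^term>\<open>M\<close>; hence the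
  completion, which does not change the law of an \<open>M\<close>-measurable version of the limit.\<close>

definition exp_integral_law ::
    "'a measure \<Rightarrow> real \<Rightarrow> (real \<Rightarrow> 'a \<Rightarrow> real) \<Rightarrow> (real \<Rightarrow> 'a \<Rightarrow> real) \<Rightarrow> real measure" where
  "exp_integral_law M c N L =
     distr (completion M) borel (\<lambda>\<omega>. Lim at_top (\<lambda>t. exp_integral_upto c N L t \<omega>))"

definition convolution_power :: "nat \<Rightarrow> real measure \<Rightarrow> real measure" where
  "convolution_power n \<rho> = ((\<lambda>\<tau>. convolution \<rho> \<tau>) ^^ n) (return borel 0)"

definition infinitely_divisible :: "real measure \<Rightarrow> bool" where
  "infinitely_divisible \<sigma> \<longleftrightarrow>
     real_distribution \<sigma> \<and>
     (\<forall>n\<ge>1. \<exists>\<rho>. real_distribution \<rho> \<and> \<sigma> = convolution_power n \<rho>)"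

definition levy_khintchine_kernel :: "real \<Rightarrow> real \<Rightarrow> complex" where
  "levy_khintchine_kernel z x = iexp (z * x) - 1 - \<i> * complex_of_real (z * x * indicator {-1..1} x)"

definition mutually_singular :: "'a measure \<Rightarrow> 'a measure \<Rightarrow> bool" where
  "mutually_singular \<mu> \<nu> \<longleftrightarrow>
     sets \<mu> = sets \<nu> \<and> (\<exists>A\<in>sets \<mu>. emeasure \<mu> A = 0 \<and> emeasure \<nu> (space \<mu> - A) = 0)"

text \<open>
  The signed Levy measure is represented by its Jordan decomposition \<open>(\<nu>p, \<nu>m)\<close>, with total
  variation \<open>\<nu>p + \<nu>m\<close>: both parts may have infinite mass near \<open>0\<close>, so their difference need not
  exist as a set function.\<close>

definition quasi_infinitely_divisible :: "real measure \<Rightarrow> bool" where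
  "quasi_infinitely_divisible \<sigma> \<longleftrightarrow>
     real_distribution \<sigma> \<and>
     (\<exists>\<gamma> a :: real. \<exists>\<nu>p \<nu>m :: real measure.
        sets \<nu>p = sets borel \<and> sets \<nu>m = sets borel \<and>
        mutually_singular \<nu>p \<nu>m \<and>
        emeasure \<nu>p {0} = 0 \<and> emeasure \<nu>m {0} = 0 \<and>
        integrable \<nu>p (\<lambda>x. min (x\<^sup>2) 1) \<and> integrable \<nu>m (\<lambda>x. min (x\<^sup>2) 1) \<and>
        (\<forall>z. char \<sigma> z =
           exp (\<i> * complex_of_real (\<gamma> * z) - complex_of_real (a * z\<^sup>2)
             + ((LINT x|\<nu>p. levy_khintchine_kernel z x) - (LINT x|\<nu>m. levy_khintchine_kernel z x)))))"

definition ID :: "real measure set" where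
  "ID = {\<sigma>. infinitely_divisible \<sigma>}"

definition ID0 :: "real measure set" where
  "ID0 = {\<sigma>. quasi_infinitely_divisible \<sigma> \<and> \<not> infinitely_divisible \<sigma>}"

definition F_fun :: "nat \<Rightarrow> real \<Rightarrow> real" where
  "F_fun \<alpha> x = (\<Sum>n. (1 / real \<alpha>) ^ n * x ^ (2 * \<alpha> ^ n))"

definition h_fun :: "nat \<Rightarrow> nat \<Rightarrow> real \<Rightarrow> real" where
  "h_fun \<alpha> \<gamma> x = (THE y. 0 < y \<and> y < x \<and> (1 / real \<alpha>) ^ \<gamma> * F_fun \<alpha> x = F_fun \<alpha> y)"

definition odd_naturals :: "real set" where
  "odd_naturals = {real n | n :: nat. odd n}"

definition a_seq :: "real \<Rightarrow> real \<Rightarrow> real \<Rightarrow> nat \<Rightarrow> real" where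
  "a_seq p q r m = (q ^ m - (- (r / p)) ^ m) / real m"

end

theory Submission
  imports Defs
begin

text \<open>
  Write \<open>\<rho> = r / p\<close> and \<open>\<kappa> = \<bar>k\<bar>\<close>. Conditioning on the first jump, the characteristic function of \<open>\<mu>\<close>
  solves \<open>\<phi>(\<zeta>) (1 - q exp \<zeta>) = (p + r exp (c\<^sup>\<kappa> \<zeta>)) \<phi>(\<zeta> / c)\<close> with \<open>\<zeta> = iz\<close>. Iterating and expanding the
  logarithms yields \<open>\<phi> = exp \<psi>\<close>, where \<open>\<psi>\<close> is the exponent of a purely atomic signed Levy measure
  with finite first absolute moment: a weight \<open>- (- \<rho>)\<^sup>m / m\<close> at \<open>c\<^sup>\<kappa> m / c\<^sup>n\<close> and a weight \<open>q\<^sup>m / m\<close> at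
  \<open>m / c\<^sup>n\<close> for all \<open>n \<ge> 0\<close> and \<open>m \<ge> 1\<close>. Hence \<open>\<mu>\<close> is quasi-infinitely divisible, and it is
  infinitely divisible iff no atom has negative mass. Dividing a position by a power of \<open>c\<close> only adds
  positive weights, so only the atoms at \<open>c\<^sup>\<kappa> m\<close> matter; which weights meet in such an atom
  is a question about the \<open>i\<close> with \<open>m c\<^sup>i\<close> an integer.

  In case (i) the atom with \<open>m = 2\<close> is negative. In case (ii) the condition for even \<open>m = 2m'\<close> reads
  \<open>F(\<rho>\<^sup>m') \<le> \<alpha>\<^sup>-\<^sup>\<beta> F((q\<^sup>A)\<^sup>m')\<close> for \<open>F = F\<^sub>\<alpha>\<close> and \<open>A = \<alpha>\<^sup>\<beta>\<close>, and \<open>m' = 1\<close> is the strongest of them because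
  \<open>F(Q\<^sup>m) / F(h\<^sup>m)\<close> is smallest at \<open>m = 1\<close>. In case (iii) the ratio \<open>q\<^sup>n / \<rho>\<^sup>2\<close> with \<open>n = 2\<alpha>\<close>, bounded
  below through the first atom (\<open>n \<ge> 5\<close>) or the second one (\<open>n = 3\<close>), controls all large \<open>m\<close>.
\<close>

section \<open>The functions \<open>F\<close> and \<open>h\<close>\<close>

text \<open>The functional equation is never read off the paths, since the definition of the process
  provides no jump times to condition on. Instead \<open>phi\<close> is defined as the infinite
  product solving the equation, which then says that one jump (x, y) of the jump law preserves the
  mean of \<open>exp (\<zeta> * y) * phi (\<zeta> * c powr (- x))\<close>. In a time step h only two
  or more jumps cause an error, of order h^2, so refining Riemann sums yield the exact identity
  E[exp (\<zeta> Y_T) phi (\<zeta> c^(-N_T))] = phi \<zeta>. For large T the second factor tends to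
  1. All this happens on Re \<zeta> \<le> 0: the negative axis shows that the limit is finite, the
  imaginary axis identifies its law. Infinite divisibility is given by convolution roots, and the
  Levy measure may have infinite mass, so nonnegativity of an atom is extracted from the positive
  definiteness of the characteristic functions of the roots, tested by averages that isolate one
  point. The minimality at m = 1 in case (ii) is the concavity of the logarithm of a lacunary
  exponential sum as a function of the logarithm of its argument.\<close>

lemma two_y_y_minus_one_le_exp:
  fixes y :: real
  assumes "y \<ge> 1"
  shows "2 * y * (y - 1) \<le> exp y"
proof -
  have "exp (2::real) = exp 1 ^ 2" by (simp flip: exp_of_nat_mult)
  moreover have "exp (1::real) \<ge> 5/2" using exp_lower_Taylor_quadratic[of 1] by simp
  ultimately have e2: "exp (2::real) \<ge> 6"
    using power_mono[of "5/2" "exp (1::real)" 2] by (simp add: power2_eq_square)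
  \<comment> \<open>Centred at 0 the quadratic Taylor polynomial of exp has leading coefficient 1/2,
    too small against 2; centred at 2 the coefficient becomes at least 3.\<close>
  define z where "z = y - 2"
  have y: "y = z + 2" and ex: "exp y = exp 2 * exp z" by (auto simp: z_def simp flip: exp_add)
  show ?thesis
  proof (cases "z \<ge> 0")
    case True
    have "2 * y * (y - 1) \<le> 6 * (1 + z + z\<^sup>2 / 2)"
      using True by (simp add: y algebra_simps power2_eq_square)
    also have "\<dots> \<le> exp 2 * exp z"
      using True e2 exp_lower_Taylor_quadratic[of z] by (intro mult_mono) auto
    finally show ?thesis by (simp add: ex)
  next
    case False
    have z: "z \<ge> -1" using assms y by simp
    have "2 * y * (y - 1) = (2 * z + 4) * (1 + z)" by (simp add: y algebra_simps)
    also have "\<dots> \<le> 6 * (1 + z)" using False z by (intro mult_right_mono) auto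
    also have "\<dots> \<le> exp 2 * exp z"
      using False e2 exp_ge_add_one_self[of z] z by (intro mult_mono) auto
    finally show ?thesis by (simp add: ex)
  qed
qed

text \<open>The first term costs at most 1 / (2 y_0) by the preceding estimate, and the remaining
  terms, started at y_1 \<ge> 2 y_0, cost at most as much again by induction. The bound 1 / y_0 is
  the one that reproduces itself under doubling.\<close>

lemma sum_exp_minus_doubling_le:
  fixes y :: "nat \<Rightarrow> real"
  assumes "\<And>k. y (Suc k) \<ge> 2 * y k" "y 0 \<ge> 1"
  shows "(\<Sum>k<n. exp (- y k) * (y k - 1)) \<le> 1 / y 0"
  using assms
proof (induction n arbitrary: y)
  case (Suc n)
  have y1: "y 1 \<ge> 2 * y 0" using Suc.prems(1)[of 0] by simp
  have "2 * y 0 * (y 0 - 1) \<le> exp (y 0)" by (rule two_y_y_minus_one_le_exp) fact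
  hence "exp (- y 0) * (y 0 - 1) \<le> 1 / (2 * y 0)"
    using Suc.prems(2) by (simp add: exp_minus field_simps)
  moreover have "(\<Sum>k<n. exp (- y (Suc k)) * (y (Suc k) - 1)) \<le> 1 / y (Suc 0)"
    by (rule Suc.IH) (use Suc.prems(1) in blast, use y1 Suc.prems(2) in simp)
  moreover have "1 / y (Suc 0) \<le> 1 / (2 * y 0)"
    using y1 Suc.prems(2) by (intro divide_left_mono) auto
  moreover have "1 / (2 * y 0) + 1 / (2 * y 0) = 1 / y 0" using Suc.prems(2) by (simp add: field_simps)
  ultimately show ?case by (subst sum.lessThan_Suc_shift) linarith
qed simp

text \<open>Terms with y_k < 1 are nonpositive and can be discarded from the front until the
  sequence reaches 1, where the sharper bound 1 / y_0 applies.\<close>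

lemma sum_exp_minus_doubling_le_one:
  fixes y :: "nat \<Rightarrow> real"
  assumes "\<And>k. y (Suc k) \<ge> 2 * y k"
  shows "(\<Sum>k<n. exp (- y k) * (y k - 1)) \<le> 1"
  using assms
proof (induction n arbitrary: y)
  case (Suc n)
  show ?case
  proof (cases "y 0 \<ge> 1")
    case True
    have "(\<Sum>k<Suc n. exp (- y k) * (y k - 1)) \<le> 1 / y 0"
      by (rule sum_exp_minus_doubling_le) (use Suc.prems True in auto)
    also have "\<dots> \<le> 1" using True by simp
    finally show ?thesis .
  next
    case False
    have "exp (- y 0) * (y 0 - 1) \<le> 0" using False by (intro mult_nonneg_nonpos) auto
    moreover have "(\<Sum>k<n. exp (- y (Suc k)) * (y (Suc k) - 1)) \<le> 1"
      by (rule Suc.IH) (use Suc.prems in auto)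
    ultimately show ?thesis by (subst sum.lessThan_Suc_shift) linarith
  qed
qed simp

text \<open>Folds the entries below the diagonal onto those above, so that each pair can be
  estimated together in the row of its smaller index.\<close>

lemma sum_product_symmetrize:
  fixes B :: "nat \<Rightarrow> nat \<Rightarrow> real"
  shows "(\<Sum>i<T. \<Sum>j<T. B i j) = (\<Sum>i<T. B i i + (\<Sum>j\<in>{i<..<T}. B i j + B j i))"
proof (induction T)
  case (Suc T)
  have *: "(\<Sum>j\<in>{i<..<Suc T}. B i j + B j i) = (\<Sum>j\<in>{i<..<T}. B i j + B j i) + (B i T + B T i)"
    if "i < T" for i
  proof -
    have "{i<..<Suc T} = insert T {i<..<T}" using that by auto
    thus ?thesis by (simp add: add.commute)
  qed
  have "(\<Sum>i<Suc T. B i i + (\<Sum>j\<in>{i<..<Suc T}. B i j + B j i)) =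
     (\<Sum>i<T. B i i + ((\<Sum>j\<in>{i<..<T}. B i j + B j i) + (B i T + B T i))) + B T T"
  proof -
    have "{T<..<Suc T} = {}" by auto
    thus ?thesis using * by simp
  qed
  also have "\<dots> = (\<Sum>i<Suc T. \<Sum>j<Suc T. B i j)"
    by (simp add: sum.distrib Suc.IH[symmetric] algebra_simps)
      (simp add: Suc.IH sum.distrib)
  finally show ?case by simp
qed simp

text \<open>The numerator of the derivative of \<open>s g s / f s\<close> for \<open>f s = (\<Sum>t<T. exp (- a ^ t s) / a ^ t)\<close>
  and \<open>g = - f'\<close>, so the sign says that \<open>ln f\<close> is concave as a function of \<open>ln s\<close>.
  After symmetrizing the double sum, the row of \<open>i\<close> is bounded via the differences \<open>a ^ j s - a ^ i s\<close>.\<close>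

lemma lacunary_exp_sum_ineq:
  fixes s :: real and a T :: nat
  assumes s: "s > 0" and a: "a \<ge> 2"
  defines "f \<equiv> (\<Sum>t<T. exp (- (real a ^ t * s)) / real a ^ t)"
    and "g \<equiv> (\<Sum>t<T. exp (- (real a ^ t * s)))"
    and "k \<equiv> (\<Sum>t<T. real a ^ t * exp (- (real a ^ t * s)))"
  shows "(g - s * k) * f + s * g\<^sup>2 \<ge> 0"
proof -
  define x where "x t = real a ^ t * s" for t
  define w where "w t = exp (- x t)" for t
  have x: "x t > 0" for t using s a by (simp add: x_def)
  have w: "w t > 0" for t by (simp add: w_def)
  \<comment> \<open>The (i, j) term of the double sum that remains after a factor \<open>s\<close>
    is taken out: (g - s k) f contributes 1 / x_j - x_i / x_j, and s g^2 contributes 1.\<close>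
  define B where "B i j = w i * w j * (1 / x j - x i / x j + 1)" for i j
  have f: "f = s * (\<Sum>j<T. w j / x j)"
    unfolding f_def w_def x_def sum_distrib_left using s a by (intro sum.cong) (auto simp: field_simps)
  have gk: "g - s * k = (\<Sum>i<T. w i * (1 - x i))"
    unfolding g_def k_def w_def x_def sum_distrib_left sum_subtractf[symmetric]
    by (intro sum.cong) (auto simp: algebra_simps)
  have "(g - s * k) * f + s * g\<^sup>2 = s * ((\<Sum>i<T. w i * (1 - x i)) * (\<Sum>j<T. w j / x j) + (\<Sum>i<T. w i) * (\<Sum>j<T. w j))"
    unfolding gk f by (simp add: g_def w_def x_def power2_eq_square algebra_simps)
  also have "(\<Sum>i<T. w i * (1 - x i)) * (\<Sum>j<T. w j / x j) + (\<Sum>i<T. w i) * (\<Sum>j<T. w j)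
     = (\<Sum>i<T. \<Sum>j<T. B i j)"
    unfolding sum_product sum.distrib[symmetric]
    by (intro sum.cong refl) (simp add: B_def algebra_simps diff_divide_distrib)
  also have "\<dots> = (\<Sum>i<T. B i i + (\<Sum>j\<in>{i<..<T}. B i j + B j i))" by (rule sum_product_symmetrize)
  also have "\<dots> \<ge> (\<Sum>i<T. (w i)\<^sup>2 / x i * (1 - (\<Sum>j\<in>{i<..<T}. exp (- (x j - x i)) * ((x j - x i) - 1))))"
  proof (intro sum_mono)
    fix i assume i: "i \<in> {..<T}"
    have "B i j + B j i \<ge> (w i)\<^sup>2 / x i * (exp (- (x j - x i)) * (1 - (x j - x i)))" if j: "j \<in> {i<..<T}" for j
    proof -
      define R where "R = x j / x i"
      have xij: "x i \<le> x j" unfolding x_def using j a s by (intro mult_right_mono power_increasing) auto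
      hence R: "R \<ge> 1" using x[of i] by (simp add: R_def)
      have wj: "w j = w i * exp (- (x j - x i))" by (simp add: w_def flip: exp_add)
      have "x i / x j = 1 / R" by (simp add: R_def)
      hence eq: "B i j + B j i = w i * w j * (1 / x i + 1 / x j + 2 - R - 1 / R)"
        unfolding B_def R_def by (simp add: algebra_simps)
      \<comment> \<open>The loss R + 1 / R - 2 is at most R - 1 for R \<ge> 1; since x_i (R - 1) =
        x_j - x_i, this is what brings the differences into play.\<close>
      have "R - 1 - (R + 1 / R - 2) = (R - 1) / R" using R by (simp add: field_simps)
      hence "R + 1 / R - 2 \<le> R - 1" using R by (smt (verit) divide_nonneg_nonneg)
      hence "1 / x i + 1 / x j + 2 - R - 1 / R \<ge> 1 / x i - (R - 1)"
        using x[of j] by (smt (verit) divide_nonneg_pos)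
      also have "1 / x i - (R - 1) = (1 - (x j - x i)) / x i" using x[of i] by (simp add: R_def field_simps)
      finally have "w i * w j * ((1 - (x j - x i)) / x i) \<le> B i j + B j i"
        unfolding eq using w[of i] w[of j] by (intro mult_left_mono) auto
      moreover have "w i * w j * ((1 - (x j - x i)) / x i) = (w i)\<^sup>2 / x i * (exp (- (x j - x i)) * (1 - (x j - x i)))"
        by (simp add: wj power2_eq_square)
      ultimately show ?thesis by linarith
    qed
    hence "(\<Sum>j\<in>{i<..<T}. B i j + B j i) \<ge> (\<Sum>j\<in>{i<..<T}. (w i)\<^sup>2 / x i * (exp (- (x j - x i)) * (1 - (x j - x i))))"
      by (intro sum_mono) auto
    also have "(\<Sum>j\<in>{i<..<T}. (w i)\<^sup>2 / x i * (exp (- (x j - x i)) * (1 - (x j - x i)))) =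
      - ((w i)\<^sup>2 / x i * (\<Sum>j\<in>{i<..<T}. exp (- (x j - x i)) * ((x j - x i) - 1)))"
      unfolding sum_distrib_left sum_negf[symmetric] by (intro sum.cong) (auto simp: algebra_simps)
    finally have "(\<Sum>j\<in>{i<..<T}. B i j + B j i) \<ge> \<dots>" .
    moreover have "B i i = (w i)\<^sup>2 / x i" using x[of i] by (simp add: B_def power2_eq_square)
    ultimately show "(w i)\<^sup>2 / x i * (1 - (\<Sum>j\<in>{i<..<T}. exp (- (x j - x i)) * ((x j - x i) - 1)))
      \<le> B i i + (\<Sum>j\<in>{i<..<T}. B i j + B j i)"
      by (simp add: algebra_simps)
  qed
  moreover have "(\<Sum>i<T. (w i)\<^sup>2 / x i * (1 - (\<Sum>j\<in>{i<..<T}. exp (- (x j - x i)) * ((x j - x i) - 1)))) \<ge> 0"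
  proof (intro sum_nonneg mult_nonneg_nonneg)
    fix i assume "i \<in> {..<T}"
    show "(w i)\<^sup>2 / x i \<ge> 0" using x[of i] by simp
    \<comment> \<open>Subtracting the positive number x_i preserves the doubling property of the
      sequence: Z - Y \<ge> 2 (X - Y) whenever Z \<ge> 2 X and Y > 0.\<close>
    define y where "y n = x (Suc i + n) - x i" for n
    have yd: "y (Suc n) \<ge> 2 * y n" for n
    proof -
      have "x (Suc i + Suc n) = real a * x (Suc i + n)" by (simp add: x_def)
      moreover have "real a * x (Suc i + n) \<ge> 2 * x (Suc i + n)"
        using a x[of "Suc i + n"] by (intro mult_right_mono) auto
      ultimately have "x (Suc i + Suc n) \<ge> 2 * x (Suc i + n)" by metis
      moreover have "2 * (X - Y) \<le> Z - Y" if "Z \<ge> 2 * X" "Y > 0" for X Y Z :: real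
        using that by (simp add: algebra_simps)
      ultimately show ?thesis unfolding y_def using x[of i] by blast
    qed
    have "(\<Sum>j\<in>{i<..<T}. exp (- (x j - x i)) * ((x j - x i) - 1)) = (\<Sum>n<T - Suc i. exp (- y n) * (y n - 1))"
      by (rule sum.reindex_bij_witness[of _ "\<lambda>n. Suc i + n" "\<lambda>j. j - Suc i"]) (auto simp: y_def)
    also have "\<dots> \<le> 1" by (rule sum_exp_minus_doubling_le_one) (rule yd)
    finally show "0 \<le> 1 - (\<Sum>j\<in>{i<..<T}. exp (- (x j - x i)) * ((x j - x i) - 1))" by simp
  qed
  ultimately show ?thesis using s by (simp add: zero_le_mult_iff)
qed

text \<open>With D x = - d ln f / d ln x, the derivative of f (m z) / f z has the sign of D z - D (m
  z). The preceding inequality makes D nondecreasing, and m z \<ge> z. Finite sums keep the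
  differentiation elementary; T tends to infinity only afterwards.\<close>

lemma lacunary_exp_sum_ratio_antimono:
  fixes s s' :: real and a m T :: nat
  assumes s: "0 < s" "s \<le> s'" and a: "a \<ge> 2" and m: "m \<ge> 1" and T: "T \<ge> 1"
  defines "f \<equiv> (\<lambda>s. \<Sum>t<T. exp (- (real a ^ t * s)) / real a ^ t)"
  shows "f (m * s') * f s \<le> f (m * s) * f s'"
proof -
  define g where "g = (\<lambda>s. \<Sum>t<T. exp (- (real a ^ t * s)))"
  define k where "k = (\<lambda>s. \<Sum>t<T. real a ^ t * exp (- (real a ^ t * s)))"
  have fpos: "f x > 0" for x unfolding f_def using a T
    by (intro sum_pos) (auto simp: lessThan_empty_iff)
  have df: "(f has_real_derivative (- g x)) (at x)" for x
    unfolding f_def g_def using a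
    by (auto intro!: derivative_eq_intros simp: sum_negf field_simps)
  have dg: "(g has_real_derivative (- k x)) (at x)" for x
    unfolding g_def k_def by (auto intro!: derivative_eq_intros simp: sum_negf field_simps)
  define D where "D x = x * g x / f x" for x
  have Dmono: "D x \<le> D y" if "0 < x" "x \<le> y" for x y
  proof (rule DERIV_nonneg_imp_nondecreasing[OF that(2)])
    fix z assume z: "x \<le> z" "z \<le> y"
    have "(D has_real_derivative ((g z - z * k z) * f z + z * (g z)\<^sup>2) / (f z)\<^sup>2) (at z)"
      unfolding D_def using fpos[of z]
      by (auto intro!: derivative_eq_intros df dg simp: field_simps power2_eq_square)
    moreover have "((g z - z * k z) * f z + z * (g z)\<^sup>2) / (f z)\<^sup>2 \<ge> 0"
      using lacunary_exp_sum_ineq[of z a T] z that a unfolding f_def g_def k_def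
      by (intro divide_nonneg_nonneg) auto
    ultimately show "\<exists>d. (D has_real_derivative d) (at z) \<and> d \<ge> 0" by blast
  qed
  have "f (m * s') / f s' \<le> f (m * s) / f s"
  proof (rule DERIV_nonpos_imp_nonincreasing[OF s(2)])
    fix z assume z: "s \<le> z" "z \<le> s'"
    have dfm: "((\<lambda>z. f (real m * z)) has_real_derivative (- g (real m * z) * real m)) (at z)"
      by (rule DERIV_chain2[OF df]) (auto intro!: derivative_eq_intros)
    have "((\<lambda>z. f (m * z) / f z) has_real_derivative (f (m * z) / (z * f z) * (D z - D (m * z)))) (at z)"
    proof (rule DERIV_cong[OF DERIV_divide[OF dfm df]])
      show "f z \<noteq> 0" using fpos[of z] by simp
      show "(- g (real m * z) * real m * f z - f (real m * z) * - g z) / (f z * f z) =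
        f (m * z) / (z * f z) * (D z - D (m * z))"
        using fpos[of z] fpos[of "m * z"] z s unfolding D_def by (simp add: field_simps)
    qed
    moreover have "z \<le> m * z" using m z s by simp
    hence "D z \<le> D (m * z)" using z s by (intro Dmono) auto
    hence "f (m * z) / (z * f z) * (D z - D (m * z)) \<le> 0"
      using fpos[of z] fpos[of "m * z"] z s by (intro mult_nonneg_nonpos) (auto intro!: divide_nonneg_nonneg)
    ultimately show "\<exists>d. ((\<lambda>z. f (m * z) / f z) has_real_derivative d) (at z) \<and> d \<le> 0" by blast
  qed
  thus ?thesis using fpos[of s] fpos[of s'] by (simp add: field_simps)
qed

section \<open>The function F, the defining property of h, and the reduction to m = 1\<close>

lemma F_fun_summable:
  fixes x :: real
  assumes "\<alpha> \<ge> 2" "0 \<le> x" "x \<le> 1"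
  shows "summable (\<lambda>n. (1 / real \<alpha>) ^ n * x ^ (2 * \<alpha> ^ n))"
proof (rule summable_comparison_test'[where N = 0])
  show "summable (\<lambda>n. (1 / real \<alpha>) ^ n)" using assms by (intro summable_geometric) auto
  show "norm ((1 / real \<alpha>) ^ n * x ^ (2 * \<alpha> ^ n)) \<le> (1 / real \<alpha>) ^ n" for n
    using assms by (auto simp: abs_mult intro!: mult_left_le power_le_one)
qed

lemma F_fun_lim:
  assumes "\<alpha> \<ge> 2" "0 \<le> x" "x \<le> 1"
  shows "(\<lambda>T. \<Sum>n<T. (1 / real \<alpha>) ^ n * x ^ (2 * \<alpha> ^ n)) \<longlonglongrightarrow> F_fun \<alpha> x"
  unfolding F_fun_def by (rule summable_LIMSEQ[OF F_fun_summable[OF assms]])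

lemma F_fun_strict_mono:
  assumes "\<alpha> \<ge> 2" "0 \<le> x" "x < y" "y \<le> 1"
  shows "F_fun \<alpha> x < F_fun \<alpha> y"
proof -
  have s: "summable (\<lambda>n. (1 / real \<alpha>) ^ n * x ^ (2 * \<alpha> ^ n))" "summable (\<lambda>n. (1 / real \<alpha>) ^ n * y ^ (2 * \<alpha> ^ n))"
    using F_fun_summable[of \<alpha> x] F_fun_summable[of \<alpha> y] assms by auto
  have "(1 / real \<alpha>) ^ n * x ^ (2 * \<alpha> ^ n) < (1 / real \<alpha>) ^ n * y ^ (2 * \<alpha> ^ n)" for n
    using assms by (intro mult_strict_left_mono power_strict_mono) auto
  hence "0 < (\<Sum>n. (1 / real \<alpha>) ^ n * y ^ (2 * \<alpha> ^ n) - (1 / real \<alpha>) ^ n * x ^ (2 * \<alpha> ^ n))"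
    by (intro suminf_pos summable_diff s) (simp del: power_divide)
  thus ?thesis unfolding F_fun_def by (subst (asm) suminf_diff[OF s(2,1), symmetric]) simp
qed

lemma F_fun_mono:
  assumes "\<alpha> \<ge> 2" "0 \<le> x" "x \<le> y" "y \<le> 1"
  shows "F_fun \<alpha> x \<le> F_fun \<alpha> y"
  using F_fun_strict_mono[of \<alpha> x y] assms by (cases "x = y") auto

lemma F_fun_0: "\<alpha> \<ge> 2 \<Longrightarrow> F_fun \<alpha> 0 = 0"
  unfolding F_fun_def by (simp add: power_0_left)

lemma F_fun_pos:
  assumes "\<alpha> \<ge> 2" "0 < x" "x \<le> 1"
  shows "F_fun \<alpha> x > 0"
  using F_fun_strict_mono[of \<alpha> 0 x] assms by (simp add: F_fun_0)

lemma F_fun_continuous: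
  assumes "\<alpha> \<ge> 2"
  shows "continuous_on {0..1} (F_fun \<alpha>)"
proof (rule uniform_limit_theorem)
  show "uniform_limit {0..1} (\<lambda>T x. \<Sum>n<T. (1 / real \<alpha>) ^ n * x ^ (2 * \<alpha> ^ n)) (F_fun \<alpha>) sequentially"
    unfolding F_fun_def[abs_def]
  proof (rule Weierstrass_m_test)
    show "summable (\<lambda>n. (1 / real \<alpha>) ^ n)" using assms by (intro summable_geometric) auto
    show "norm ((1 / real \<alpha>) ^ n * x ^ (2 * \<alpha> ^ n)) \<le> (1 / real \<alpha>) ^ n" if "x \<in> {0..1}" for n x
      using that by (auto simp: abs_mult intro!: mult_left_le power_le_one)
  qed
qed (auto intro!: always_eventually continuous_intros)

text \<open>The factor \<alpha>^(-\<gamma>) lies strictly between 0 and 1, so the intermediate value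
  theorem gives a solution in (0, x) and strict monotonicity makes it the only one; this turns the
  definite description in \<open>h_fun\<close> into usable facts.\<close>

lemma h_fun_properties:
  assumes \<alpha>: "\<alpha> \<ge> 2" and \<gamma>: "\<gamma> \<ge> 1" and x: "0 < x" "x \<le> 1"
  shows "0 < h_fun \<alpha> \<gamma> x" "h_fun \<alpha> \<gamma> x < x" "(1 / real \<alpha>) ^ \<gamma> * F_fun \<alpha> x = F_fun \<alpha> (h_fun \<alpha> \<gamma> x)"
proof -
  let ?v = "(1 / real \<alpha>) ^ \<gamma> * F_fun \<alpha> x"
  have Fx: "F_fun \<alpha> x > 0" using F_fun_pos \<alpha> x by blast
  have lt: "(1 / real \<alpha>) ^ \<gamma> < 1" using \<alpha> \<gamma> by (intro power_less_one_iff[THEN iffD2]) auto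
  have v: "0 < ?v" "?v < F_fun \<alpha> x" using Fx \<alpha> lt by (auto simp: mult_less_cancel_right1 simp del: power_divide)
  have "\<exists>y\<ge>0. y \<le> x \<and> F_fun \<alpha> y = ?v"
  proof (rule IVT')
    show "F_fun \<alpha> 0 \<le> ?v" "?v \<le> F_fun \<alpha> x" "0 \<le> x" using v x by (simp_all only: F_fun_0[OF \<alpha>] less_imp_le)
    show "continuous_on {0..x} (F_fun \<alpha>)"
      by (rule continuous_on_subset[OF F_fun_continuous[OF \<alpha>]]) (use x in auto)
  qed
  then obtain y where y: "y \<ge> 0" "y \<le> x" "F_fun \<alpha> y = ?v" by blast
  have "y \<noteq> 0" "y \<noteq> x" using y(3) v F_fun_0[OF \<alpha>] by (metis less_irrefl)+
  hence P: "0 < y \<and> y < x \<and> ?v = F_fun \<alpha> y" using y by auto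
  have "h_fun \<alpha> \<gamma> x = y" unfolding h_fun_def
  proof (rule the_equality)
    show "0 < y \<and> y < x \<and> ?v = F_fun \<alpha> y" by (rule P)
    fix z assume z: "0 < z \<and> z < x \<and> ?v = F_fun \<alpha> z"
    show "z = y"
      using F_fun_strict_mono[OF \<alpha>, of z y] F_fun_strict_mono[OF \<alpha>, of y z] z P x
      by (cases z y rule: linorder_cases) auto
  qed
  thus "0 < h_fun \<alpha> \<gamma> x" "h_fun \<alpha> \<gamma> x < x" "?v = F_fun \<alpha> (h_fun \<alpha> \<gamma> x)" using P by auto
qed

text \<open>Writing x = exp (- s / 2) turns x^(2 \<alpha>^t) into exp (- \<alpha>^t s) and the power
  x^m into the dilation of s by m, so that the partial sums of \<open>F_fun\<close> are the lacunary
  exponential sums above.\<close>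

lemma F_fun_power_ratio_mono:
  fixes h Q :: real
  assumes \<alpha>: "\<alpha> \<ge> 2" and hQ: "0 < h" "h \<le> Q" "Q < 1" and m: "m \<ge> 1"
  shows "F_fun \<alpha> (h ^ m) * F_fun \<alpha> Q \<le> F_fun \<alpha> (Q ^ m) * F_fun \<alpha> h"
proof (rule LIMSEQ_le)
  define F where "F T x = (\<Sum>n<T. (1 / real \<alpha>) ^ n * x ^ (2 * \<alpha> ^ n))" for T x
  have F_eq: "F T (x ^ m) = (\<Sum>t<T. exp (- (real \<alpha> ^ t * (real m * (-2 * ln x)))) / real \<alpha> ^ t)"
    if "x > 0" for T x m
  proof -
    have "(x ^ m) ^ (2 * \<alpha> ^ t) = exp (- (real \<alpha> ^ t * (real m * (-2 * ln x))))" for t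
    proof -
      have "exp (- (real \<alpha> ^ t * (real m * (-2 * ln x)))) = exp (real (m * (2 * \<alpha> ^ t)) * ln x)"
        by (simp add: mult_ac)
      also have "\<dots> = x ^ (m * (2 * \<alpha> ^ t))"
        unfolding exp_of_nat_mult using that by simp
      finally show ?thesis by (simp add: power_mult)
    qed
    thus ?thesis by (simp add: F_def power_one_over field_simps)
  qed
  have le: "h ^ m \<le> 1" "Q ^ m \<le> 1" using hQ by (auto intro!: power_le_one)
  show "(\<lambda>T. F T (h ^ m) * F T Q) \<longlonglongrightarrow> F_fun \<alpha> (h ^ m) * F_fun \<alpha> Q"
    "(\<lambda>T. F T (Q ^ m) * F T h) \<longlonglongrightarrow> F_fun \<alpha> (Q ^ m) * F_fun \<alpha> h"
    unfolding F_def using \<alpha> hQ le by (auto intro!: tendsto_mult F_fun_lim simp del: power_divide)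
  show "\<exists>N. \<forall>T\<ge>N. F T (h ^ m) * F T Q \<le> F T (Q ^ m) * F T h"
  proof (intro exI[of _ 1] allI impI)
    fix T :: nat assume T: "T \<ge> 1"
    have "ln h \<le> ln Q" "ln Q < 0" using hQ by auto
    hence "0 < -2 * ln Q" "-2 * ln Q \<le> -2 * ln h" by auto
    from lacunary_exp_sum_ratio_antimono[OF this \<alpha> m T]
    show "F T (h ^ m) * F T Q \<le> F T (Q ^ m) * F T h"
      using F_eq[of h T m] F_eq[of h T 1] F_eq[of Q T m] F_eq[of Q T 1] hQ by simp
  qed
qed

text \<open>Forward, F (\<rho>^m) \<le> F (h^m), and the ratio bound compares F (h^m) with F (Q^m)
  at the price F h / F Q = \<alpha>^(-\<gamma>). Backward, m = 1 suffices.\<close>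

lemma h_fun_ge_iff:
  fixes \<rho> q :: real
  assumes \<alpha>: "\<alpha> \<ge> 2" and \<gamma>: "\<gamma> \<ge> 1" and \<rho>: "0 < \<rho>" "\<rho> < 1" and Q: "0 < Q" "Q < 1"
  shows "\<rho> \<le> h_fun \<alpha> \<gamma> Q \<longleftrightarrow> (\<forall>m\<ge>1. F_fun \<alpha> (\<rho> ^ m) \<le> (1 / real \<alpha>) ^ \<gamma> * F_fun \<alpha> (Q ^ m))"
proof -
  define h where "h = h_fun \<alpha> \<gamma> Q"
  have h: "0 < h" "h < Q" "(1 / real \<alpha>) ^ \<gamma> * F_fun \<alpha> Q = F_fun \<alpha> h"
    using h_fun_properties[OF \<alpha> \<gamma>, of Q] Q by (auto simp: h_def)
  show ?thesis unfolding h_def[symmetric]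
  proof
    assume \<rho>h: "\<rho> \<le> h"
    show "\<forall>m\<ge>1. F_fun \<alpha> (\<rho> ^ m) \<le> (1 / real \<alpha>) ^ \<gamma> * F_fun \<alpha> (Q ^ m)"
    proof (intro allI impI)
      fix m :: nat assume m: "m \<ge> 1"
      have FQ: "F_fun \<alpha> Q > 0" using F_fun_pos \<alpha> Q by simp
      have "F_fun \<alpha> (\<rho> ^ m) \<le> F_fun \<alpha> (h ^ m)"
        using \<alpha> \<rho> \<rho>h h Q by (intro F_fun_mono power_mono) (auto intro!: power_le_one)
      also have "\<dots> \<le> F_fun \<alpha> (Q ^ m) * F_fun \<alpha> h / F_fun \<alpha> Q"
        using F_fun_power_ratio_mono[OF \<alpha> h(1) _ Q(2) m] h FQ by (simp add: field_simps)
      also have "\<dots> = (1 / real \<alpha>) ^ \<gamma> * F_fun \<alpha> (Q ^ m)"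
        using FQ by (simp flip: h(3))
      finally show "F_fun \<alpha> (\<rho> ^ m) \<le> (1 / real \<alpha>) ^ \<gamma> * F_fun \<alpha> (Q ^ m)" .
    qed
  next
    assume "\<forall>m\<ge>1. F_fun \<alpha> (\<rho> ^ m) \<le> (1 / real \<alpha>) ^ \<gamma> * F_fun \<alpha> (Q ^ m)"
    hence "F_fun \<alpha> \<rho> \<le> F_fun \<alpha> h" using h(3) by (metis le_refl power_one_right)
    thus "\<rho> \<le> h" using F_fun_strict_mono[OF \<alpha>, of h \<rho>] h \<rho> by (meson not_less less_imp_le leD)
  qed
qed

section \<open>Compound Poisson distributions\<close>

lemma integral_bind_pmf_bounded_real:
  fixes f :: "'b \<Rightarrow> real"
  assumes "\<And>x. \<bar>f x\<bar> \<le> B"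
  shows "(LINT x|measure_pmf (bind_pmf M N). f x) = (LINT i|measure_pmf M. LINT y|measure_pmf (N i). f y)"
  unfolding measure_pmf_bind
proof (rule integral_bind[where K = "count_space UNIV" and B = B and B' = 1])
  show "finite_measure (measure_pmf M)" by unfold_locales
qed (use assms measurable_measure_pmf[of N] in \<open>auto simp: measure_pmf.emeasure_space_1\<close>)

text \<open>The bound is required on the support only: test functions used later are bounded on a
  quadrant but not on the whole plane. Cutting \<open>f\<close> off outside the support makes the
  bounded version applicable, separately to real and imaginary parts.\<close>

lemma integral_bind_pmf_bounded:
  fixes f :: "'b \<Rightarrow> complex"
  assumes "\<And>x. x \<in> set_pmf (bind_pmf M N) \<Longrightarrow> norm (f x) \<le> B"
  shows "(LINT x|measure_pmf (bind_pmf M N). f x) = (LINT i|measure_pmf M. LINT y|measure_pmf (N i). f y)"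
proof -
  define g where "g x = (if x \<in> set_pmf (bind_pmf M N) then f x else 0)" for x
  have g: "norm (g x) \<le> max B 0" for x
    using assms[of x] by (cases "x \<in> set_pmf (bind_pmf M N)") (simp_all add: g_def del: set_bind_pmf)
  have gi: "integrable (measure_pmf K) g" for K
    by (rule measure_pmf.integrable_const_bound[where B = "max B 0"]) (use g in auto)
  have gb: "norm (LINT y|measure_pmf (N i). g y) \<le> max B 0" for i
  proof -
    have "norm (LINT y|measure_pmf (N i). g y) \<le> (LINT y|measure_pmf (N i). norm (g y))" by (rule integral_norm_bound)
    also have "\<dots> \<le> (LINT y|measure_pmf (N i). max B 0)"
      by (intro integral_mono) (use g gi in auto)
    finally show ?thesis by (simp add: measure_pmf.prob_space)
  qed
  have gi2: "integrable (measure_pmf M) (\<lambda>i. LINT y|measure_pmf (N i). g y)"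
    by (rule measure_pmf.integrable_const_bound[where B = "max B 0"]) (use gb in auto)
  have fg: "(LINT x|measure_pmf K. f x) = (LINT x|measure_pmf K. g x)" if "set_pmf K \<subseteq> set_pmf (bind_pmf M N)" for K
    by (intro integral_cong_AE) (use that in \<open>auto simp: g_def AE_measure_pmf_iff\<close>)
  have "(LINT x|measure_pmf (bind_pmf M N). g x) = (LINT i|measure_pmf M. LINT y|measure_pmf (N i). g y)"
  proof (rule complex_eqI)
    have "\<bar>Re (g x)\<bar> \<le> max B 0" "\<bar>Im (g x)\<bar> \<le> max B 0" for x
      using abs_Re_le_cmod[of "g x"] abs_Im_le_cmod[of "g x"] g[of x] by linarith+
    note * = this[THEN integral_bind_pmf_bounded_real]
    show "Re (LINT x|measure_pmf (bind_pmf M N). g x) = Re (LINT i|measure_pmf M. LINT y|measure_pmf (N i). g y)"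
      "Im (LINT x|measure_pmf (bind_pmf M N). g x) = Im (LINT i|measure_pmf M. LINT y|measure_pmf (N i). g y)"
      using *[of M N] by (simp_all only: integral_Re[OF gi, symmetric] integral_Im[OF gi, symmetric] integral_Re[OF gi2, symmetric] integral_Im[OF gi2, symmetric])
  qed
  moreover have "(LINT i|measure_pmf M. LINT y|measure_pmf (N i). f y) = (LINT i|measure_pmf M. LINT y|measure_pmf (N i). g y)"
    by (intro integral_cong_AE) (auto simp: AE_measure_pmf_iff intro!: fg)
  ultimately show ?thesis using fg[of "bind_pmf M N"] by simp
qed

lemma sums_integral_poisson_pmf:
  fixes h :: "nat \<Rightarrow> complex"
  assumes x: "x > 0" and h: "\<And>j. norm (h j) \<le> B"
  shows "(\<lambda>j. of_real (x ^ j / fact j * exp (- x)) * h j) sums (LINT j|measure_pmf (poisson_pmf x). h j)"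
proof -
  have "integrable (measure_pmf (poisson_pmf x)) h"
    by (rule measure_pmf.integrable_const_bound[where B = B]) (use h in auto)
  hence "integrable (count_space UNIV) (\<lambda>j. pmf (poisson_pmf x) j *\<^sub>R h j)"
    unfolding measure_pmf_eq_density by (subst (asm) integrable_density) auto
  from sums_integral_count_space_nat[OF this]
  have "(\<lambda>j. pmf (poisson_pmf x) j *\<^sub>R h j) sums (LINT j|count_space UNIV. pmf (poisson_pmf x) j *\<^sub>R h j)" .
  also have "(LINT j|count_space UNIV. pmf (poisson_pmf x) j *\<^sub>R h j) = (LINT j|measure_pmf (poisson_pmf x). h j)"
    unfolding measure_pmf_eq_density by (subst integral_density) auto
  finally show ?thesis using x by (simp add: scaleR_conv_of_real)
qed

section \<open>Random walks observed at a Poisson time\<close>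

primrec walk_pmf :: "'a :: comm_monoid_add pmf \<Rightarrow> nat \<Rightarrow> 'a pmf" where
  "walk_pmf Q 0 = return_pmf 0"
| "walk_pmf Q (Suc n) = bind_pmf Q (\<lambda>x. map_pmf (\<lambda>y. x + y) (walk_pmf Q n))"

definition compound_poisson_pmf :: "real \<Rightarrow> 'a :: comm_monoid_add pmf \<Rightarrow> 'a pmf" where
  "compound_poisson_pmf x Q = bind_pmf (poisson_pmf x) (walk_pmf Q)"

lemma walk_pmf_Suc_0: "walk_pmf Q (Suc 0) = Q"
  by (simp add: bind_return_pmf')

lemma set_walk_pmf:
  assumes "0 \<in> S" "\<And>a b. a \<in> S \<Longrightarrow> b \<in> S \<Longrightarrow> a + b \<in> S" "set_pmf Q \<subseteq> S"
  shows "set_pmf (walk_pmf Q n) \<subseteq> S"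
  using assms by (induction n) auto

lemma set_compound_poisson_pmf:
  assumes "0 \<in> S" "\<And>a b. a \<in> S \<Longrightarrow> b \<in> S \<Longrightarrow> a + b \<in> S" "set_pmf Q \<subseteq> S"
  shows "set_pmf (compound_poisson_pmf x Q) \<subseteq> S"
  using set_walk_pmf[OF assms] unfolding compound_poisson_pmf_def by auto

lemma norm_integral_pmf_le:
  fixes f :: "'a \<Rightarrow> complex"
  assumes "\<And>x. x \<in> set_pmf Q \<Longrightarrow> norm (f x) \<le> B"
  shows "norm (LINT x|measure_pmf Q. f x) \<le> B"
proof -
  have "norm (LINT x|measure_pmf Q. f x) \<le> (LINT x|measure_pmf Q. norm (f x))" by (rule integral_norm_bound)
  also have "\<dots> \<le> B"
    by (rule measure_pmf.integral_le_const)
      (use assms in \<open>auto simp: AE_measure_pmf_iff intro!: measure_pmf.integrable_const_bound[where B = B]\<close>)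
  finally show ?thesis .
qed

text \<open>The steps are independent and \<open>f\<close> is multiplicative, so the mean is a
  power. The submonoid \<open>S\<close> admits functions such as c powr (- fst x), which are bounded
  by 1 only where the first coordinate is nonnegative.\<close>

lemma integral_walk_pmf_mult:
  fixes f :: "'a :: comm_monoid_add \<Rightarrow> complex"
  assumes S: "0 \<in> S" "\<And>a b. a \<in> S \<Longrightarrow> b \<in> S \<Longrightarrow> a + b \<in> S" "set_pmf Q \<subseteq> S"
    and f: "\<And>x. x \<in> S \<Longrightarrow> norm (f x) \<le> 1" "f 0 = 1" "\<And>a b. a \<in> S \<Longrightarrow> b \<in> S \<Longrightarrow> f (a + b) = f a * f b"
  shows "(LINT x|measure_pmf (walk_pmf Q n). f x) = (LINT x|measure_pmf Q. f x) ^ n"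
proof (induction n)
  case 0
  show ?case by (simp add: f integral_measure_pmf[of "{0}"])
next
  case (Suc n)
  have "(LINT x|measure_pmf (walk_pmf Q (Suc n)). f x) = (LINT a|measure_pmf Q. LINT b|measure_pmf (walk_pmf Q n). f (a + b))"
    using set_walk_pmf[OF S, of "Suc n"] f(1)
    unfolding walk_pmf.simps by (subst integral_bind_pmf_bounded[where B = 1]) auto
  also have "\<dots> = (LINT a|measure_pmf Q. f a * (LINT b|measure_pmf (walk_pmf Q n). f b))"
  proof (intro integral_cong_AE)
    have "(LINT b|measure_pmf (walk_pmf Q n). f (a + b)) = f a * (LINT b|measure_pmf (walk_pmf Q n). f b)"
      if "a \<in> set_pmf Q" for a
    proof -
      have "(LINT b|measure_pmf (walk_pmf Q n). f (a + b)) = (LINT b|measure_pmf (walk_pmf Q n). f a * f b)"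
        using that S(3) set_walk_pmf[OF S, of n] by (intro integral_cong_AE) (auto simp: AE_measure_pmf_iff intro!: f)
      thus ?thesis by simp
    qed
    thus "AE a in measure_pmf Q. (LINT b|measure_pmf (walk_pmf Q n). f (a + b)) = f a * (LINT b|measure_pmf (walk_pmf Q n). f b)"
      by (simp add: AE_measure_pmf_iff)
  qed auto
  also have "\<dots> = (LINT x|measure_pmf Q. f x) ^ Suc n" by (simp add: Suc.IH)
  finally show ?case .
qed

lemma integral_compound_poisson_pmf_mult:
  fixes f :: "'a :: comm_monoid_add \<Rightarrow> complex"
  assumes S: "0 \<in> S" "\<And>a b. a \<in> S \<Longrightarrow> b \<in> S \<Longrightarrow> a + b \<in> S" "set_pmf Q \<subseteq> S"
    and f: "\<And>x. x \<in> S \<Longrightarrow> norm (f x) \<le> 1" "f 0 = 1" "\<And>a b. a \<in> S \<Longrightarrow> b \<in> S \<Longrightarrow> f (a + b) = f a * f b"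
    and x: "x > 0"
  shows "(LINT y|measure_pmf (compound_poisson_pmf x Q). f y) = exp (of_real x * ((LINT y|measure_pmf Q. f y) - 1))"
proof -
  define c where "c = (LINT y|measure_pmf Q. f y)"
  have c: "norm c \<le> 1" unfolding c_def by (rule norm_integral_pmf_le) (use f S in auto)
  have "(LINT y|measure_pmf (compound_poisson_pmf x Q). f y) = (LINT j|measure_pmf (poisson_pmf x). LINT y|measure_pmf (walk_pmf Q j). f y)"
    unfolding compound_poisson_pmf_def
    by (rule integral_bind_pmf_bounded[where B = 1])
      (use set_compound_poisson_pmf[OF S, where x = x] f(1) in \<open>auto simp: compound_poisson_pmf_def\<close>)
  also have "\<dots> = (LINT j|measure_pmf (poisson_pmf x). c ^ j)"
    using integral_walk_pmf_mult[OF S f] by (simp add: c_def)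
  finally have *: "(\<lambda>j. of_real (x ^ j / fact j * exp (- x)) * c ^ j) sums (LINT y|measure_pmf (compound_poisson_pmf x Q). f y)"
    using sums_integral_poisson_pmf[OF x, of "\<lambda>j. c ^ j" 1] c by (simp add: norm_power power_le_one)
  have "(\<lambda>j. of_real (exp (- x)) * ((of_real x * c) ^ j /\<^sub>R fact j)) sums (of_real (exp (- x)) * exp (of_real x * c))"
    by (intro sums_mult exp_converges)
  also have "(\<lambda>j. of_real (exp (- x)) * ((of_real x * c) ^ j /\<^sub>R fact j)) = (\<lambda>j. of_real (x ^ j / fact j * exp (- x)) * c ^ j)"
    by (auto simp: scaleR_conv_of_real field_simps power_mult_distrib)
  finally have "(LINT y|measure_pmf (compound_poisson_pmf x Q). f y) = of_real (exp (- x)) * exp (of_real x * c)"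
    using * sums_unique2 by blast
  also have "of_real (exp (- x)) = exp (- of_real x :: complex)" by (simp flip: exp_of_real)
  also have "exp (- of_real x) * exp (of_real x * c) = exp (of_real x * (c - 1))"
    by (simp add: algebra_simps flip: exp_add)
  finally show ?thesis by (simp add: c_def)
qed

text \<open>If one jump does not change the expectation of \<open>f\<close>, only two or more jumps contribute.\<close>

lemma integral_compound_poisson_pmf_near:
  fixes f :: "'a :: comm_monoid_add \<Rightarrow> complex"
  assumes S: "0 \<in> S" "\<And>a b. a \<in> S \<Longrightarrow> b \<in> S \<Longrightarrow> a + b \<in> S" "set_pmf Q \<subseteq> S"
    and f: "\<And>x. x \<in> S \<Longrightarrow> norm (f x) \<le> 1" "(LINT y|measure_pmf Q. f y) = f 0"
    and x: "x > 0"
  shows "norm ((LINT y|measure_pmf (compound_poisson_pmf x Q). f y) - f 0) \<le> 2 * x\<^sup>2"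
proof -
  define H where "H j = (LINT y|measure_pmf (walk_pmf Q j). f y)" for j
  have H: "norm (H j) \<le> 1" for j
    unfolding H_def by (rule norm_integral_pmf_le) (use f set_walk_pmf[OF S] in auto)
  have H01: "H 0 = f 0" "H (Suc 0) = f 0"
    using f(2) unfolding H_def walk_pmf_Suc_0 by (auto simp: integral_measure_pmf[of "{0}"])
  have "(LINT y|measure_pmf (compound_poisson_pmf x Q). f y) = (LINT j|measure_pmf (poisson_pmf x). H j)"
    unfolding compound_poisson_pmf_def H_def
    by (rule integral_bind_pmf_bounded[where B = 1])
      (use set_compound_poisson_pmf[OF S, where x = x] f(1) in \<open>auto simp: compound_poisson_pmf_def\<close>)
  also have "\<dots> - f 0 = (LINT j|measure_pmf (poisson_pmf x). H j - f 0)"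
    by (subst Bochner_Integration.integral_diff)
      (auto simp: measure_pmf.prob_space H intro!: measure_pmf.integrable_const_bound[where B = 1])
  also have "norm \<dots> \<le> (LINT j|measure_pmf (poisson_pmf x). norm (H j - f 0))" by (rule integral_norm_bound)
  also have "\<dots> \<le> (LINT j|measure_pmf (poisson_pmf x). 2 * indicator {2..} j)"
  proof (intro integral_mono)
    have 2: "norm (H j - f 0) \<le> 2" for j
      using norm_triangle_ineq4[of "H j" "f 0"] H[of j] f(1)[OF S(1)] by linarith
    show "integrable (measure_pmf (poisson_pmf x)) (\<lambda>j. norm (H j - f 0))"
      by (rule measure_pmf.integrable_const_bound[where B = 2])
        (use 2 in auto)
    show "integrable (measure_pmf (poisson_pmf x)) (\<lambda>j. 2 * indicator {2..} j :: real)"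
      by (rule measure_pmf.integrable_const_bound[where B = 2]) (auto simp: indicator_def)
    show "norm (H j - f 0) \<le> 2 * indicator {2..} j" for j
    proof (cases "j \<ge> 2")
      case True
      thus ?thesis using 2[of j] by simp
    next
      case False
      hence "j = 0 \<or> j = Suc 0" by auto
      thus ?thesis using H01 by auto
    qed
  qed
  also have "\<dots> = 2 * measure (measure_pmf (poisson_pmf x)) {2..}" by simp
  also have "measure (measure_pmf (poisson_pmf x)) {2..} = 1 - measure (measure_pmf (poisson_pmf x)) {0, 1}"
  proof -
    have "- {0, 1} = {2::nat..}" by auto
    thus ?thesis using measure_pmf.prob_compl[of "{0, 1}" "poisson_pmf x"] by (simp add: Compl_eq_Diff_UNIV)
  qed
  also have "measure (measure_pmf (poisson_pmf x)) {0, 1} = exp (- x) + x * exp (- x)"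
    using x by (subst measure_measure_pmf_finite) auto
  \<comment> \<open>The probability of two or more jumps: exp (- x) \<ge> 1 - x gives (1 + x) exp (-
    x) \<ge> 1 - x^2.\<close>
  also have "1 - (exp (- x) + x * exp (- x)) \<le> x\<^sup>2"
  proof -
    have "1 - x \<le> exp (- x)" using exp_ge_add_one_self[of "- x"] by simp
    hence "(1 - x) * (1 + x) \<le> exp (- x) * (1 + x)" using x by (intro mult_right_mono) auto
    thus ?thesis by (simp add: algebra_simps power2_eq_square)
  qed
  finally show ?thesis by simp
qed

lemma nn_integral_poisson_pmf_id:
  assumes x: "x > 0"
  shows "(\<integral>\<^sup>+j. ennreal (real j) \<partial>measure_pmf (poisson_pmf x)) = ennreal x"
proof -
  have "(\<integral>\<^sup>+j. ennreal (real j) \<partial>measure_pmf (poisson_pmf x)) = (\<integral>\<^sup>+j. ennreal (pmf (poisson_pmf x) j * real j) \<partial>count_space UNIV)"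
    unfolding measure_pmf_eq_density by (subst nn_integral_density) (auto simp: ennreal_mult)
  also have "\<dots> = (\<Sum>j. ennreal (pmf (poisson_pmf x) j * real j))" by (rule nn_integral_count_space_nat)
  also have "\<dots> = ennreal x"
  proof (rule suminf_ennreal_eq)
    have "(\<lambda>j. x * exp (- x) * (x ^ j /\<^sub>R fact j)) sums (x * exp (- x) * exp x)"
      by (intro sums_mult exp_converges)
    also have "(\<lambda>j. x * exp (- x) * (x ^ j /\<^sub>R fact j)) = (\<lambda>j. pmf (poisson_pmf x) (Suc j) * real (Suc j))"
      using x by (auto simp: field_simps simp del: of_nat_Suc)
    also have "x * exp (- x) * exp x = x" by (simp add: mult.assoc flip: exp_add)
    finally have "(\<lambda>j. pmf (poisson_pmf x) (Suc j) * real (Suc j)) sums x" .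
    thus "(\<lambda>j. pmf (poisson_pmf x) j * real j) sums x"
      using sums_Suc_iff[of "\<lambda>j. pmf (poisson_pmf x) j * real j" x] by simp
  qed auto
  finally show ?thesis .
qed

lemma nn_integral_norm_walk_pmf_le:
  fixes Q :: "'a :: real_normed_vector pmf"
  shows "(\<integral>\<^sup>+y. norm y \<partial>measure_pmf (walk_pmf Q n)) \<le> of_nat n * (\<integral>\<^sup>+y. norm y \<partial>measure_pmf Q)"
proof (induction n)
  case (Suc n)
  have "(\<integral>\<^sup>+y. norm y \<partial>measure_pmf (walk_pmf Q (Suc n))) = (\<integral>\<^sup>+a. \<integral>\<^sup>+b. norm (a + b) \<partial>measure_pmf (walk_pmf Q n) \<partial>measure_pmf Q)"
    by simp
  also have "\<dots> \<le> (\<integral>\<^sup>+a. \<integral>\<^sup>+b. ennreal (norm a) + ennreal (norm b) \<partial>measure_pmf (walk_pmf Q n) \<partial>measure_pmf Q)"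
    by (intro nn_integral_mono) (simp flip: ennreal_plus add: norm_triangle_ineq ennreal_leI)
  also have "\<dots> = (\<integral>\<^sup>+y. norm y \<partial>measure_pmf Q) + (\<integral>\<^sup>+y. norm y \<partial>measure_pmf (walk_pmf Q n))"
    by (simp add: nn_integral_add measure_pmf.emeasure_space_1)
  also have "\<dots> \<le> (\<integral>\<^sup>+y. norm y \<partial>measure_pmf Q) + of_nat n * (\<integral>\<^sup>+y. norm y \<partial>measure_pmf Q)"
    by (intro add_left_mono Suc.IH)
  finally show ?case by (simp add: algebra_simps)
qed simp

text \<open>This first moment bound, linear in the jump rate, will give tightness when infinitely
  many atoms are approximated by finitely many.\<close>

lemma nn_integral_norm_compound_poisson_pmf_le:
  fixes Q :: "'a :: real_normed_vector pmf"
  assumes "x > 0"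
  shows "(\<integral>\<^sup>+y. norm y \<partial>measure_pmf (compound_poisson_pmf x Q)) \<le> ennreal x * (\<integral>\<^sup>+y. norm y \<partial>measure_pmf Q)"
proof -
  have "(\<integral>\<^sup>+y. norm y \<partial>measure_pmf (compound_poisson_pmf x Q)) = (\<integral>\<^sup>+j. \<integral>\<^sup>+y. norm y \<partial>measure_pmf (walk_pmf Q j) \<partial>measure_pmf (poisson_pmf x))"
    by (simp add: compound_poisson_pmf_def)
  also have "\<dots> \<le> (\<integral>\<^sup>+j. ennreal (real j) * (\<integral>\<^sup>+y. norm y \<partial>measure_pmf Q) \<partial>measure_pmf (poisson_pmf x))"
    using nn_integral_norm_walk_pmf_le[of Q] by (intro nn_integral_mono) (simp add: ennreal_of_nat_eq_real_of_nat)
  also have "\<dots> = ennreal x * (\<integral>\<^sup>+y. norm y \<partial>measure_pmf Q)"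
    by (simp add: nn_integral_multc nn_integral_poisson_pmf_id[OF assms])
  finally show ?thesis .
qed

section \<open>Atomic signed Levy measures\<close>

text \<open>Unordered sums are rewritten as integrals over counting measure so that dominated
  convergence becomes available.\<close>

lemma integral_count_space_infsum:
  fixes f :: "'a \<Rightarrow> 'b :: {banach, second_countable_topology}"
  assumes "(\<lambda>x. norm (f x)) summable_on A"
  shows "integrable (count_space A) f" "(LINT x|count_space A. f x) = infsum f A"
proof -
  show "integrable (count_space A) f"
    using assms abs_summable_equivalent[of f A] by (simp add: Infinite_Set_Sum.abs_summable_on_def)
  show "(LINT x|count_space A. f x) = infsum f A"
    using infsetsum_infsum[OF assms[THEN abs_summable_equivalent[THEN iffD1]]] by (simp add: infsetsum_def)
qed

lemma convolution_real_distribution: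
  assumes "real_distribution M" "real_distribution N"
  shows "real_distribution (convolution M N)"
    and "char (convolution M N) t = char M t * char N t"
proof -
  interpret M: real_distribution M by fact
  interpret N: real_distribution N by fact
  interpret P: pair_prob_space M N ..
  have [measurable_cong]: "sets M = sets borel" "sets N = sets borel" by simp_all
  have [measurable]: "(\<lambda>(x, y). x + y) \<in> borel_measurable (M \<Otimes>\<^sub>M N)" by measurable
  have "prob_space (convolution M N)" unfolding convolution_def by (rule P.prob_space_distr) measurable
  thus "real_distribution (convolution M N)"
    by (auto simp: real_distribution_def real_distribution_axioms_def)
  have int: "integrable (M \<Otimes>\<^sub>M N) (\<lambda>z. iexp (t * (fst z + snd z)))"
    by (rule P.integrable_const_bound[where B = 1]) auto
  have "char (convolution M N) t = (LINT z|(M \<Otimes>\<^sub>M N). iexp (t * (fst z + snd z)))"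
    unfolding char_def convolution_def by (subst integral_distr) (auto simp: case_prod_beta)
  also have "\<dots> = (LINT x|M. LINT y|N. iexp (t * (x + y)))"
    using P.integral_fst'[OF int] by simp
  also have "\<dots> = (LINT x|M. iexp (t * x) * (LINT y|N. iexp (t * y)))"
    by (simp add: algebra_simps exp_add)
  also have "\<dots> = char M t * char N t" by (simp add: char_def)
  finally show "char (convolution M N) t = char M t * char N t" .
qed

lemma return_real_distribution:
  "real_distribution (return borel (a :: real))" "char (return borel a) t = iexp (t * a)"
  by (auto simp: real_distribution_def real_distribution_axioms_def char_def integral_return intro!: prob_space_return)

lemma convolution_power_real_distribution:
  assumes "real_distribution \<rho>"
  shows "real_distribution (convolution_power n \<rho>)" "char (convolution_power n \<rho>) t = char \<rho> t ^ n"
proof -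
  have "real_distribution (convolution_power n \<rho>) \<and> char (convolution_power n \<rho>) t = char \<rho> t ^ n"
    unfolding convolution_power_def
    by (induction n) (auto simp: return_real_distribution convolution_real_distribution assms)
  thus "real_distribution (convolution_power n \<rho>)" "char (convolution_power n \<rho>) t = char \<rho> t ^ n" by auto
qed

text \<open>The Levy exponent without compensator: a finite first absolute moment of the weights
  makes the uncompensated sum absolutely convergent even if the total mass of the atoms is
  infinite.\<close>

definition atomic_exponent :: "(real \<Rightarrow> real) \<Rightarrow> real set \<Rightarrow> real \<Rightarrow> complex" where
  "atomic_exponent b Y z = (\<Sum>\<^sub>\<infinity>x\<in>Y. complex_of_real (b x) * (iexp (z * x) - 1))"

lemma norm_iexp_diff_le: "norm (iexp s - iexp t) \<le> \<bar>s - t\<bar>"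
proof -
  have "iexp s - iexp t = iexp t * (iexp (s - t) - 1)" by (simp add: algebra_simps flip: exp_add)
  thus ?thesis using iexp_approx1[of "s - t" 0] by (simp add: norm_mult)
qed

locale atomic_levy_measure =
  fixes b :: "real \<Rightarrow> real" and Y :: "real set"
  assumes countable_atoms: "countable Y" and zero_not_atom: "0 \<notin> Y"
    and summable_weights: "(\<lambda>x. \<bar>b x\<bar> * \<bar>x\<bar>) summable_on Y"
begin

lemma summable_weights_bound:
  fixes f :: "real \<Rightarrow> 'b :: banach"
  assumes "\<And>x. x \<in> Y \<Longrightarrow> norm (f x) \<le> C * (\<bar>b x\<bar> * \<bar>x\<bar>)"
  shows "(\<lambda>x. norm (f x)) summable_on Y" "f summable_on Y"
proof -
  show "(\<lambda>x. norm (f x)) summable_on Y"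
  proof (rule Infinite_Sum.abs_summable_on_comparison_test[where g = "\<lambda>x. C * (\<bar>b x\<bar> * \<bar>x\<bar>)"])
    show "(\<lambda>x. norm (C * (\<bar>b x\<bar> * \<bar>x\<bar>))) summable_on Y"
      by (auto intro!: summable_on_cmult_right summable_weights simp: abs_mult)
    show "norm (f x) \<le> norm (C * (\<bar>b x\<bar> * \<bar>x\<bar>))" if "x \<in> Y" for x
      using assms[OF that] by (metis abs_ge_self order_trans real_norm_def)
  qed
  thus "f summable_on Y" by (rule abs_summable_summable)
qed

lemma exponent_summable:
  "(\<lambda>x. norm (complex_of_real (b x) * (iexp (z * x) - 1))) summable_on Y"
  "(\<lambda>x. complex_of_real (b x) * (iexp (z * x) - 1)) summable_on Y"
proof -
  have "norm (complex_of_real (b x) * (iexp (z * x) - 1)) \<le> \<bar>z\<bar> * (\<bar>b x\<bar> * \<bar>x\<bar>)" for x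
  proof -
    have "norm (complex_of_real (b x) * (iexp (z * x) - 1)) = \<bar>b x\<bar> * norm (iexp (z * x) - iexp 0)"
      by (simp only: norm_mult norm_of_real) simp
    also have "\<dots> \<le> \<bar>b x\<bar> * \<bar>z * x - 0\<bar>" by (intro mult_left_mono norm_iexp_diff_le) auto
    finally show ?thesis by (simp add: abs_mult mult_ac)
  qed
  thus "(\<lambda>x. norm (complex_of_real (b x) * (iexp (z * x) - 1))) summable_on Y"
    "(\<lambda>x. complex_of_real (b x) * (iexp (z * x) - 1)) summable_on Y"
    by (rule summable_weights_bound)+
qed

lemma exponent_0: "atomic_exponent b Y 0 = 0"
  by (simp add: atomic_exponent_def)

text \<open>Combines |iexp s - iexp t| \<le> |s - t| with the finite first moment. The continuity
  that follows is needed to select the right branch of the n-th root of the exponential.\<close>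

lemma exponent_lipschitz:
  "norm (atomic_exponent b Y z - atomic_exponent b Y z') \<le> (\<Sum>\<^sub>\<infinity>x\<in>Y. \<bar>b x\<bar> * \<bar>x\<bar>) * \<bar>z - z'\<bar>"
proof (rule norm_infsum_le)
  show "((\<lambda>x. complex_of_real (b x) * (iexp (z * x) - 1) + - (complex_of_real (b x) * (iexp (z' * x) - 1)))
     has_sum (atomic_exponent b Y z - atomic_exponent b Y z')) Y"
  proof -
    have "((\<lambda>x. complex_of_real (b x) * (iexp (z * x) - 1)) has_sum atomic_exponent b Y z) Y" for z
      unfolding atomic_exponent_def by (intro has_sum_infsum exponent_summable)
    note h = this
    have "((\<lambda>x. - (complex_of_real (b x) * (iexp (z' * x) - 1))) has_sum - atomic_exponent b Y z') Y"
      unfolding has_sum_uminus minus_minus by (rule h)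
    from has_sum_add[OF h[of z] this]
    show ?thesis by simp
  qed
  show "((\<lambda>x. \<bar>b x\<bar> * \<bar>x\<bar> * \<bar>z - z'\<bar>) has_sum (\<Sum>\<^sub>\<infinity>x\<in>Y. \<bar>b x\<bar> * \<bar>x\<bar>) * \<bar>z - z'\<bar>) Y"
    by (intro has_sum_cmult_left has_sum_infsum summable_weights)
  fix x
  have "norm (complex_of_real (b x) * (iexp (z * x) - 1) + - (complex_of_real (b x) * (iexp (z' * x) - 1))) =
    \<bar>b x\<bar> * norm (iexp (z * x) - iexp (z' * x))"
    by (simp add: norm_mult flip: right_diff_distrib)
  also have "\<dots> \<le> \<bar>b x\<bar> * \<bar>z * x - z' * x\<bar>" by (intro mult_left_mono norm_iexp_diff_le) auto
  also have "\<bar>z * x - z' * x\<bar> = \<bar>x\<bar> * \<bar>z - z'\<bar>" by (simp add: left_diff_distrib[symmetric] abs_mult)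
  finally show "norm (complex_of_real (b x) * (iexp (z * x) - 1) + - (complex_of_real (b x) * (iexp (z' * x) - 1)))
    \<le> \<bar>b x\<bar> * \<bar>x\<bar> * \<bar>z - z'\<bar>"
    by (simp only: mult.assoc)
qed

lemma exponent_continuous: "continuous_on UNIV (atomic_exponent b Y)"
proof (rule lipschitz_on_continuous_on)
  show "(\<Sum>\<^sub>\<infinity>x\<in>Y. \<bar>b x\<bar> * \<bar>x\<bar>)-lipschitz_on UNIV (atomic_exponent b Y)"
    using exponent_lipschitz by (auto intro!: lipschitz_onI infsum_nonneg simp: dist_norm)
qed

end

section \<open>Existence of laws with nonnegative atoms\<close>

text \<open>The total mass B serves as jump rate and b / B as jump law; vanishing total mass is
  split off because b / B is then no law. The moment bound is carried along for the passage to
  infinitely many atoms.\<close>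

lemma finite_compound_poisson_exists:
  fixes b :: "real \<Rightarrow> real"
  assumes F: "finite F" and b: "\<And>x. x \<in> F \<Longrightarrow> b x \<ge> 0"
  shows "\<exists>\<rho>. real_distribution \<rho> \<and> (\<forall>z. char \<rho> z = exp (\<Sum>x\<in>F. complex_of_real (b x) * (iexp (z * x) - 1))) \<and>
    (\<integral>\<^sup>+x. \<bar>x\<bar> \<partial>\<rho>) \<le> ennreal (\<Sum>x\<in>F. b x * \<bar>x\<bar>)"
proof (cases "(\<Sum>x\<in>F. b x) = 0")
  case True
  hence 0: "\<forall>x\<in>F. b x = 0" using b F by (simp add: sum_nonneg_eq_0_iff)
  show ?thesis
    by (intro exI[of _ "return borel 0"]) (simp add: return_real_distribution 0 nn_integral_return)
next
  case False
  define B where "B = (\<Sum>x\<in>F. b x)"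
  have "B \<ge> 0" unfolding B_def by (rule sum_nonneg) (rule b)
  hence B: "B > 0" using False by (simp add: B_def)
  define f where "f x = (if x \<in> F then b x / B else 0)" for x
  have f0: "f x \<ge> 0" for x using b B by (simp add: f_def)
  have "(\<integral>\<^sup>+x. ennreal (f x) \<partial>count_space UNIV) = (\<Sum>x\<in>F. ennreal (f x))"
    by (rule nn_integral_count_space'[OF F]) (auto simp: f_def)
  also have "\<dots> = ennreal (\<Sum>x\<in>F. f x)" using f0 by simp
  also have "(\<Sum>x\<in>F. f x) = 1" using B by (simp add: f_def B_def flip: sum_divide_distrib)
  finally have f1: "(\<integral>\<^sup>+x. ennreal (f x) \<partial>count_space UNIV) = 1" by simp
  define Q where "Q = embed_pmf f"
  have Q: "pmf Q x = f x" for x unfolding Q_def by (rule pmf_embed_pmf[OF f0 f1])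
  have setQ: "set_pmf Q \<subseteq> F" by (auto simp: set_pmf_eq Q f_def)
  have EQ: "(LINT x|measure_pmf Q. h x) = (\<Sum>x\<in>F. f x *\<^sub>R h x)" for h :: "real \<Rightarrow> complex"
    using integral_measure_pmf[OF F, of Q h] setQ by (auto simp: Q)
  define \<rho> where "\<rho> = distr (measure_pmf (compound_poisson_pmf B Q)) borel (\<lambda>x. x)"
  have "prob_space \<rho>" unfolding \<rho>_def by (rule measure_pmf.prob_space_distr) auto
  hence rd: "real_distribution \<rho>" by (auto simp: real_distribution_def real_distribution_axioms_def \<rho>_def)
  have "char \<rho> z = exp (\<Sum>x\<in>F. complex_of_real (b x) * (iexp (z * x) - 1))" for z
  proof -
    have "char \<rho> z = (LINT x|measure_pmf (compound_poisson_pmf B Q). iexp (z * x))"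
      unfolding char_def \<rho>_def by (subst integral_distr) auto
    also have "\<dots> = exp (of_real B * ((LINT x|measure_pmf Q. iexp (z * x)) - 1))"
      by (rule integral_compound_poisson_pmf_mult[where S = UNIV]) (use B in \<open>auto simp: algebra_simps exp_add\<close>)
    also have "of_real B * ((LINT x|measure_pmf Q. iexp (z * x)) - 1) = (\<Sum>x\<in>F. complex_of_real (b x) * (iexp (z * x) - 1))"
    proof -
      have "of_real B * (LINT x|measure_pmf Q. iexp (z * x)) = (\<Sum>x\<in>F. complex_of_real (b x) * iexp (z * x))"
        unfolding EQ sum_distrib_left using B by (intro sum.cong) (auto simp: f_def scaleR_conv_of_real)
      thus ?thesis by (simp add: algebra_simps sum_subtractf B_def)
    qed
    finally show ?thesis .
  qed
  moreover have "(\<integral>\<^sup>+x. \<bar>x\<bar> \<partial>\<rho>) \<le> ennreal (\<Sum>x\<in>F. b x * \<bar>x\<bar>)"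
  proof -
    have "(\<integral>\<^sup>+x. \<bar>x\<bar> \<partial>\<rho>) = (\<integral>\<^sup>+x. norm x \<partial>measure_pmf (compound_poisson_pmf B Q))"
      unfolding \<rho>_def by (subst nn_integral_distr) auto
    also have "\<dots> \<le> ennreal B * (\<integral>\<^sup>+x. norm x \<partial>measure_pmf Q)"
      by (rule nn_integral_norm_compound_poisson_pmf_le[OF B])
    also have "(\<integral>\<^sup>+x. norm x \<partial>measure_pmf Q) = (\<Sum>x\<in>F. ennreal (norm x) * ennreal (f x))"
      using F setQ by (subst nn_integral_measure_pmf_support[of F]) (auto simp: Q)
    also have "ennreal B * \<dots> = ennreal (B * (\<Sum>x\<in>F. \<bar>x\<bar> * f x))"
      using f0 B by (subst ennreal_mult) (auto intro!: sum_nonneg simp: ennreal_mult simp flip: sum_ennreal)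
    also have "B * (\<Sum>x\<in>F. \<bar>x\<bar> * f x) = (\<Sum>x\<in>F. b x * \<bar>x\<bar>)"
      unfolding sum_distrib_left using B by (intro sum.cong) (auto simp: f_def)
    finally show ?thesis .
  qed
  ultimately show ?thesis using rd by blast
qed

context atomic_levy_measure
begin

text \<open>The total mass may be infinite, so there need not be a single jump law. Finite subsets F
  n exhaust Y; the first moments stay below C, hence the approximating laws are tight by Markov's
  inequality, and along a weakly convergent subsequence their characteristic functions converge to
  the exponential of the full exponent.\<close>

lemma compound_poisson_exists:
  assumes nonneg: "\<And>x. x \<in> Y \<Longrightarrow> b x \<ge> 0"
  shows "\<exists>\<rho>. real_distribution \<rho> \<and> (\<forall>z. char \<rho> z = exp (atomic_exponent b Y z))"
proof -
  define C where "C = (\<Sum>\<^sub>\<infinity>x\<in>Y. \<bar>b x\<bar> * \<bar>x\<bar>)"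
  have C: "C \<ge> 0" unfolding C_def by (intro infsum_nonneg) auto
  define F where "F n = {x\<in>Y. to_nat_on Y x < n}" for n
  have finF: "finite (F n)" for n
  proof -
    have "inj_on (to_nat_on Y) (F n)"
      using inj_on_to_nat_on[OF countable_atoms] by (rule inj_on_subset) (auto simp: F_def)
    moreover have "to_nat_on Y ` F n \<subseteq> {..<n}" by (auto simp: F_def)
    ultimately show ?thesis by (meson finite_lessThan inj_on_finite)
  qed
  have Flim: "filterlim F (finite_subsets_at_top Y) sequentially"
    unfolding filterlim_finite_subsets_at_top
  proof (intro allI impI)
    fix X assume X: "finite X \<and> X \<subseteq> Y"
    then obtain N where N: "\<forall>x\<in>X. to_nat_on Y x < N"
      by (metis finite_imageI finite_nat_set_iff_bounded imageI)
    show "\<forall>\<^sub>F n in sequentially. finite (F n) \<and> X \<subseteq> F n \<and> F n \<subseteq> Y"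
      using eventually_ge_at_top[of N]
    proof eventually_elim
      case (elim n)
      thus ?case using X N finF[of n] by (force simp: F_def)
    qed
  qed
  have "\<forall>n. \<exists>\<rho>. real_distribution \<rho> \<and> (\<forall>z. char \<rho> z = exp (\<Sum>x\<in>F n. complex_of_real (b x) * (iexp (z * x) - 1))) \<and>
    (\<integral>\<^sup>+x. \<bar>x\<bar> \<partial>\<rho>) \<le> ennreal (\<Sum>x\<in>F n. b x * \<bar>x\<bar>)"
    using nonneg by (intro allI finite_compound_poisson_exists finF) (auto simp: F_def)
  then obtain \<rho> where rd: "\<And>n. real_distribution (\<rho> n)"
    and char: "\<And>n z. char (\<rho> n) z = exp (\<Sum>x\<in>F n. complex_of_real (b x) * (iexp (z * x) - 1))"
    and mean: "\<And>n. (\<integral>\<^sup>+x. \<bar>x\<bar> \<partial>(\<rho> n)) \<le> ennreal (\<Sum>x\<in>F n. b x * \<bar>x\<bar>)"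
    by metis
  have mean': "(\<integral>\<^sup>+x. \<bar>x\<bar> \<partial>(\<rho> n)) \<le> ennreal C" for n
  proof -
    have "(\<Sum>x\<in>F n. b x * \<bar>x\<bar>) = (\<Sum>x\<in>F n. \<bar>b x\<bar> * \<bar>x\<bar>)" using nonneg by (intro sum.cong) (auto simp: F_def)
    also have "\<dots> \<le> C" unfolding C_def
      by (rule finite_sum_le_infsum[OF summable_weights finF]) (auto simp: F_def)
    finally show ?thesis using mean[of n] by (meson ennreal_leI order_trans)
  qed
  have "tight \<rho>" unfolding tight_def
  proof (intro conjI allI impI rd)
    fix e :: real assume e: "e > 0"
    define R where "R = C / e + 1"
    have R: "R > 0" "C / R < e" using C e unfolding R_def by (auto simp: field_simps add_pos_nonneg)
    have "measure (\<rho> n) {-R<..R} > 1 - e" for n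
    proof -
      interpret real_distribution "\<rho> n" by (rule rd)
      have "emeasure (\<rho> n) {x \<in> space (\<rho> n). 1 \<le> ennreal (1 / R) * ennreal \<bar>x\<bar>} \<le>
        ennreal (1 / R) * (\<integral>\<^sup>+x. ennreal \<bar>x\<bar> * indicator (space (\<rho> n)) x \<partial>\<rho> n)"
        by (rule nn_integral_Markov_inequality) auto
      also have "\<dots> \<le> ennreal (1 / R) * ennreal C" using mean'[of n] by (intro mult_left_mono) auto
      also have "\<dots> = ennreal (C / R)" using R C by (simp flip: ennreal_mult)
      also have "{x \<in> space (\<rho> n). 1 \<le> ennreal (1 / R) * ennreal \<bar>x\<bar>} = {x. R \<le> \<bar>x\<bar>}"
        using R by (auto simp flip: ennreal_mult ennreal_1 simp: field_simps)
      finally have "measure (\<rho> n) {x. R \<le> \<bar>x\<bar>} \<le> C / R"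
        using C R by (simp add: emeasure_eq_measure divide_nonneg_pos)
      moreover have "measure (\<rho> n) {x. R \<le> \<bar>x\<bar>} \<ge> measure (\<rho> n) (space (\<rho> n) - {-R<..R})"
        by (intro finite_measure_mono) auto
      ultimately show ?thesis using R by (subst (asm) prob_compl) auto
    qed
    thus "\<exists>a b. a < b \<and> (\<forall>n. 1 - e < measure (\<rho> n) {a<..b})" using R by (intro exI[of _ "-R"] exI[of _ R]) auto
  qed
  from tight_imp_convergent_subsubsequence[OF this strict_mono_id]
  obtain r M where r: "strict_mono r" and M: "real_distribution M" and wc: "weak_conv_m (\<rho> \<circ> id \<circ> r) M"
    by blast
  have "char M z = exp (atomic_exponent b Y z)" for z
  proof (rule LIMSEQ_unique)
    show "(\<lambda>n. char ((\<rho> \<circ> id \<circ> r) n) z) \<longlonglongrightarrow> char M z"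
      by (rule levy_continuity1[OF _ M wc]) (simp add: rd)
    have "((\<lambda>X. \<Sum>x\<in>X. complex_of_real (b x) * (iexp (z * x) - 1)) \<longlongrightarrow> atomic_exponent b Y z) (finite_subsets_at_top Y)"
      unfolding atomic_exponent_def by (rule infsum_tendsto[OF exponent_summable(2)])
    hence "(\<lambda>n. \<Sum>x\<in>F n. complex_of_real (b x) * (iexp (z * x) - 1)) \<longlonglongrightarrow> atomic_exponent b Y z"
      using Flim by (rule filterlim_compose)
    hence "(\<lambda>n. \<Sum>x\<in>F (r n). complex_of_real (b x) * (iexp (z * x) - 1)) \<longlonglongrightarrow> atomic_exponent b Y z"
      using LIMSEQ_subseq_LIMSEQ[OF _ r] by (fastforce simp: comp_def)
    thus "(\<lambda>n. char ((\<rho> \<circ> id \<circ> r) n) z) \<longlonglongrightarrow> exp (atomic_exponent b Y z)"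
      by (simp add: char tendsto_exp)
  qed
  thus ?thesis using M by blast
qed

end

section \<open>Infinite divisibility forces nonnegative atoms\<close>

text \<open>The quotient f / exp (g / n) is continuous on the connected line and takes values among
  the finitely many n-th roots of unity; it is constant, and equals 1 at 0.\<close>

lemma continuous_power_eq_exp_imp_eq:
  fixes f g :: "real \<Rightarrow> complex"
  assumes n: "n \<ge> 1" and f: "continuous_on UNIV f" and g: "continuous_on UNIV g"
    and eq: "\<And>z. f z ^ n = exp (g z)" and 0: "f 0 = 1" "g 0 = 0"
  shows "f z = exp (g z / of_nat n)"
proof -
  define r where "r z = f z * exp (- (g z / of_nat n))" for z
  have "continuous_on UNIV r" unfolding r_def using n by (intro continuous_intros f g) auto
  moreover have rn: "r z ^ n = 1" for z
  proof -
    have "r z ^ n = exp (g z) * exp (of_nat n * (- (g z / of_nat n)))"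
      unfolding r_def power_mult_distrib eq exp_of_nat_mult by simp
    also have "\<dots> = 1" using n by (simp flip: exp_add)
    finally show ?thesis .
  qed
  have "finite {z :: complex. z ^ n = 1}" using n by (intro finite_roots_unity) auto
  hence "finite (range r)" by (rule rev_finite_subset) (use rn in auto)
  ultimately have "r constant_on UNIV" by (intro continuous_finite_range_constant) auto
  hence "r z = r 0" by (auto simp: constant_on_def)
  hence "f z * exp (- (g z / of_nat n)) = 1" by (simp add: r_def 0)
  thus ?thesis by (simp add: exp_minus field_simps)
qed

lemma of_nat_times_exp_minus_one_tendsto:
  "(\<lambda>n. of_nat n * (exp (w / of_nat n) - 1)) \<longlonglongrightarrow> (w :: complex)"
proof -
  have "((\<lambda>t. exp (w * t)) has_field_derivative w) (at 0)"
    by (auto intro!: derivative_eq_intros)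
  hence "((\<lambda>h. (exp (w * h) - 1) / h) \<longlongrightarrow> w) (at 0)" by (simp add: DERIV_def)
  moreover have "filterlim (\<lambda>n. 1 / of_nat n :: complex) (at 0) sequentially"
    unfolding filterlim_at using eventually_gt_at_top[of "0::nat"]
    by (auto elim!: eventually_mono intro: lim_1_over_n)
  ultimately have "(\<lambda>n. (exp (w * (1 / of_nat n)) - 1) / (1 / of_nat n)) \<longlonglongrightarrow> w"
    by (rule filterlim_compose)
  thus ?thesis by (simp add: mult.commute)
qed

lemma double_sum_iexp_eq_norm:
  fixes c :: "'i \<Rightarrow> complex" and \<zeta> :: "'i \<Rightarrow> real"
  shows "(\<Sum>i\<in>A. \<Sum>j\<in>A. c i * cnj (c j) * iexp ((\<zeta> i - \<zeta> j) * x)) =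
    complex_of_real ((norm (\<Sum>i\<in>A. c i * iexp (\<zeta> i * x)))\<^sup>2)"
proof -
  have "complex_of_real ((norm (\<Sum>i\<in>A. c i * iexp (\<zeta> i * x)))\<^sup>2) =
    (\<Sum>i\<in>A. c i * iexp (\<zeta> i * x)) * cnj (\<Sum>i\<in>A. c i * iexp (\<zeta> i * x))"
    by (simp only: complex_norm_square)
  also have "\<dots> = (\<Sum>i\<in>A. \<Sum>j\<in>A. (c i * iexp (\<zeta> i * x)) * cnj (c j * iexp (\<zeta> j * x)))"
    by (simp only: cnj_sum sum_product)
  also have "\<dots> = (\<Sum>i\<in>A. \<Sum>j\<in>A. c i * cnj (c j) * iexp ((\<zeta> i - \<zeta> j) * x))"
  proof (intro sum.cong refl)
    fix i j
    have "iexp ((\<zeta> i - \<zeta> j) * x) = iexp (\<zeta> i * x) * cnj (iexp (\<zeta> j * x))"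
      by (simp add: exp_cnj algebra_simps flip: exp_add)
    thus "(c i * iexp (\<zeta> i * x)) * cnj (c j * iexp (\<zeta> j * x)) = c i * cnj (c j) * iexp ((\<zeta> i - \<zeta> j) * x)"
      by (simp only: complex_cnj_mult mult_ac)
  qed
  finally show ?thesis by (rule sym)
qed

text \<open>The double sum is the mean of |sum_i c_i exp (i \<zeta>_i x)|^2: the elementary half of
  Bochner's theorem.\<close>

lemma char_positive_definite:
  fixes c :: "'i \<Rightarrow> complex" and \<zeta> :: "'i \<Rightarrow> real"
  assumes "real_distribution \<rho>"
  shows "Re (\<Sum>i\<in>A. \<Sum>j\<in>A. c i * cnj (c j) * char \<rho> (\<zeta> i - \<zeta> j)) \<ge> 0"
proof -
  interpret real_distribution \<rho> by fact
  have int: "integrable \<rho> (\<lambda>x. c i * cnj (c j) * iexp ((\<zeta> i - \<zeta> j) * x))" for i j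
    by (intro integrable_mult_right integrable_iexp) auto
  have "(\<Sum>i\<in>A. \<Sum>j\<in>A. c i * cnj (c j) * char \<rho> (\<zeta> i - \<zeta> j)) =
    (\<Sum>i\<in>A. \<Sum>j\<in>A. (LINT x|\<rho>. c i * cnj (c j) * iexp ((\<zeta> i - \<zeta> j) * x)))"
    by (simp add: char_def)
  also have "\<dots> = (LINT x|\<rho>. (\<Sum>i\<in>A. \<Sum>j\<in>A. c i * cnj (c j) * iexp ((\<zeta> i - \<zeta> j) * x)))"
    by (simp only: Bochner_Integration.integral_sum[OF int] Bochner_Integration.integral_sum Bochner_Integration.integrable_sum int)
  also have "\<dots> = complex_of_real (LINT x|\<rho>. (norm (\<Sum>i\<in>A. c i * iexp (\<zeta> i * x)))\<^sup>2)"
    by (simp only: double_sum_iexp_eq_norm integral_complex_of_real)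
  finally show ?thesis by (simp add: integral_nonneg_AE)
qed

lemma average_unit_powers_tendsto_0:
  fixes u :: complex
  assumes "norm u = 1" "u \<noteq> 1"
  shows "(\<lambda>J. (\<Sum>j<J. u ^ j) / of_nat J) \<longlonglongrightarrow> 0"
proof (rule Lim_null_comparison)
  show "\<forall>\<^sub>F J in sequentially. norm ((\<Sum>j<J. u ^ j) / of_nat J) \<le> 2 / norm (1 - u) * (1 / real J)"
  proof (intro always_eventually allI)
    fix J
    have "norm (1 - u ^ J) \<le> 2" using norm_triangle_ineq4[of 1 "u ^ J"] assms by (simp add: norm_power)
    moreover have "(\<Sum>j<J. u ^ j) = (1 - u ^ J) / (1 - u)" using assms by (simp add: sum_gp_strict)
    ultimately show "norm ((\<Sum>j<J. u ^ j) / of_nat J) \<le> 2 / norm (1 - u) * (1 / real J)"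
      by (simp add: norm_divide norm_mult divide_right_mono)
  qed
  show "(\<lambda>J. 2 / norm (1 - u) * (1 / real J)) \<longlonglongrightarrow> 0" by (intro tendsto_mult_right_zero lim_1_over_n)
qed

text \<open>Each x other than x0 rules out the countable set of s with s (x - x0) in 2 pi Z, and
  countably many such sets do not cover the line.\<close>

lemma exists_separating_frequency:
  fixes Y :: "real set"
  assumes "countable Y"
  shows "\<exists>s. \<forall>x\<in>Y - {x0}. iexp (s * (x - x0)) \<noteq> 1"
proof -
  define Bad where "Bad = (\<lambda>(x, k). 2 * of_int k * pi / (x - x0)) ` ((Y - {x0}) \<times> (UNIV :: int set))"
  have "countable Bad" unfolding Bad_def using assms by auto
  hence "\<exists>s. s \<notin> Bad" using uncountable_UNIV_real by (metis UNIV_eq_I)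
  then obtain s where s: "s \<notin> Bad" by blast
  have "iexp (s * (x - x0)) \<noteq> 1" if x: "x \<in> Y - {x0}" for x
  proof
    assume "iexp (s * (x - x0)) = 1"
    then obtain k :: int where k: "s * (x - x0) = of_int (2 * k) * pi" by (auto simp: exp_eq_1)
    have "s = 2 * of_int k * pi / (x - x0)" using k x by (simp add: field_simps)
    hence "s \<in> Bad" unfolding Bad_def using x by (auto intro!: rev_image_eqI[of "(x, k)"])
    thus False using s by simp
  qed
  thus ?thesis by blast
qed

context atomic_levy_measure
begin

text \<open>For the convolution roots \<open>\<rho>\<^sub>n\<close> of \<open>\<sigma>\<close>, the functions \<open>n (char \<rho>\<^sub>n - 1)\<close> are conditionally positive definite
  and converge to the exponent.\<close>

lemma exponent_conditionally_positive:
  fixes c :: "'i \<Rightarrow> complex" and \<zeta> :: "'i \<Rightarrow> real"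
  assumes \<sigma>: "infinitely_divisible \<sigma>" and char: "\<And>z. char \<sigma> z = exp (atomic_exponent b Y z)"
    and A: "finite A" and c: "(\<Sum>i\<in>A. c i) = 0"
  shows "(\<Sum>\<^sub>\<infinity>x\<in>Y. b x * (norm (\<Sum>i\<in>A. c i * iexp (\<zeta> i * x)))\<^sup>2) \<ge> 0"
proof -
  let ?\<psi> = "atomic_exponent b Y"
  \<comment> \<open>Because the c_i sum to 0, this cancels the constant - 1 both in n (char - 1) and
    in each summand of the exponent.\<close>
  have cc: "(\<Sum>i\<in>A. \<Sum>j\<in>A. c i * cnj (c j)) = 0"
    by (simp add: c flip: sum_distrib_left sum_distrib_right)
  have lim: "(\<lambda>n. \<Sum>i\<in>A. \<Sum>j\<in>A. c i * cnj (c j) * (of_nat n * (exp (?\<psi> (\<zeta> i - \<zeta> j) / of_nat n) - 1)))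
     \<longlonglongrightarrow> (\<Sum>i\<in>A. \<Sum>j\<in>A. c i * cnj (c j) * ?\<psi> (\<zeta> i - \<zeta> j))"
    by (intro tendsto_sum tendsto_mult tendsto_const of_nat_times_exp_minus_one_tendsto)
  have "Re (\<Sum>i\<in>A. \<Sum>j\<in>A. c i * cnj (c j) * ?\<psi> (\<zeta> i - \<zeta> j)) \<ge> 0"
  proof (rule LIMSEQ_le_const[OF tendsto_Re[OF lim]], intro exI[of _ 1] allI impI)
    fix n :: nat assume n: "n \<ge> 1"
    obtain \<rho> where \<rho>: "real_distribution \<rho>" "\<sigma> = convolution_power n \<rho>"
      using \<sigma> n by (auto simp: infinitely_divisible_def)
    interpret real_distribution \<rho> by fact
    have "char \<rho> z = exp (?\<psi> z / of_nat n)" for z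
    proof (rule continuous_power_eq_exp_imp_eq[OF n _ exponent_continuous])
      show "continuous_on UNIV (char \<rho>)" using isCont_char by (intro continuous_at_imp_continuous_on) auto
      show "char \<rho> z ^ n = exp (?\<psi> z)" for z
        using char[of z] convolution_power_real_distribution(2)[OF \<rho>(1)] \<rho>(2) by simp
    qed (simp_all add: char_zero exponent_0)
    hence "(\<Sum>i\<in>A. \<Sum>j\<in>A. c i * cnj (c j) * (of_nat n * (exp (?\<psi> (\<zeta> i - \<zeta> j) / of_nat n) - 1))) =
      of_nat n * ((\<Sum>i\<in>A. \<Sum>j\<in>A. c i * cnj (c j) * char \<rho> (\<zeta> i - \<zeta> j)) - (\<Sum>i\<in>A. \<Sum>j\<in>A. c i * cnj (c j)))"
      by (simp add: sum_distrib_left algebra_simps flip: sum_subtractf)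
    also have "\<dots> = of_nat n * (\<Sum>i\<in>A. \<Sum>j\<in>A. c i * cnj (c j) * char \<rho> (\<zeta> i - \<zeta> j))" unfolding cc by simp
    finally show "0 \<le> Re (\<Sum>i\<in>A. \<Sum>j\<in>A. c i * cnj (c j) * (of_nat n * (exp (?\<psi> (\<zeta> i - \<zeta> j) / of_nat n) - 1)))"
      using char_positive_definite[OF \<rho>(1), where A = A and c = c and \<zeta> = \<zeta>] by (simp add: Re_complex_of_real)
  qed
  moreover have "((\<lambda>x. complex_of_real (b x * (norm (\<Sum>i\<in>A. c i * iexp (\<zeta> i * x)))\<^sup>2)) has_sum
      (\<Sum>i\<in>A. \<Sum>j\<in>A. c i * cnj (c j) * ?\<psi> (\<zeta> i - \<zeta> j))) Y"
  proof -
    have hs: "((\<lambda>x. \<Sum>k\<in>K. f k x) has_sum (\<Sum>k\<in>K. S k)) Y"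
      if "\<And>k. k \<in> K \<Longrightarrow> (f k has_sum S k) Y" "finite K" for K :: "'i set" and f :: "'i \<Rightarrow> real \<Rightarrow> complex" and S
      using that(2,1) by (induction K rule: finite_induct) (auto intro!: has_sum_add)
    have "((\<lambda>x. \<Sum>i\<in>A. \<Sum>j\<in>A. c i * cnj (c j) * (complex_of_real (b x) * (iexp ((\<zeta> i - \<zeta> j) * x) - 1))) has_sum
      (\<Sum>i\<in>A. \<Sum>j\<in>A. c i * cnj (c j) * ?\<psi> (\<zeta> i - \<zeta> j))) Y"
      unfolding atomic_exponent_def by (intro hs A has_sum_cmult_right has_sum_infsum exponent_summable)
    also have "(\<lambda>x. \<Sum>i\<in>A. \<Sum>j\<in>A. c i * cnj (c j) * (complex_of_real (b x) * (iexp ((\<zeta> i - \<zeta> j) * x) - 1))) =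
      (\<lambda>x. complex_of_real (b x * (norm (\<Sum>i\<in>A. c i * iexp (\<zeta> i * x)))\<^sup>2))"
    proof
      fix x
      have "(\<Sum>i\<in>A. \<Sum>j\<in>A. c i * cnj (c j) * (complex_of_real (b x) * (iexp ((\<zeta> i - \<zeta> j) * x) - 1))) =
        complex_of_real (b x) * ((\<Sum>i\<in>A. \<Sum>j\<in>A. c i * cnj (c j) * iexp ((\<zeta> i - \<zeta> j) * x)) - (\<Sum>i\<in>A. \<Sum>j\<in>A. c i * cnj (c j)))"
        unfolding sum_subtractf[symmetric] sum_distrib_left by (intro sum.cong refl) (simp only: right_diff_distrib mult_ac mult_1_right mult_1_left)
      thus "(\<Sum>i\<in>A. \<Sum>j\<in>A. c i * cnj (c j) * (complex_of_real (b x) * (iexp ((\<zeta> i - \<zeta> j) * x) - 1))) =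
        complex_of_real (b x * (norm (\<Sum>i\<in>A. c i * iexp (\<zeta> i * x)))\<^sup>2)"
        unfolding cc double_sum_iexp_eq_norm by simp
    qed
    finally show ?thesis .
  qed
  from has_sum_Re[OF this] have "((\<lambda>x. b x * (norm (\<Sum>i\<in>A. c i * iexp (\<zeta> i * x)))\<^sup>2) has_sum
      Re (\<Sum>i\<in>A. \<Sum>j\<in>A. c i * cnj (c j) * ?\<psi> (\<zeta> i - \<zeta> j))) Y" by (simp only: Re_complex_of_real)
  hence "(\<Sum>\<^sub>\<infinity>x\<in>Y. b x * (norm (\<Sum>i\<in>A. c i * iexp (\<zeta> i * x)))\<^sup>2) =
      Re (\<Sum>i\<in>A. \<Sum>j\<in>A. c i * cnj (c j) * ?\<psi> (\<zeta> i - \<zeta> j))" by (rule infsumI)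
  ultimately show ?thesis by (simp only:)
qed

text \<open>Testing conditional positivity with \<open>(1 - e\<^sup>i\<^sup>a\<^sup>x) (1/J) \<Sum>\<^sub>j e\<^sup>i\<^sup>j\<^sup>s\<^sup>(\<^sup>x\<^sup>-\<^sup>x\<^sup>0\<^sup>)\<close> for a generic frequency \<open>s\<close>
  isolates the atom at \<open>x0\<close> as \<open>J\<close> tends to infinity.\<close>

lemma infinitely_divisible_imp_nonneg:
  assumes \<sigma>: "infinitely_divisible \<sigma>" and char: "\<And>z. char \<sigma> z = exp (atomic_exponent b Y z)" and x0: "x0 \<in> Y"
  shows "b x0 \<ge> 0"
proof -
  have x0_nz: "x0 \<noteq> 0" using x0 zero_not_atom by auto
  \<comment> \<open>With this choice 1 - exp (i a x) equals 2 at x0, so the surviving term is 4 b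
    x0. The same factor makes the coefficients of the test sum add up to 0.\<close>
  define a where "a = pi / x0"
  obtain s where s: "\<And>x. x \<in> Y - {x0} \<Longrightarrow> iexp (s * (x - x0)) \<noteq> 1"
    using exists_separating_frequency[OF countable_atoms] by metis
  define av where "av J x = (\<Sum>j<J. iexp (s * (x - x0)) ^ j) / of_nat J" for J x
  define G where "G J x = (1 - iexp (a * x)) * av J x" for J x
  have av_le: "norm (av J x) \<le> 1" for J x
  proof (cases "J = 0")
    case False
    have "norm (\<Sum>j<J. iexp (s * (x - x0)) ^ j) \<le> (\<Sum>j<J. 1)"
      by (rule order_trans[OF norm_sum]) (simp add: norm_power)
    thus ?thesis using False by (simp add: av_def norm_divide)
  qed (simp add: av_def)
  have nonneg: "(\<Sum>\<^sub>\<infinity>x\<in>Y. b x * (norm (G J x))\<^sup>2) \<ge> 0" for J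
  proof -
    \<comment> \<open>The first component selects one of the two terms of 1 - exp (i a x), the
      second one a summand of the average.\<close>
    define A where "A = {0::nat, 1} \<times> {..<J}"
    define c where "c = (\<lambda>(e::nat, j::nat). (if e = 0 then 1 else - 1) * (iexp (- (real j * s * x0)) / of_nat J))"
    define \<zeta> where "\<zeta> = (\<lambda>(e::nat, j::nat). real e * a + real j * s)"
    have sumA: "(\<Sum>i\<in>A. h i) = (\<Sum>j<J. h (0, j)) + (\<Sum>j<J. h (1, j))" for h :: "nat \<times> nat \<Rightarrow> complex"
      unfolding A_def by (subst sum.cartesian_product') simp
    have "(\<Sum>i\<in>A. c i) = 0" unfolding sumA c_def by (simp add: sum_negf)
    moreover have "(\<Sum>i\<in>A. c i * iexp (\<zeta> i * x)) = G J x" for x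
    proof -
      have p: "iexp (s * (x - x0)) ^ j = iexp (- (real j * s * x0)) * iexp (real j * s * x)" for j
        by (simp add: algebra_simps flip: exp_of_nat_mult exp_add)
      have "(\<Sum>i\<in>A. c i * iexp (\<zeta> i * x)) =
         (\<Sum>j<J. iexp (s * (x - x0)) ^ j / of_nat J) + (\<Sum>j<J. - (iexp (a * x) * (iexp (s * (x - x0)) ^ j / of_nat J)))"
        unfolding sumA
      proof (intro arg_cong2[where f = "(+)"] sum.cong refl)
        fix j
        show "c (0, j) * iexp (\<zeta> (0, j) * x) = iexp (s * (x - x0)) ^ j / of_nat J"
          unfolding p by (simp add: c_def \<zeta>_def)
        have "iexp (\<zeta> (1, j) * x) = iexp (a * x) * iexp (real j * s * x)"
          by (simp add: \<zeta>_def algebra_simps flip: exp_add)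
        thus "c (1, j) * iexp (\<zeta> (1, j) * x) = - (iexp (a * x) * (iexp (s * (x - x0)) ^ j / of_nat J))"
          unfolding p by (simp add: c_def)
      qed
      also have "\<dots> = G J x"
        by (simp add: G_def av_def sum_negf sum_divide_distrib sum_distrib_left left_diff_distrib sum_subtractf diff_divide_distrib)
      finally show ?thesis .
    qed
    ultimately show ?thesis
      using exponent_conditionally_positive[OF \<sigma> char, where A = A and c = c and \<zeta> = \<zeta>] by (simp add: A_def)
  qed
  \<comment> \<open>One factor of |G|^2 is bounded by |a| |x| and the other by 2, which gives an
    integrable majorant even when the total mass is infinite.\<close>
  have bound: "norm (b x * (norm (G J x))\<^sup>2) \<le> 2 * \<bar>a\<bar> * (\<bar>b x\<bar> * \<bar>x\<bar>)" for J x
  proof -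
    have n1: "norm (1 - iexp (a * x)) \<le> \<bar>a\<bar> * \<bar>x\<bar>" using norm_iexp_diff_le[of 0 "a * x"] by (simp add: abs_mult)
    have n2: "norm (1 - iexp (a * x)) \<le> 2" using norm_triangle_ineq4[of 1 "iexp (a * x)"] by simp
    have "norm (G J x) \<le> norm (1 - iexp (a * x)) * 1"
      unfolding G_def norm_mult by (intro mult_left_mono av_le) auto
    hence "(norm (G J x))\<^sup>2 \<le> (\<bar>a\<bar> * \<bar>x\<bar>) * 2"
      unfolding power2_eq_square using n1 n2 by (intro mult_mono) auto
    hence "\<bar>b x\<bar> * (norm (G J x))\<^sup>2 \<le> \<bar>b x\<bar> * ((\<bar>a\<bar> * \<bar>x\<bar>) * 2)" by (intro mult_left_mono) auto
    thus ?thesis by (simp add: abs_mult mult_ac)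
  qed
  have eq: "(\<Sum>\<^sub>\<infinity>x\<in>Y. b x * (norm (G J x))\<^sup>2) = (LINT x|count_space Y. b x * (norm (G J x))\<^sup>2)" for J
    by (rule integral_count_space_infsum(2)[symmetric], rule summable_weights_bound(1)) (rule bound)
  have "(\<lambda>J. LINT x|count_space Y. b x * (norm (G J x))\<^sup>2) \<longlonglongrightarrow> (LINT x|count_space Y. (if x = x0 then 4 * b x0 else 0))"
  proof (rule integral_dominated_convergence[where w = "\<lambda>x. 2 * \<bar>a\<bar> * (\<bar>b x\<bar> * \<bar>x\<bar>)"])
    show "integrable (count_space Y) (\<lambda>x. 2 * \<bar>a\<bar> * (\<bar>b x\<bar> * \<bar>x\<bar>))"
      by (rule integral_count_space_infsum(1)) (auto intro!: summable_on_cmult_right summable_weights simp: abs_mult)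
    show "AE x in count_space Y. (\<lambda>J. b x * (norm (G J x))\<^sup>2) \<longlonglongrightarrow> (if x = x0 then 4 * b x0 else 0)"
      unfolding AE_count_space
    proof
      fix x assume x: "x \<in> Y"
      show "(\<lambda>J. b x * (norm (G J x))\<^sup>2) \<longlonglongrightarrow> (if x = x0 then 4 * b x0 else 0)"
      proof (cases "x = x0")
        case True
        have e: "iexp (a * x0) = -1" using x0_nz by (simp add: a_def exp_pi_i')
        have "norm (G J x) = 2" if "J > 0" for J
          using that unfolding G_def True e by (simp add: av_def)
        hence "\<And>J. J > 0 \<Longrightarrow> b x * (norm (G J x))\<^sup>2 = 4 * b x0" by (simp add: True)
        hence "\<forall>\<^sub>F J in sequentially. b x * (norm (G J x))\<^sup>2 = 4 * b x0"
          by (intro eventually_mono[OF eventually_gt_at_top[of 0]])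
        thus ?thesis using True by (simp add: tendsto_eventually)
      next
        case False
        have "(\<lambda>J. av J x) \<longlonglongrightarrow> 0" unfolding av_def
          by (rule average_unit_powers_tendsto_0) (use s x False in auto)
        hence "(\<lambda>J. b x * (norm ((1 - iexp (a * x)) * av J x))\<^sup>2) \<longlonglongrightarrow> b x * (norm ((1 - iexp (a * x)) * 0))\<^sup>2"
          by (intro tendsto_intros)
        thus ?thesis using False by (simp add: G_def)
      qed
    qed
  qed (use bound in auto)
  also have "(LINT x|count_space Y. (if x = x0 then 4 * b x0 else 0)) = 4 * b x0"
  proof -
    have "{a \<in> Y. (if a = x0 then 4 * b x0 else 0) \<noteq> 0} \<subseteq> {x0}" by auto
    hence "finite {a \<in> Y. (if a = x0 then 4 * b x0 else 0) \<noteq> 0}" by (rule finite_subset) auto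
    thus ?thesis using x0 by (subst lebesgue_integral_count_space_finite_support)
      (auto intro!: sum.neutral simp: if_distrib[of "\<lambda>t. t \<noteq> 0"] cong: conj_cong)
  qed
  finally have "4 * b x0 \<ge> 0"
    by (rule LIMSEQ_le_const) (use nonneg eq in auto)
  thus ?thesis by simp
qed

text \<open>The weights b / n are again nonnegative with finite moment and define the n-th root;
  Levy's uniqueness theorem identifies its n-fold convolution with \<sigma>.\<close>

lemma nonneg_imp_infinitely_divisible:
  assumes \<sigma>: "real_distribution \<sigma>" and char: "\<And>z. char \<sigma> z = exp (atomic_exponent b Y z)"
    and nonneg: "\<And>x. x \<in> Y \<Longrightarrow> b x \<ge> 0"
  shows "infinitely_divisible \<sigma>"
  unfolding infinitely_divisible_def
proof (intro conjI allI impI \<sigma>)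
  fix n :: nat assume n: "n \<ge> 1"
  interpret S: atomic_levy_measure "\<lambda>x. b x / real n" Y
  proof
    have "(\<lambda>x. \<bar>b x\<bar> * \<bar>x\<bar> * (1 / real n)) summable_on Y" by (intro summable_on_cmult_left summable_weights)
    thus "(\<lambda>x. \<bar>b x / real n\<bar> * \<bar>x\<bar>) summable_on Y" by (simp add: abs_div field_simps)
  qed (rule countable_atoms zero_not_atom)+
  obtain \<rho> where \<rho>: "real_distribution \<rho>" "\<And>z. char \<rho> z = exp (atomic_exponent (\<lambda>x. b x / real n) Y z)"
    using S.compound_poisson_exists nonneg by (auto simp: divide_nonneg_nonneg)
  have "atomic_exponent (\<lambda>x. b x / real n) Y z = atomic_exponent b Y z / of_nat n" for z
  proof -
    have "atomic_exponent (\<lambda>x. b x / real n) Y z = (\<Sum>\<^sub>\<infinity>x\<in>Y. (1 / of_nat n) * (complex_of_real (b x) * (iexp (z * x) - 1)))"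
      unfolding atomic_exponent_def by (intro infsum_cong) simp
    thus ?thesis unfolding atomic_exponent_def infsum_cmult_right' by simp
  qed
  hence "char (convolution_power n \<rho>) = char \<sigma>"
    using n by (auto simp: fun_eq_iff convolution_power_real_distribution[OF \<rho>(1)] \<rho>(2) char simp flip: exp_of_nat_mult)
  hence "\<sigma> = convolution_power n \<rho>"
    using Levy_uniqueness[OF \<sigma> convolution_power_real_distribution(1)[OF \<rho>(1)]] by metis
  thus "\<exists>\<rho>. real_distribution \<rho> \<and> \<sigma> = convolution_power n \<rho>" using \<rho>(1) by blast
qed

theorem infinitely_divisible_iff:
  assumes "real_distribution \<sigma>" "\<And>z. char \<sigma> z = exp (atomic_exponent b Y z)"
  shows "infinitely_divisible \<sigma> \<longleftrightarrow> (\<forall>x\<in>Y. b x \<ge> 0)"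
  using infinitely_divisible_imp_nonneg nonneg_imp_infinitely_divisible assms by blast

lemma summable_weights_min:
  fixes f :: "real \<Rightarrow> real"
  assumes "\<And>x. 0 \<le> f x" "\<And>x. f x \<le> \<bar>b x\<bar>"
  fixes h :: "real \<Rightarrow> 'b :: {banach, second_countable_topology}"
  assumes "\<And>x. norm (h x) \<le> C * \<bar>x\<bar>"
  shows "(\<lambda>x. norm (f x *\<^sub>R h x)) summable_on Y"
proof (rule summable_weights_bound(1))
  fix x
  have "norm (f x *\<^sub>R h x) \<le> \<bar>b x\<bar> * (C * \<bar>x\<bar>)"
    unfolding norm_scaleR using assms(1,2)[of x] assms(3)[of x] by (intro mult_mono) auto
  thus "norm (f x *\<^sub>R h x) \<le> C * (\<bar>b x\<bar> * \<bar>x\<bar>)" by (simp add: mult_ac)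
qed

section \<open>Quasi-infinite divisibility from the Jordan decomposition\<close>

text \<open>Meant for \<epsilon> = 1 and \<epsilon> = -1, the positive and the negative part of the
  signed measure. The pushforward by the identity passes from the discrete \<sigma>-algebra on
  \<open>Y\<close> to the Borel one.\<close>

definition part :: "real \<Rightarrow> real measure" where
  "part \<epsilon> = distr (density (count_space Y) (\<lambda>x. ennreal (max 0 (\<epsilon> * b x)))) borel (\<lambda>x. x)"

lemma sets_part [simp]: "sets (part \<epsilon>) = sets borel" "space (part \<epsilon>) = UNIV"
  by (simp_all add: part_def)

lemma emeasure_part_eq_0:
  assumes "A \<in> sets borel" "\<And>x. x \<in> A \<Longrightarrow> x \<in> Y \<Longrightarrow> \<epsilon> * b x \<le> 0"
  shows "emeasure (part \<epsilon>) A = 0"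
proof -
  have "emeasure (part \<epsilon>) A = (\<integral>\<^sup>+x. ennreal (max 0 (\<epsilon> * b x)) * indicator (A \<inter> Y) x \<partial>count_space Y)"
    unfolding part_def using assms(1) by (subst emeasure_distr) (auto simp: emeasure_density)
  also have "\<dots> = (\<integral>\<^sup>+x. 0 \<partial>count_space Y)"
    by (intro nn_integral_cong) (auto simp: indicator_def max_def intro: antisym dest: assms(2))
  finally show ?thesis by simp
qed

lemma part_integral:
  fixes h :: "real \<Rightarrow> 'b :: {banach, second_countable_topology}"
  assumes \<epsilon>: "\<bar>\<epsilon>\<bar> = 1" and h: "h \<in> borel_measurable borel" "\<And>x. norm (h x) \<le> C * \<bar>x\<bar>"
  shows "integrable (part \<epsilon>) h" "((\<lambda>x. max 0 (\<epsilon> * b x) *\<^sub>R h x) has_sum (LINT x|part \<epsilon>. h x)) Y"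
proof -
  have le: "max 0 (\<epsilon> * b x) \<le> \<bar>b x\<bar>" for x using \<epsilon> abs_ge_self[of "\<epsilon> * b x"] by (simp add: abs_mult)
  have sm: "(\<lambda>x. norm (max 0 (\<epsilon> * b x) *\<^sub>R h x)) summable_on Y"
    by (rule summable_weights_min[where C = C]) (use le h in auto)
  note int = integral_count_space_infsum[OF sm]
  show "integrable (part \<epsilon>) h"
  proof -
    have "integrable (density (count_space Y) (\<lambda>x. ennreal (max 0 (\<epsilon> * b x)))) h"
      by (subst integrable_density) (use int(1) in auto)
    thus ?thesis unfolding part_def using h(1) by (subst integrable_distr_eq) auto
  qed
  have "(LINT x|part \<epsilon>. h x) = infsum (\<lambda>x. max 0 (\<epsilon> * b x) *\<^sub>R h x) Y"
  proof -
    have "(LINT x|density (count_space Y) (\<lambda>x. ennreal (max 0 (\<epsilon> * b x))). h x) = infsum (\<lambda>x. max 0 (\<epsilon> * b x) *\<^sub>R h x) Y"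
      unfolding int(2)[symmetric] by (subst integral_density) auto
    thus ?thesis unfolding part_def using h(1) by (subst integral_distr) auto
  qed
  thus "((\<lambda>x. max 0 (\<epsilon> * b x) *\<^sub>R h x) has_sum (LINT x|part \<epsilon>. h x)) Y"
    using has_sum_infsum[OF abs_summable_summable[OF sm]] by simp
qed

text \<open>Each part integrates every measurable function bounded by a multiple of |x|, so the
  compensator can be split off and summed separately; its sum is the drift \<gamma>, and the
  Gaussian coefficient is 0.\<close>

theorem quasi_infinitely_divisibleI:
  assumes \<sigma>: "real_distribution \<sigma>" "\<And>z. char \<sigma> z = exp (atomic_exponent b Y z)"
  shows "quasi_infinitely_divisible \<sigma>"
proof -
  define \<gamma> where "\<gamma> = (\<Sum>\<^sub>\<infinity>x\<in>Y. b x * (x * indicator {-1..1} x))"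
  have kernel: "norm (levy_khintchine_kernel z x) \<le> (2 * \<bar>z\<bar>) * \<bar>x\<bar>" for z x
  proof -
    have "norm (levy_khintchine_kernel z x) \<le> norm (iexp (z * x) - 1) + norm (\<i> * complex_of_real (z * x * indicator {-1..1} x))"
      unfolding levy_khintchine_kernel_def by (rule norm_triangle_ineq4)
    also have "norm (iexp (z * x) - 1) \<le> \<bar>z * x\<bar>" using norm_iexp_diff_le[of "z * x" 0] by simp
    also have "norm (\<i> * complex_of_real (z * x * indicator {-1..1} x)) \<le> \<bar>z * x\<bar>"
      by (auto simp: norm_mult indicator_def simp flip: abs_mult of_real_mult)
    finally show ?thesis by (simp add: abs_mult mult_ac)
  qed
  have kmeas: "levy_khintchine_kernel z \<in> borel_measurable borel" for z
    unfolding levy_khintchine_kernel_def by measurable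
  have char: "char \<sigma> z = exp (\<i> * complex_of_real (\<gamma> * z) - complex_of_real (0 * z\<^sup>2)
     + ((LINT x|part 1. levy_khintchine_kernel z x) - (LINT x|part (-1). levy_khintchine_kernel z x)))" for z
  proof -
    let ?K = "levy_khintchine_kernel z"
    have "((\<lambda>x. max 0 (1 * b x) *\<^sub>R ?K x + (- 1) *\<^sub>R (max 0 (- 1 * b x) *\<^sub>R ?K x)) has_sum
       (LINT x|part 1. ?K x) + (- 1) *\<^sub>R (LINT x|part (-1). ?K x)) Y"
      by (intro has_sum_add has_sum_scaleR part_integral(2)[OF _ kmeas kernel]) auto
    also have "(\<lambda>x. max 0 (1 * b x) *\<^sub>R ?K x + (- 1) *\<^sub>R (max 0 (- 1 * b x) *\<^sub>R ?K x)) =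
      (\<lambda>x. complex_of_real (b x) * (iexp (z * x) - 1) + (- (\<i> * z)) * complex_of_real (b x * (x * indicator {-1..1} x)))"
      by (auto simp: fun_eq_iff levy_khintchine_kernel_def max_def scaleR_conv_of_real algebra_simps)
    finally have 1: "((\<lambda>x. complex_of_real (b x) * (iexp (z * x) - 1) + (- (\<i> * z)) * complex_of_real (b x * (x * indicator {-1..1} x))) has_sum
       (LINT x|part 1. ?K x) - (LINT x|part (-1). ?K x)) Y" by simp
    have "((\<lambda>x. b x * (x * indicator {-1..1} x)) has_sum \<gamma>) Y"
      unfolding \<gamma>_def
      by (rule has_sum_infsum, rule summable_weights_bound(2)[where C = 1]) (auto simp: indicator_def abs_mult)
    hence "((\<lambda>x. complex_of_real (b x) * (iexp (z * x) - 1) + (- (\<i> * z)) * complex_of_real (b x * (x * indicator {-1..1} x))) has_sum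
       atomic_exponent b Y z + (- (\<i> * z)) * complex_of_real \<gamma>) Y"
      unfolding atomic_exponent_def
      by (intro has_sum_add has_sum_cmult_right has_sum_infsum exponent_summable has_sum_of_real)
    from has_sum_unique[OF this 1]
    have "atomic_exponent b Y z = \<i> * complex_of_real (\<gamma> * z) - complex_of_real (0 * z\<^sup>2)
     + ((LINT x|part 1. ?K x) - (LINT x|part (-1). ?K x))" by (simp add: algebra_simps)
    thus ?thesis unfolding \<sigma>(2) by (simp only:)
  qed
  have Yb: "A \<in> sets borel" if "A \<subseteq> Y" for A :: "real set"
    using countable_subset[OF that countable_atoms] by (rule sets.countable[rotated]) auto
  have min_le: "norm (min (x\<^sup>2) 1) \<le> 1 * \<bar>x\<bar>" for x :: real
  proof (cases "\<bar>x\<bar> \<le> 1")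
    case True
    hence "\<bar>x\<bar> * \<bar>x\<bar> \<le> \<bar>x\<bar> * 1" by (intro mult_left_mono) auto
    thus ?thesis by (auto simp: power2_eq_square min_def)
  qed (auto simp: min_def)
  show ?thesis unfolding quasi_infinitely_divisible_def
  proof (intro conjI exI allI)
    show "char \<sigma> z = exp (\<i> * complex_of_real (\<gamma> * z) - complex_of_real (0 * z\<^sup>2)
     + ((LINT x|part 1. levy_khintchine_kernel z x) - (LINT x|part (-1). levy_khintchine_kernel z x)))" for z
      by (rule char)
    show "mutually_singular (part 1) (part (- 1))" unfolding mutually_singular_def
    proof (intro conjI bexI[of _ "{x\<in>Y. b x < 0}"])
      show "emeasure (part 1) {x\<in>Y. b x < 0} = 0" by (rule emeasure_part_eq_0) (auto intro: Yb)
      show "emeasure (part (- 1)) (space (part 1) - {x\<in>Y. b x < 0}) = 0"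
        by (rule emeasure_part_eq_0) (auto intro!: Yb borel_comp[unfolded Compl_eq_Diff_UNIV])
      show "{x\<in>Y. b x < 0} \<in> sets (part 1)" by (auto intro: Yb)
    qed simp
    show "emeasure (part 1) {0} = 0" "emeasure (part (- 1)) {0} = 0"
      using zero_not_atom by (auto intro!: emeasure_part_eq_0)
    show "integrable (part 1) (\<lambda>x. min (x\<^sup>2) 1)" "integrable (part (- 1)) (\<lambda>x. min (x\<^sup>2) 1)"
      by (rule part_integral(1)[OF _ _ min_le]; simp)+
  qed (simp_all add: \<sigma>(1))
qed

end

section \<open>The characteristic function of the exponential integral\<close>

lemma norm_exp_minus_one_le:
  fixes w :: complex
  assumes "Re w \<le> 0"
  shows "norm (exp w - 1) \<le> norm w"
proof -
  have "norm (exp w - exp 0) \<le> 1 * norm (w - 0)"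
  proof (rule field_differentiable_bound)
    show "convex {z. Re z \<le> 0}" by (rule convex_halfspace_Re_le)
    show "(exp has_field_derivative exp z) (at z within {z. Re z \<le> 0})" for z :: complex
      by (rule DERIV_subset[OF DERIV_exp]) auto
  qed (use assms in auto)
  thus ?thesis by simp
qed

text \<open>Up to sign the logarithm of one factor of the functional equation: x = \<rho> for the
  numerator, x = - q for the denominator. The subtraction makes it vanish at \<zeta> = 0, and this
  lets the sum over all scales \<zeta> / c^n converge.\<close>

definition log_ratio :: "real \<Rightarrow> complex \<Rightarrow> complex" where
  "log_ratio x \<zeta> = Ln (1 + of_real x * exp \<zeta>) - Ln (1 + of_real x)"

lemma norm_mult_exp_less_1:
  assumes "\<bar>x\<bar> < 1" "Re \<zeta> \<le> 0"
  shows "norm (of_real x * exp \<zeta>) < 1"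
proof -
  have "norm (of_real x * exp \<zeta>) \<le> \<bar>x\<bar> * 1" unfolding norm_mult using assms by (intro mult_mono) auto
  thus ?thesis using assms by simp
qed

lemma Re_one_plus_pos: "norm (z :: complex) < 1 \<Longrightarrow> Re (1 + z) > 0"
  using abs_Re_le_cmod[of z] by simp

lemma exp_log_ratio:
  assumes "\<bar>x\<bar> < 1" "Re \<zeta> \<le> 0"
  shows "exp (log_ratio x \<zeta>) = (1 + of_real x * exp \<zeta>) / (1 + of_real x)"
proof -
  have "Re (1 + of_real x * exp \<zeta>) > 0" "Re (1 + of_real x) > 0"
    using Re_one_plus_pos[OF norm_mult_exp_less_1[OF assms]] Re_one_plus_pos[of "of_real x"] assms by auto
  hence "1 + of_real x * exp \<zeta> \<noteq> 0" "1 + (of_real x :: complex) \<noteq> 0" by (auto simp del: plus_complex.sel)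
  thus ?thesis unfolding log_ratio_def exp_diff by simp
qed

text \<open>In the logarithmic series the denominator m is compensated by |exp (m \<zeta>) - 1|
  \<le> m |\<zeta>|, valid for Re \<zeta> \<le> 0, which leaves a geometric series times |\<zeta>|.
  The coefficients later become the weights of the atoms.\<close>

lemma log_ratio_series:
  assumes x: "\<bar>x\<bar> < 1" and \<zeta>: "Re \<zeta> \<le> 0"
  defines "t \<equiv> \<lambda>m. complex_of_real (- ((- x) ^ Suc m) / real (Suc m)) * (exp (of_nat (Suc m) * \<zeta>) - 1)"
  shows "t sums log_ratio x \<zeta>" "norm (t m) \<le> norm \<zeta> * (\<bar>x\<bar> ^ Suc m)"
    "summable (\<lambda>m. norm (t m))" "norm (log_ratio x \<zeta>) \<le> norm \<zeta> * (\<bar>x\<bar> / (1 - \<bar>x\<bar>))"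
proof -
  have s: "(\<lambda>m. - ((- w) ^ Suc m) / of_nat (Suc m)) sums Ln (1 + w)" if "norm w < 1" for w :: complex
  proof -
    have "(\<lambda>n. - ((- w) ^ n) / of_nat n) sums Ln (1 + w)" using that by (rule Ln_series')
    thus ?thesis using sums_Suc_iff[of "\<lambda>n. - ((- w) ^ n) / of_nat n" "Ln (1 + w)"] by simp
  qed
  have "(\<lambda>m. - ((- (of_real x * exp \<zeta>)) ^ Suc m) / of_nat (Suc m) - - ((- of_real x) ^ Suc m) / of_nat (Suc m)) sums log_ratio x \<zeta>"
    unfolding log_ratio_def using x by (intro sums_diff s norm_mult_exp_less_1 x \<zeta>) auto
  also have "(\<lambda>m. - ((- (of_real x * exp \<zeta>)) ^ Suc m) / of_nat (Suc m) - - ((- of_real x) ^ Suc m) / of_nat (Suc m)) = t"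
  proof
    fix m
    have "(- (of_real x * exp \<zeta>)) ^ Suc m = (- of_real x) ^ Suc m * exp (of_nat (Suc m) * \<zeta>)"
      unfolding exp_of_nat_mult power_mult_distrib[symmetric] by simp
    thus "- ((- (of_real x * exp \<zeta>)) ^ Suc m) / of_nat (Suc m) - - ((- of_real x) ^ Suc m) / of_nat (Suc m) = t m"
      by (simp only: t_def of_real_divide of_real_minus of_real_power of_real_of_nat_eq) (simp add: algebra_simps diff_divide_distrib)
  qed
  finally show 1: "t sums log_ratio x \<zeta>" .
  show 2: "norm (t m) \<le> norm \<zeta> * (\<bar>x\<bar> ^ Suc m)" for m
  proof -
    have "norm (t m) \<le> \<bar>x\<bar> ^ Suc m / real (Suc m) * norm (of_nat (Suc m) * \<zeta>)"
      unfolding t_def norm_mult[of "complex_of_real _"] using \<zeta>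
      by (intro mult_mono norm_exp_minus_one_le) (auto simp: norm_divide norm_power norm_mult abs_mult power_abs mult_nonneg_nonpos simp del: of_nat_Suc)
    thus ?thesis by (simp add: norm_mult mult_ac del: of_nat_Suc power_Suc)
  qed
  have g: "(\<lambda>m. norm \<zeta> * \<bar>x\<bar> ^ Suc m) sums (norm \<zeta> * (\<bar>x\<bar> / (1 - \<bar>x\<bar>)))"
    using sums_mult[OF geometric_sums[of "\<bar>x\<bar>"], of "norm \<zeta> * \<bar>x\<bar>"] x by (simp add: mult_ac)
  show 3: "summable (\<lambda>m. norm (t m))"
    by (rule summable_comparison_test'[OF sums_summable[OF g]]) (use 2 in auto)
  have "norm (log_ratio x \<zeta>) \<le> (\<Sum>m. norm (t m))" using summable_norm[OF 3] sums_unique[OF 1] by simp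
  also have "\<dots> \<le> (\<Sum>m. norm \<zeta> * \<bar>x\<bar> ^ Suc m)" by (rule suminf_le[OF 2 3 sums_summable[OF g]])
  finally show "norm (log_ratio x \<zeta>) \<le> norm \<zeta> * (\<bar>x\<bar> / (1 - \<bar>x\<bar>))" using sums_unique[OF g] by simp
qed

lemma continuous_on_log_ratio:
  assumes "\<bar>x\<bar> < 1"
  shows "continuous_on {\<zeta>. Re \<zeta> \<le> 0} (log_ratio x)"
proof -
  have "1 + complex_of_real x * exp \<zeta> \<notin> \<real>\<^sub>\<le>\<^sub>0" if "Re \<zeta> \<le> 0" for \<zeta>
    using Re_one_plus_pos[OF norm_mult_exp_less_1[OF assms that]] by (force simp: complex_nonpos_Reals_iff)
  hence "continuous_on {\<zeta>. Re \<zeta> \<le> 0} (\<lambda>\<zeta>. Ln (1 + of_real x * exp \<zeta>))"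
    by (intro continuous_on_Ln continuous_intros) auto
  thus ?thesis unfolding log_ratio_def by (intro continuous_on_diff continuous_on_const)
qed

section \<open>The transform as an infinite product\<close>

locale ou_exponent =
  fixes c q \<rho> :: real and \<kappa> :: nat
  assumes c: "c > 1" and q: "0 \<le> q" "q < 1" and \<rho>: "0 < \<rho>" "\<rho> < 1"
begin

text \<open>The logarithm of phi \<zeta> / phi (\<zeta> / c) prescribed by the functional equation;
  \<open>psi\<close> adds it up along \<zeta>, \<zeta> / c, \<zeta> / c^2 and so on.\<close>

definition g :: "complex \<Rightarrow> complex" where
  "g \<zeta> = log_ratio \<rho> (of_real c ^ \<kappa> * \<zeta>) - log_ratio (- q) \<zeta>"

definition psi :: "complex \<Rightarrow> complex" where "psi \<zeta> = (\<Sum>n. g (\<zeta> / of_real c ^ n))"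

definition phi :: "complex \<Rightarrow> complex" where "phi \<zeta> = exp (psi \<zeta>)"

definition K :: real where "K = (c ^ \<kappa> * (\<rho> / (1 - \<rho>)) + q / (1 - q)) * (1 / (1 - 1 / c))"

lemma Re_scale: "x \<ge> 0 \<Longrightarrow> Re \<zeta> \<le> 0 \<Longrightarrow> Re (of_real x * \<zeta>) \<le> 0"
  by (simp add: mult_nonneg_nonpos)

lemma Re_scale':
  assumes "Re \<zeta> \<le> 0"
  shows "Re (of_real c ^ n * \<zeta>) \<le> 0" "Re (\<zeta> / of_real c ^ n) \<le> 0" "Re (\<zeta> / of_real c) \<le> 0"
proof -
  show "Re (of_real c ^ n * \<zeta>) \<le> 0" using Re_scale[OF _ assms, of "c ^ n"] c by simp
  have "Re (\<zeta> / of_real c ^ n) \<le> 0" for n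
    using Re_scale[OF _ assms, of "inverse (c ^ n)"] c by (simp add: field_class.field_divide_inverse mult.commute)
  from this[of n] this[of 1] show "Re (\<zeta> / of_real c ^ n) \<le> 0" "Re (\<zeta> / of_real c) \<le> 0" by simp_all
qed

lemma norm_g_le:
  assumes "Re \<zeta> \<le> 0"
  shows "norm (g \<zeta>) \<le> (c ^ \<kappa> * (\<rho> / (1 - \<rho>)) + q / (1 - q)) * norm \<zeta>"
proof -
  have "norm (g \<zeta>) \<le> norm (log_ratio \<rho> (of_real c ^ \<kappa> * \<zeta>)) + norm (log_ratio (- q) \<zeta>)"
    unfolding g_def by (rule norm_triangle_ineq4)
  also have "\<dots> \<le> norm (of_real c ^ \<kappa> * \<zeta>) * (\<bar>\<rho>\<bar> / (1 - \<bar>\<rho>\<bar>)) + norm \<zeta> * (\<bar>-q\<bar> / (1 - \<bar>-q\<bar>))"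
    using \<rho> q by (intro add_mono log_ratio_series(4) Re_scale' assms) auto
  finally show ?thesis using c \<rho> q by (simp add: norm_mult norm_power algebra_simps)
qed

lemma psi_sums:
  assumes "Re \<zeta> \<le> 0"
  shows "(\<lambda>n. g (\<zeta> / of_real c ^ n)) sums psi \<zeta>" "norm (psi \<zeta>) \<le> K * norm \<zeta>"
proof -
  define C where "C = (c ^ \<kappa> * (\<rho> / (1 - \<rho>)) + q / (1 - q))"
  have le: "norm (g (\<zeta> / of_real c ^ n)) \<le> C * norm \<zeta> * (1 / c) ^ n" for n
    using norm_g_le[OF Re_scale'(2)[OF assms], of n] c by (simp add: C_def norm_divide norm_power power_one_over)
  have gs: "(\<lambda>n. C * norm \<zeta> * (1 / c) ^ n) sums (C * norm \<zeta> * (1 / (1 - 1 / c)))"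
    using c by (intro sums_mult geometric_sums) auto
  have sm: "summable (\<lambda>n. norm (g (\<zeta> / of_real c ^ n)))"
    by (rule summable_comparison_test'[OF sums_summable[OF gs]]) (use le in auto)
  show "(\<lambda>n. g (\<zeta> / of_real c ^ n)) sums psi \<zeta>"
    unfolding psi_def by (rule summable_sums[OF summable_norm_cancel[OF sm]])
  have "norm (psi \<zeta>) \<le> (\<Sum>n. norm (g (\<zeta> / of_real c ^ n)))" unfolding psi_def by (rule summable_norm[OF sm])
  also have "\<dots> \<le> (\<Sum>n. C * norm \<zeta> * (1 / c) ^ n)" by (rule suminf_le[OF le sm sums_summable[OF gs]])
  also have "\<dots> = K * norm \<zeta>" using sums_unique[OF gs] by (simp add: K_def C_def)
  finally show "norm (psi \<zeta>) \<le> K * norm \<zeta>" .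
qed

lemma exp_g:
  assumes "Re \<zeta> \<le> 0"
  shows "exp (g \<zeta>) = (1 + of_real \<rho> * exp (of_real c ^ \<kappa> * \<zeta>)) / (1 + of_real \<rho>) * ((1 - of_real q) / (1 - of_real q * exp \<zeta>))"
proof -
  have "exp (log_ratio \<rho> (of_real c ^ \<kappa> * \<zeta>)) = (1 + of_real \<rho> * exp (of_real c ^ \<kappa> * \<zeta>)) / (1 + of_real \<rho>)"
    using \<rho> by (intro exp_log_ratio Re_scale' assms) auto
  moreover have "exp (log_ratio (- q) \<zeta>) = (1 + of_real (- q) * exp \<zeta>) / (1 + of_real (- q))"
    using q by (intro exp_log_ratio assms) auto
  ultimately show ?thesis unfolding g_def exp_diff by simp
qed

lemma phi_functional_equation:
  assumes "Re \<zeta> \<le> 0"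
  shows "phi \<zeta> * (1 - of_real q * exp \<zeta>) * (1 + of_real \<rho>) = (1 - of_real q) * (1 + of_real \<rho> * exp (of_real c ^ \<kappa> * \<zeta>)) * phi (\<zeta> / of_real c)"
proof -
  have "psi \<zeta> = g (\<zeta> / of_real c ^ 0) + (\<Sum>n. g (\<zeta> / of_real c ^ Suc n))"
    using suminf_split_head[OF sums_summable[OF psi_sums(1)[OF assms]]] by (simp add: psi_def)
  also have "\<dots> = g \<zeta> + psi (\<zeta> / of_real c)" by (simp add: psi_def)
  finally have "phi \<zeta> = exp (g \<zeta>) * phi (\<zeta> / of_real c)" by (simp add: phi_def exp_add)
  moreover have "1 - of_real q * exp \<zeta> \<noteq> 0"
    using norm_mult_exp_less_1[OF _ assms, of q] q by auto
  moreover have "1 + complex_of_real \<rho> \<noteq> 0" using \<rho> by (metis add_pos_pos less_irrefl of_real_1 of_real_add of_real_eq_0_iff zero_less_one)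
  moreover have "(a / b * (d / e)) * f * e * b = d * a * f" if "b \<noteq> 0" "e \<noteq> 0" for a b d e f :: complex
    using that by simp
  ultimately show ?thesis unfolding exp_g[OF assms] by metis
qed

text \<open>Each factor has modulus at most 1 because the normalising constants 1 + \<rho> and 1 - q
  are the extreme values of |1 + \<rho> exp (c^\<kappa> \<zeta>)| and |1 - q exp \<zeta>|. Thus
  \<open>phi\<close> is bounded by 1 before it is known to be the transform of a law.\<close>

lemma Re_g_le_0:
  assumes "Re \<zeta> \<le> 0"
  shows "Re (g \<zeta>) \<le> 0"
proof -
  have "norm (1 + of_real \<rho> * exp (of_real c ^ \<kappa> * \<zeta>)) \<le> norm (1 :: complex) + norm (of_real \<rho> * exp (of_real c ^ \<kappa> * \<zeta>))"
    by (rule norm_triangle_ineq)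
  also have "\<dots> \<le> 1 + \<rho> * 1" unfolding norm_mult using \<rho> Re_scale'(1)[OF assms, of \<kappa>] by (intro add_mono mult_mono) auto
  finally have 1: "norm (1 + of_real \<rho> * exp (of_real c ^ \<kappa> * \<zeta>)) \<le> 1 + \<rho>" by simp
  have "norm (of_real q * exp \<zeta>) \<le> q * 1" unfolding norm_mult using q assms by (intro mult_mono) auto
  hence 2: "1 - q \<le> norm (1 - of_real q * exp \<zeta>)" using norm_triangle_ineq2[of 1 "of_real q * exp \<zeta>"] by simp
  have "norm (complex_of_real (1 + \<rho>)) = 1 + \<rho>" "norm (complex_of_real (1 - q)) = 1 - q"
    unfolding norm_of_real using \<rho> q by simp_all
  hence "norm (1 + complex_of_real \<rho>) = 1 + \<rho>" "norm (1 - complex_of_real q) = 1 - q"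
    unfolding of_real_add of_real_diff of_real_1 by simp_all
  note n = this
  have "norm (exp (g \<zeta>)) = norm (1 + of_real \<rho> * exp (of_real c ^ \<kappa> * \<zeta>)) / (1 + \<rho>) * ((1 - q) / norm (1 - of_real q * exp \<zeta>))"
    unfolding exp_g[OF assms] norm_mult[of "_ / _"] norm_divide n by (rule refl)
  also have "\<dots> \<le> 1 * 1" using 1 2 \<rho> q by (intro mult_mono) (auto simp: divide_le_eq_1)
  finally show ?thesis by simp
qed

lemma norm_phi_le_1:
  assumes "Re \<zeta> \<le> 0"
  shows "norm (phi \<zeta>) \<le> 1"
proof -
  have "(\<lambda>n. Re (g (\<zeta> / of_real c ^ n))) sums Re (psi \<zeta>)" by (rule sums_Re[OF psi_sums(1)[OF assms]])
  from sums_le[OF _ this sums_zero] have "Re (psi \<zeta>) \<le> 0" using Re_g_le_0 Re_scale'(2) assms by blast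
  thus ?thesis by (simp add: phi_def)
qed

lemma norm_phi_minus_1_le:
  assumes "Re \<zeta> \<le> 0"
  shows "norm (phi \<zeta> - 1) \<le> K * norm \<zeta>"
proof -
  have "Re (psi \<zeta>) \<le> 0" using norm_phi_le_1[OF assms] by (simp add: phi_def)
  thus ?thesis unfolding phi_def using norm_exp_minus_one_le psi_sums(2)[OF assms] order_trans by blast
qed

text \<open>Continuity of \<open>g\<close> is available on the closed left half-plane only, so the
  approximating partial sums are cut off outside it.\<close>

lemma phi_measurable:
  assumes "f \<in> borel_measurable M" "\<And>x. x \<in> space M \<Longrightarrow> Re (f x) \<le> 0"
  shows "(\<lambda>x. phi (f x)) \<in> borel_measurable M"
proof -
  have gc: "continuous_on {\<zeta>. Re \<zeta> \<le> 0} g"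
    unfolding g_def using \<rho> q
    by (intro continuous_intros continuous_on_compose2[OF continuous_on_log_ratio]) (auto intro: Re_scale')
  have gm: "(\<lambda>\<zeta>. indicator {\<zeta>. Re \<zeta> \<le> 0} \<zeta> *\<^sub>R g \<zeta>) \<in> borel_measurable borel"
    by (rule borel_measurable_continuous_on_indicator[OF _ gc]) simp
  have "(\<lambda>x. psi (f x)) \<in> borel_measurable M"
  proof (rule borel_measurable_LIMSEQ_metric)
    show "(\<lambda>N. \<Sum>n<N. indicator {\<zeta>. Re \<zeta> \<le> 0} (f x / of_real c ^ n) *\<^sub>R g (f x / of_real c ^ n)) \<longlonglongrightarrow> psi (f x)" if "x \<in> space M" for x
      using psi_sums(1)[OF assms(2)[OF that]] Re_scale'(2)[OF assms(2)[OF that]] unfolding sums_def by simp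
    show "(\<lambda>x. \<Sum>n<N. indicator {\<zeta>. Re \<zeta> \<le> 0} (f x / of_real c ^ n) *\<^sub>R g (f x / of_real c ^ n)) \<in> borel_measurable M" for N
      by (intro borel_measurable_sum measurable_compose[OF _ gm] borel_measurable_divide assms(1) borel_measurable_const)
  qed
  thus ?thesis unfolding phi_def by measurable
qed

end

text \<open>Weights \<open>w i\<close> sitting at not necessarily distinct positions \<open>pos i\<close>.\<close>

locale weighted_positions =
  fixes w pos :: "'i :: countable \<Rightarrow> real"
  assumes summable_moment: "(\<lambda>i. \<bar>w i\<bar> * \<bar>pos i\<bar>) summable_on UNIV"
    and pos_nonzero: "\<And>i. pos i \<noteq> 0"
begin

definition fibre :: "real \<Rightarrow> 'i set" where "fibre x = {i. pos i = x}"

definition atom :: "real \<Rightarrow> real" where "atom x = (\<Sum>\<^sub>\<infinity>i\<in>fibre x. w i)"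

text \<open>On the fibre over x the moment series is |x| times the weight series; the fibre over 0
  is empty.\<close>

lemma fibre_summable: "(\<lambda>i. norm (w i)) summable_on fibre x"
proof (cases "x = 0")
  case True
  thus ?thesis using pos_nonzero by (simp add: fibre_def)
next
  case False
  have "(\<lambda>i. \<bar>w i\<bar> * \<bar>pos i\<bar>) summable_on fibre x"
    by (rule summable_on_subset_banach[OF summable_moment]) auto
  hence "(\<lambda>i. \<bar>w i\<bar> * \<bar>x\<bar>) summable_on fibre x"
    by (rule summable_on_cong[THEN iffD1, rotated]) (auto simp: fibre_def)
  thus ?thesis using False summable_on_cmult_left'[of "\<bar>x\<bar>" "\<lambda>i. \<bar>w i\<bar>"] by simp
qed

lemma infsum_by_fibres:
  fixes f :: "'i \<Rightarrow> 'b :: banach"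
  assumes "(\<lambda>i. norm (f i)) summable_on UNIV"
  shows "(\<Sum>\<^sub>\<infinity>i. f i) = (\<Sum>\<^sub>\<infinity>x\<in>range pos. \<Sum>\<^sub>\<infinity>i\<in>fibre x. f i)"
    "(\<lambda>x. (\<Sum>\<^sub>\<infinity>i\<in>fibre x. norm (f i))) summable_on range pos"
proof -
  have bij: "bij_betw (\<lambda>i. (pos i, i)) UNIV (Sigma (range pos) fibre)"
    by (rule bij_betw_byWitness[where f' = snd]) (auto simp: fibre_def)
  have "(\<lambda>(x, i). norm (f i)) summable_on Sigma (range pos) fibre"
    using summable_on_reindex_bij_betw[OF bij, of "\<lambda>(x, i). norm (f i)"] assms by simp
  hence 1: "(\<lambda>z. norm ((\<lambda>(x, i). f i) z)) summable_on Sigma (range pos) fibre"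
    by (simp add: case_prod_unfold)
  have "(\<Sum>\<^sub>\<infinity>i. f i) = infsum (\<lambda>(x, i). f i) (Sigma (range pos) fibre)"
    using infsum_reindex_bij_betw[OF bij, of "\<lambda>(x, i). f i"] by simp
  also have "\<dots> = (\<Sum>\<^sub>\<infinity>x\<in>range pos. \<Sum>\<^sub>\<infinity>i\<in>fibre x. f i)"
    using infsum_Sigma_banach[OF abs_summable_summable[OF 1]] by simp
  finally show "(\<Sum>\<^sub>\<infinity>i. f i) = (\<Sum>\<^sub>\<infinity>x\<in>range pos. \<Sum>\<^sub>\<infinity>i\<in>fibre x. f i)" .
  have "(\<lambda>x. norm (\<Sum>\<^sub>\<infinity>i\<in>fibre x. norm (f i))) summable_on range pos"
    using Infinite_Sum.abs_summable_on_Sigma_iff[of "\<lambda>(x, i). f i" "range pos" fibre] 1 by simp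
  thus "(\<lambda>x. (\<Sum>\<^sub>\<infinity>i\<in>fibre x. norm (f i))) summable_on range pos"
    by (simp add: infsum_nonneg)
qed

sublocale atomic_levy_measure atom "range pos"
proof
  show "countable (range pos)" by auto
  show "0 \<notin> range pos" using pos_nonzero by force
  have "(\<lambda>i. norm (w i * pos i)) summable_on UNIV" using summable_moment by (simp add: abs_mult)
  from infsum_by_fibres(2)[OF this]
  show "(\<lambda>x. \<bar>atom x\<bar> * \<bar>x\<bar>) summable_on range pos"
  proof (rule summable_on_comparison_test)
    fix x assume "x \<in> range pos"
    have "\<bar>atom x\<bar> \<le> (\<Sum>\<^sub>\<infinity>i\<in>fibre x. \<bar>w i\<bar>)"
      unfolding atom_def using norm_infsum_bound[OF fibre_summable[of x]] by simp
    hence "\<bar>atom x\<bar> * \<bar>x\<bar> \<le> (\<Sum>\<^sub>\<infinity>i\<in>fibre x. \<bar>w i\<bar>) * \<bar>x\<bar>" by (intro mult_right_mono) auto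
    also have "\<dots> = (\<Sum>\<^sub>\<infinity>i\<in>fibre x. \<bar>w i\<bar> * \<bar>x\<bar>)" by (rule infsum_cmult_left'[symmetric])
    also have "\<dots> = (\<Sum>\<^sub>\<infinity>i\<in>fibre x. norm (w i * pos i))"
      by (intro infsum_cong) (auto simp: fibre_def abs_mult)
    finally show "\<bar>atom x\<bar> * \<bar>x\<bar> \<le> (\<Sum>\<^sub>\<infinity>i\<in>fibre x. norm (w i * pos i))" .
  qed auto
qed

lemma atomic_exponent_eq_infsum:
  "atomic_exponent atom (range pos) z = (\<Sum>\<^sub>\<infinity>i. complex_of_real (w i) * (iexp (z * pos i) - 1))"
proof -
  have "(\<lambda>i. norm (complex_of_real (w i) * (iexp (z * pos i) - 1))) summable_on UNIV"
  proof (rule Infinite_Sum.abs_summable_on_comparison_test[where g = "\<lambda>i. \<bar>z\<bar> * (\<bar>w i\<bar> * \<bar>pos i\<bar>)"])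
    show "(\<lambda>i. norm (\<bar>z\<bar> * (\<bar>w i\<bar> * \<bar>pos i\<bar>))) summable_on UNIV"
      using summable_on_cmult_right[OF summable_moment, of "\<bar>z\<bar>"] by (simp add: abs_mult)
    fix i
    have "norm (complex_of_real (w i) * (iexp (z * pos i) - 1)) = \<bar>w i\<bar> * norm (iexp (z * pos i) - iexp 0)"
      by (simp only: norm_mult norm_of_real) simp
    also have "\<dots> \<le> \<bar>w i\<bar> * \<bar>z * pos i - 0\<bar>" by (intro mult_left_mono norm_iexp_diff_le) auto
    finally show "norm (complex_of_real (w i) * (iexp (z * pos i) - 1)) \<le> norm (\<bar>z\<bar> * (\<bar>w i\<bar> * \<bar>pos i\<bar>))"
      by (simp add: abs_mult mult_ac)
  qed
  from infsum_by_fibres(1)[OF this]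
  have "(\<Sum>\<^sub>\<infinity>i. complex_of_real (w i) * (iexp (z * pos i) - 1)) =
    (\<Sum>\<^sub>\<infinity>x\<in>range pos. \<Sum>\<^sub>\<infinity>i\<in>fibre x. complex_of_real (w i) * (iexp (z * pos i) - 1))" .
  also have "\<dots> = atomic_exponent atom (range pos) z"
    unfolding atomic_exponent_def
  proof (intro infsum_cong)
    fix x
    have "(\<Sum>\<^sub>\<infinity>i\<in>fibre x. complex_of_real (w i) * (iexp (z * pos i) - 1)) =
      (\<Sum>\<^sub>\<infinity>i\<in>fibre x. complex_of_real (w i) * (iexp (z * x) - 1))"
      by (intro infsum_cong) (auto simp: fibre_def)
    also have "\<dots> = (\<Sum>\<^sub>\<infinity>i\<in>fibre x. complex_of_real (w i)) * (iexp (z * x) - 1)"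
      by (rule infsum_cmult_left')
    also have "(\<Sum>\<^sub>\<infinity>i\<in>fibre x. complex_of_real (w i)) = complex_of_real (atom x)"
      unfolding atom_def
      by (rule infsumI, rule has_sum_of_real, rule has_sum_infsum, rule abs_summable_summable[OF fibre_summable])
    finally show "(\<Sum>\<^sub>\<infinity>i\<in>fibre x. complex_of_real (w i) * (iexp (z * pos i) - 1)) =
      complex_of_real (atom x) * (iexp (z * x) - 1)" .
  qed
  finally show ?thesis by (rule sym)
qed

end

section \<open>The atoms of the exponent\<close>

context ou_exponent
begin

text \<open>The index (n, m) belongs to the position c^\<kappa> m / c^n. A member of the q-family at
  m / c^i has this form with n = i + \<kappa>, hence the restriction n \<ge> \<kappa>.\<close>

definition weight :: "nat \<Rightarrow> nat \<Rightarrow> real" where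
  "weight n m = - ((- \<rho>) ^ m) / real m + (if n \<ge> \<kappa> then q ^ m / real m else 0)"

lemma weight_bound: "\<bar>weight n m\<bar> * real m \<le> \<rho> ^ m + q ^ m"
proof (cases "m = 0")
  case False
  have "\<bar>weight n m\<bar> * real m = \<bar>- ((- \<rho>) ^ m) + (if n \<ge> \<kappa> then q ^ m else 0)\<bar>"
  proof -
    have "\<bar>weight n m\<bar> * real m = \<bar>weight n m * real m\<bar>" by (simp add: abs_mult)
    also have "weight n m * real m = - ((- \<rho>) ^ m) + (if n \<ge> \<kappa> then q ^ m else 0)"
      using False by (simp add: weight_def field_simps)
    finally show ?thesis .
  qed
  also have "\<dots> \<le> \<bar>(- \<rho>) ^ m\<bar> + \<bar>if n \<ge> \<kappa> then q ^ m else 0\<bar>" by linarith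
  also have "\<dots> \<le> \<rho> ^ m + q ^ m" using \<rho> q by (simp add: power_abs)
  finally show ?thesis .
qed (use q in simp)

sublocale W: weighted_positions "\<lambda>(n, m). weight n (Suc m)" "\<lambda>(n, m). c ^ \<kappa> * real (Suc m) / c ^ n"
proof
  show "(case i of (n, m) \<Rightarrow> c ^ \<kappa> * real (Suc m) / c ^ n) \<noteq> 0" for i
    using c by (cases i) (auto simp del: of_nat_Suc)
  \<comment> \<open>Majorant of weight times position: a geometric sequence in n times a sum of two
    geometric sequences in m.\<close>
  define h where "h = (\<lambda>(n, m). (1 / c) ^ n * (c ^ \<kappa> * (\<rho> ^ Suc m + q ^ Suc m)))"
  have s1: "(\<lambda>m. c ^ \<kappa> * (\<rho> ^ Suc m + q ^ Suc m)) summable_on UNIV"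
  proof (rule norm_summable_imp_summable_on)
    have "summable (\<lambda>m. c ^ \<kappa> * (\<rho> * \<rho> ^ m + q * q ^ m))"
      using \<rho> q by (intro summable_mult summable_add summable_geometric) auto
    thus "summable (\<lambda>m. norm (c ^ \<kappa> * (\<rho> ^ Suc m + q ^ Suc m)))" using \<rho> q c by (simp add: abs_mult)
  qed
  have s2: "(\<lambda>n. (1 / c) ^ n) summable_on UNIV"
    by (rule norm_summable_imp_summable_on) (use c in \<open>auto simp: summable_geometric\<close>)
  have "(\<lambda>z. norm (h z)) summable_on (UNIV \<times> UNIV)"
  proof (subst Infinite_Sum.abs_summable_on_Sigma_iff, intro conjI ballI)
    fix n
    show "(\<lambda>m. norm (h (n, m))) summable_on UNIV"
      using summable_on_cmult_right[OF s1, of "(1 / c) ^ n"] c \<rho> q by (simp add: h_def abs_mult power_abs)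
  next
    have "(\<Sum>\<^sub>\<infinity>m. norm (h (n, m))) = (1 / c) ^ n * (\<Sum>\<^sub>\<infinity>m. c ^ \<kappa> * (\<rho> ^ Suc m + q ^ Suc m))" for n
    proof -
      have "(\<Sum>\<^sub>\<infinity>m. norm (h (n, m))) = (\<Sum>\<^sub>\<infinity>m. (1 / c) ^ n * (c ^ \<kappa> * (\<rho> ^ Suc m + q ^ Suc m)))"
        using c \<rho> q by (intro infsum_cong) (simp add: h_def abs_mult power_abs)
      thus ?thesis by (simp only: infsum_cmult_right')
    qed
    thus "(\<lambda>n. norm (\<Sum>\<^sub>\<infinity>m. norm (h (n, m)))) summable_on UNIV"
      using summable_on_cmult_left[OF s2] c \<rho> q by (simp add: abs_mult power_abs)
  qed
  hence hs: "(\<lambda>z. norm (h z)) summable_on UNIV" by simp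
  have bd: "norm (\<bar>case i of (n, m) \<Rightarrow> weight n (Suc m)\<bar> * \<bar>case i of (n, m) \<Rightarrow> c ^ \<kappa> * real (Suc m) / c ^ n\<bar>) \<le> norm (h i)" for i
  proof -
    obtain n m where i: "i = (n, m)" by (cases i)
    have "\<bar>weight n (Suc m)\<bar> * \<bar>c ^ \<kappa> * real (Suc m) / c ^ n\<bar> = (c ^ \<kappa> / c ^ n) * (\<bar>weight n (Suc m)\<bar> * real (Suc m))"
      using c by (simp add: abs_mult del: of_nat_Suc)
    also have "\<dots> \<le> (c ^ \<kappa> / c ^ n) * (\<rho> ^ Suc m + q ^ Suc m)"
      using c by (intro mult_left_mono weight_bound) auto
    also have "\<dots> = h i" using i c by (simp add: h_def power_one_over)
    also have "\<dots> \<le> norm (h i)" by simp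
    finally show ?thesis by (simp add: i del: of_nat_Suc power_Suc)
  qed
  have "(\<lambda>i. norm (\<bar>case i of (n, m) \<Rightarrow> weight n (Suc m)\<bar> * \<bar>case i of (n, m) \<Rightarrow> c ^ \<kappa> * real (Suc m) / c ^ n\<bar>)) summable_on UNIV"
    by (rule Infinite_Sum.abs_summable_on_comparison_test[OF hs bd])
  thus "(\<lambda>i. \<bar>case i of (n, m) \<Rightarrow> weight n (Suc m)\<bar> * \<bar>case i of (n, m) \<Rightarrow> c ^ \<kappa> * real (Suc m) / c ^ n\<bar>) summable_on UNIV"
    by (simp only: real_norm_def abs_mult abs_abs)
qed

lemma summable_log_ratio_scaled:
  assumes "\<bar>x\<bar> < 1" "Re \<zeta> \<le> 0"
  shows "summable (\<lambda>n. log_ratio x (\<zeta> / of_real c ^ n))"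
proof (rule summable_comparison_test'[where g = "\<lambda>n. norm \<zeta> * (\<bar>x\<bar> / (1 - \<bar>x\<bar>)) * (1 / c) ^ n"])
  show "summable (\<lambda>n. norm \<zeta> * (\<bar>x\<bar> / (1 - \<bar>x\<bar>)) * (1 / c) ^ n)"
    using c by (intro summable_mult summable_geometric) auto
  show "norm (log_ratio x (\<zeta> / of_real c ^ n)) \<le> norm \<zeta> * (\<bar>x\<bar> / (1 - \<bar>x\<bar>)) * (1 / c) ^ n" for n
    using log_ratio_series(4)[OF assms(1) Re_scale'(2)[OF assms(2)], of n] c
    by (simp add: norm_divide norm_power power_one_over mult_ac)
qed

abbreviation atoms :: "real set" where
  "atoms \<equiv> range (\<lambda>(n, m). c ^ \<kappa> * real (Suc m) / c ^ n)"

text \<open>Summing over m first turns each row into logarithmic series at the scale \<zeta>' / c^n,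
  with \<zeta>' = c^\<kappa> \<zeta>; the rows then add up to \<open>psi\<close>. Absolute
  summability over all pairs permits replacing the iterated sum by the unordered one.\<close>

lemma psi_eq_atomic_exponent: "psi (\<i> * of_real z) = atomic_exponent W.atom atoms z"
proof -
  define \<zeta> where "\<zeta> = \<i> * complex_of_real z"
  have \<zeta>: "Re \<zeta> \<le> 0" by (simp add: \<zeta>_def)
  define \<zeta>' where "\<zeta>' = of_real c ^ \<kappa> * \<zeta>"
  have \<zeta>': "Re \<zeta>' \<le> 0" unfolding \<zeta>'_def by (rule Re_scale'[OF \<zeta>])
  define F where "F = (\<lambda>(n, m). complex_of_real (weight n (Suc m)) * (iexp (z * (c ^ \<kappa> * real (Suc m) / c ^ n)) - 1))"
  define T where "T n = log_ratio \<rho> (\<zeta>' / of_real c ^ n) - (if n \<ge> \<kappa> then log_ratio (- q) (\<zeta>' / of_real c ^ n) else 0)" for n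
  have inner: "(\<lambda>m. F (n, m)) sums T n" for n
  proof -
    let ?y = "\<zeta>' / of_real c ^ n"
    have y: "Re ?y \<le> 0" by (rule Re_scale'(2)[OF \<zeta>'])
    have e: "exp (of_nat (Suc m) * ?y) = iexp (z * (c ^ \<kappa> * real (Suc m) / c ^ n))" for m
      by (simp add: \<zeta>'_def \<zeta>_def mult_ac)
    have 1: "(\<lambda>m. complex_of_real (- ((- \<rho>) ^ Suc m) / real (Suc m)) * (exp (of_nat (Suc m) * ?y) - 1)) sums log_ratio \<rho> ?y"
      by (rule log_ratio_series(1)[OF _ y]) (use \<rho> in auto)
    have 2: "(\<lambda>m. complex_of_real (- ((- (- q)) ^ Suc m) / real (Suc m)) * (exp (of_nat (Suc m) * ?y) - 1)) sums log_ratio (- q) ?y"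
      by (rule log_ratio_series(1)[OF _ y]) (use q in auto)
    show ?thesis
    proof (cases "n \<ge> \<kappa>")
      case True
      have "(\<lambda>m. complex_of_real (- ((- \<rho>) ^ Suc m) / real (Suc m)) * (exp (of_nat (Suc m) * ?y) - 1) -
        complex_of_real (- ((- (- q)) ^ Suc m) / real (Suc m)) * (exp (of_nat (Suc m) * ?y) - 1)) sums T n"
        using sums_diff[OF 1 2] True by (simp only: T_def if_True)
      also have "(\<lambda>m. complex_of_real (- ((- \<rho>) ^ Suc m) / real (Suc m)) * (exp (of_nat (Suc m) * ?y) - 1) -
        complex_of_real (- ((- (- q)) ^ Suc m) / real (Suc m)) * (exp (of_nat (Suc m) * ?y) - 1)) = (\<lambda>m. F (n, m))"
        unfolding F_def case_prod_conv e weight_def left_diff_distrib[symmetric] of_real_diff[symmetric]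
        using True by simp
      finally show ?thesis .
    next
      case False
      hence "T n = log_ratio \<rho> ?y" by (simp add: T_def)
      moreover have "F (n, m) = complex_of_real (- ((- \<rho>) ^ Suc m) / real (Suc m)) * (exp (of_nat (Suc m) * ?y) - 1)" for m
        unfolding F_def case_prod_conv e weight_def using False by simp
      ultimately show ?thesis using 1 by simp
    qed
  qed
  have Fs: "(\<lambda>i. norm (F i)) summable_on (UNIV \<times> UNIV)"
  proof -
    define w where "w = (\<lambda>(n, m). weight n (Suc m))"
    define ps where "ps = (\<lambda>(n, m). c ^ \<kappa> * real (Suc m) / c ^ n)"
    have "(\<lambda>i. norm (F i)) summable_on UNIV"
    proof (rule Infinite_Sum.abs_summable_on_comparison_test[where g = "\<lambda>i. \<bar>z\<bar> * (\<bar>w i\<bar> * \<bar>ps i\<bar>)"])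
      show "(\<lambda>i. norm (\<bar>z\<bar> * (\<bar>w i\<bar> * \<bar>ps i\<bar>))) summable_on UNIV"
        using summable_on_cmult_right[OF W.summable_moment, of "\<bar>z\<bar>"] by (simp add: abs_mult w_def ps_def)
      fix i
      have "norm (F i) = \<bar>w i\<bar> * norm (iexp (z * ps i) - iexp 0)"
        unfolding F_def w_def ps_def case_prod_unfold norm_mult norm_of_real by simp
      also have "\<dots> \<le> \<bar>w i\<bar> * \<bar>z * ps i - 0\<bar>" by (intro mult_left_mono norm_iexp_diff_le) auto
      finally show "norm (F i) \<le> norm (\<bar>z\<bar> * (\<bar>w i\<bar> * \<bar>ps i\<bar>))"
        by (simp add: abs_mult mult_ac)
    qed
    thus ?thesis by simp
  qed
  have innersum: "(\<Sum>\<^sub>\<infinity>m. F (n, m)) = T n" for n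
  proof (rule sums_unique2[OF _ inner], rule has_sum_imp_sums, rule has_sum_infsum, rule abs_summable_summable)
    show "(\<lambda>m. norm (F (n, m))) summable_on UNIV"
      using Fs unfolding Infinite_Sum.abs_summable_on_Sigma_iff by blast
  qed
  have Ts: "T sums (\<Sum>\<^sub>\<infinity>i. F i)"
  proof -
    have 1: "(\<Sum>\<^sub>\<infinity>n. \<Sum>\<^sub>\<infinity>m. F (n, m)) = (\<Sum>\<^sub>\<infinity>i. F i)"
      using infsum_Sigma_banach[OF abs_summable_summable[OF Fs]] by simp
    have 2: "(\<lambda>n. \<Sum>\<^sub>\<infinity>m. F (n, m)) summable_on UNIV"
      using summable_on_Sigma_banach[of "\<lambda>n m. F (n, m)" UNIV "\<lambda>_. UNIV"] abs_summable_summable[OF Fs] by simp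
    from has_sum_imp_sums[OF has_sum_infsum[OF 2]] show ?thesis unfolding innersum 1[unfolded innersum] .
  qed
  have "T sums psi \<zeta>"
  proof -
    define L where "L n = (if n \<ge> \<kappa> then log_ratio (- q) (\<zeta>' / of_real c ^ n) else 0)" for n
    obtain a where a: "(\<lambda>n. log_ratio \<rho> (\<zeta>' / of_real c ^ n)) sums a"
      using summable_log_ratio_scaled[OF _ \<zeta>', of \<rho>] \<rho> by (auto simp: summable_def)
    obtain b where b: "(\<lambda>n. log_ratio (- q) (\<zeta> / of_real c ^ n)) sums b"
      using summable_log_ratio_scaled[OF _ \<zeta>, of "- q"] q by (auto simp: summable_def)
    have "(\<lambda>n. g (\<zeta> / of_real c ^ n)) sums (a - b)"
      using sums_diff[OF a b] by (simp add: g_def \<zeta>'_def)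
    hence "psi \<zeta> = a - b" using psi_sums(1)[OF \<zeta>] sums_unique2 by blast
    \<comment> \<open>Since \<zeta>' / c^(n + \<kappa>) = \<zeta> / c^n, dropping the rows n <
      \<kappa>, where L vanishes, undoes the shift of the q-part.\<close>
    moreover have "(\<lambda>n. L (n + \<kappa>)) sums b"
      using b c by (simp add: L_def \<zeta>'_def power_add)
    hence "L sums b" unfolding sums_iff_shift by (simp add: L_def)
    ultimately show ?thesis using sums_diff[OF a] unfolding T_def L_def by auto
  qed
  hence "psi \<zeta> = (\<Sum>\<^sub>\<infinity>i. F i)" using Ts sums_unique2 by blast
  also have "\<dots> = atomic_exponent W.atom atoms z"
    unfolding W.atomic_exponent_eq_infsum F_def by (simp only: case_prod_unfold)
  finally show ?thesis by (simp add: \<zeta>_def)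
qed

text \<open>\<open>mass y\<close> is the mass of the atom at \<open>c ^ \<kappa> * y\<close>; the \<open>q\<close>-part of \<open>weight\<close> is shifted by \<open>\<kappa>\<close>
  indices to bring both families of weights to common positions.\<close>

definition scales :: "real \<Rightarrow> nat set" where "scales y = {n. y * c ^ n \<in> \<nat>}"

definition mass :: "real \<Rightarrow> real" where
  "mass y = (\<Sum>\<^sub>\<infinity>n\<in>scales y. weight n (nat \<lfloor>y * c ^ n\<rfloor>))"

text \<open>An index in the fibre is determined by its scale n, since m + 1 must then be the
  positive integer y c^n; the - 1 is there because weights are indexed by
  \<open>Suc m\<close>.\<close>

lemma fibre_reindex:
  assumes y: "y > 0"
  shows "bij_betw (\<lambda>n. (n, nat \<lfloor>y * c ^ n\<rfloor> - 1)) (scales y) (W.fibre (c ^ \<kappa> * y))"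
    and "n \<in> scales y \<Longrightarrow> Suc (nat \<lfloor>y * c ^ n\<rfloor> - 1) = nat \<lfloor>y * c ^ n\<rfloor>"
proof -
  have pos: "y * c ^ n > 0" for n using y c by simp
  have S: "Suc (nat \<lfloor>y * c ^ n\<rfloor> - 1) = nat \<lfloor>y * c ^ n\<rfloor>" "real (nat \<lfloor>y * c ^ n\<rfloor>) = y * c ^ n" if "n \<in> scales y" for n
  proof -
    have "y * c ^ n \<in> \<nat>" using that by (simp add: scales_def)
    then obtain M where M: "y * c ^ n = real M" by (rule Nats_cases)
    hence "M > 0" using pos[of n] by (metis of_nat_0_less_iff)
    thus "Suc (nat \<lfloor>y * c ^ n\<rfloor> - 1) = nat \<lfloor>y * c ^ n\<rfloor>" "real (nat \<lfloor>y * c ^ n\<rfloor>) = y * c ^ n" unfolding M by auto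
  qed
  thus "n \<in> scales y \<Longrightarrow> Suc (nat \<lfloor>y * c ^ n\<rfloor> - 1) = nat \<lfloor>y * c ^ n\<rfloor>" by blast
  have fib: "(n, m) \<in> W.fibre (c ^ \<kappa> * y) \<longleftrightarrow> y * c ^ n = real (Suc m)" for n m
    using c unfolding W.fibre_def by (auto simp: field_simps simp del: of_nat_Suc)
  show "bij_betw (\<lambda>n. (n, nat \<lfloor>y * c ^ n\<rfloor> - 1)) (scales y) (W.fibre (c ^ \<kappa> * y))"
  proof (rule bij_betw_byWitness[where f' = fst])
    show "(\<lambda>n. (n, nat \<lfloor>y * c ^ n\<rfloor> - 1)) ` scales y \<subseteq> W.fibre (c ^ \<kappa> * y)"
    proof (rule image_subsetI)
      fix n assume n: "n \<in> scales y"
      show "(n, nat \<lfloor>y * c ^ n\<rfloor> - 1) \<in> W.fibre (c ^ \<kappa> * y)" unfolding fib S(1)[OF n] by (simp only: S(2)[OF n])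
    qed
    have *: "n \<in> scales y \<and> nat \<lfloor>y * c ^ n\<rfloor> - 1 = m" if "(n, m) \<in> W.fibre (c ^ \<kappa> * y)" for n m
      using that[unfolded fib] by (auto simp: scales_def simp del: of_nat_Suc)
    show "\<forall>a'\<in>W.fibre (c ^ \<kappa> * y). (fst a', nat \<lfloor>y * c ^ fst a'\<rfloor> - 1) = a'" "fst ` W.fibre (c ^ \<kappa> * y) \<subseteq> scales y"
      using * by (force simp: prod_eq_iff)+
  qed simp
qed

lemma mass_eq_atom:
  assumes y: "y > 0"
  shows "W.atom (c ^ \<kappa> * y) = mass y" "(\<lambda>n. weight n (nat \<lfloor>y * c ^ n\<rfloor>)) summable_on scales y"
proof -
  note bij = fibre_reindex(1)[OF y] and S = fibre_reindex(2)[OF y]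
  have "W.atom (c ^ \<kappa> * y) = (\<Sum>\<^sub>\<infinity>n\<in>scales y. weight n (Suc (nat \<lfloor>y * c ^ n\<rfloor> - 1)))"
    unfolding W.atom_def infsum_reindex_bij_betw[OF bij, symmetric] by simp
  also have "\<dots> = mass y" unfolding mass_def by (intro infsum_cong) (simp only: S)
  finally show "W.atom (c ^ \<kappa> * y) = mass y" .
  have "(\<lambda>n. weight n (Suc (nat \<lfloor>y * c ^ n\<rfloor> - 1))) summable_on scales y"
    using summable_on_reindex_bij_betw[OF bij, of "\<lambda>(n, m). weight n (Suc m)"] abs_summable_summable[OF W.fibre_summable, of "c ^ \<kappa> * y"]
    by (simp add: case_prod_unfold)
  thus "(\<lambda>n. weight n (nat \<lfloor>y * c ^ n\<rfloor>)) summable_on scales y"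
    by (rule summable_on_cong[THEN iffD1, rotated]) (simp only: S)
qed

lemma weight_mono: "weight n m \<le> weight (k + n) m"
  using q by (auto simp: weight_def)

lemma infinitely_divisible_iff_mass:
  assumes \<sigma>: "real_distribution \<sigma>" "\<And>z. char \<sigma> z = phi (\<i> * of_real z)"
  shows "infinitely_divisible \<sigma> \<longleftrightarrow> (\<forall>m::nat\<ge>1. mass (real m) \<ge> 0)"
proof -
  have "infinitely_divisible \<sigma> \<longleftrightarrow> (\<forall>x\<in>atoms. W.atom x \<ge> 0)"
    by (rule W.infinitely_divisible_iff[OF \<sigma>(1)]) (simp add: \<sigma>(2) phi_def psi_eq_atomic_exponent)
  also have "\<dots> \<longleftrightarrow> (\<forall>m::nat\<ge>1. mass (real m) \<ge> 0)"
  proof safe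
    fix m :: nat assume *: "\<forall>x\<in>atoms. W.atom x \<ge> 0" "m \<ge> 1"
    have "c ^ \<kappa> * real m = (\<lambda>(n, m). c ^ \<kappa> * real (Suc m) / c ^ n) (0, m - 1)" using *(2) by simp
    hence "c ^ \<kappa> * real m \<in> atoms" by (rule range_eqI)
    hence "W.atom (c ^ \<kappa> * real m) \<ge> 0" using *(1) by blast
    thus "mass (real m) \<ge> 0" using mass_eq_atom(1)[of "real m"] *(2) by simp
  next
    fix n m assume *: "\<forall>m::nat\<ge>1. mass (real m) \<ge> 0"
    define y where "y = real (Suc m) / c ^ n"
    have y: "y > 0" using c by (simp add: y_def del: of_nat_Suc)
    have "n \<in> scales y" using c by (simp add: scales_def y_def del: of_nat_Suc)
    \<comment> \<open>Taking the least scale makes n - k a scale of M for every scale n of y, so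
      \<open>scales y\<close> is \<open>scales (real M)\<close> shifted by k. At a shifted index the
      q-part can only be switched on.\<close>
    define k where "k = (LEAST n. n \<in> scales y)"
    have k: "k \<in> scales y" "\<And>n. n \<in> scales y \<Longrightarrow> k \<le> n"
      unfolding k_def using \<open>n \<in> scales y\<close> by (auto intro: LeastI Least_le)
    hence "y * c ^ k \<in> \<nat>" by (simp add: scales_def)
    then obtain M where M: "y * c ^ k = real M" by (rule Nats_cases)
    have "y * c ^ k > 0" using y c by simp
    hence M1: "M \<ge> 1" using M by (cases M) auto
    have sh: "y * c ^ (k + i) = real M * c ^ i" for i by (simp add: M[symmetric] power_add)
    have bij: "bij_betw (\<lambda>i. k + i) (scales (real M)) (scales y)"
    proof (rule bij_betw_byWitness[where f' = "\<lambda>n. n - k"])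
      show "(\<lambda>i. k + i) ` scales (real M) \<subseteq> scales y" by (auto simp: scales_def sh)
      show "(\<lambda>n. n - k) ` scales y \<subseteq> scales (real M)"
      proof (rule image_subsetI)
        fix n assume n: "n \<in> scales y"
        hence "y * c ^ (k + (n - k)) \<in> \<nat>" using k(2)[OF n] by (simp add: scales_def)
        thus "n - k \<in> scales (real M)" unfolding sh by (simp add: scales_def)
      qed
    qed (use k(2) in auto)
    have "0 \<le> mass (real M)" using * M1 by blast
    also have "mass (real M) \<le> (\<Sum>\<^sub>\<infinity>i\<in>scales (real M). weight (k + i) (nat \<lfloor>y * c ^ (k + i)\<rfloor>))"
      unfolding mass_def
    proof (rule infsum_mono)
      show "(\<lambda>i. weight i (nat \<lfloor>real M * c ^ i\<rfloor>)) summable_on scales (real M)"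
        using mass_eq_atom(2)[of "real M"] M1 by simp
      show "(\<lambda>i. weight (k + i) (nat \<lfloor>y * c ^ (k + i)\<rfloor>)) summable_on scales (real M)"
        using summable_on_reindex_bij_betw[OF bij, of "\<lambda>n. weight n (nat \<lfloor>y * c ^ n\<rfloor>)"] mass_eq_atom(2)[OF y] by simp
      show "weight i (nat \<lfloor>real M * c ^ i\<rfloor>) \<le> weight (k + i) (nat \<lfloor>y * c ^ (k + i)\<rfloor>)" for i
        unfolding sh by (rule weight_mono)
    qed
    also have "\<dots> = mass y"
      unfolding mass_def using infsum_reindex_bij_betw[OF bij, of "\<lambda>n. weight n (nat \<lfloor>y * c ^ n\<rfloor>)"] by simp
    also have "\<dots> = W.atom (c ^ \<kappa> * y)" by (rule mass_eq_atom(1)[OF y, symmetric])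
    finally show "W.atom (c ^ \<kappa> * real (Suc m) / c ^ n) \<ge> 0" by (simp only: y_def times_divide_eq_right)
  qed
  finally show ?thesis .
qed

lemma quasi_infinitely_divisible_phi:
  assumes \<sigma>: "real_distribution \<sigma>" "\<And>z. char \<sigma> z = phi (\<i> * of_real z)"
  shows "quasi_infinitely_divisible \<sigma>"
  by (rule W.quasi_infinitely_divisibleI[OF \<sigma>(1)]) (simp add: \<sigma>(2) phi_def psi_eq_atomic_exponent)

end

section \<open>The law of the driving process\<close>

text \<open>A coincidence of two values fixes \<theta> as a quotient of differences, which leaves
  only countably many bad \<theta>.\<close>

lemma exists_injective_combination:
  fixes A B :: "real set"
  assumes "countable A" "countable B"
  shows "\<exists>\<theta>. inj_on (\<lambda>x. fst x + \<theta> * snd x) (A \<times> B)"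
proof -
  define Bad where "Bad = (\<lambda>(a, a', b, b'). (a - a') / (b' - b)) ` (A \<times> A \<times> B \<times> B)"
  have "countable Bad" unfolding Bad_def using assms by auto
  hence "\<exists>\<theta>. \<theta> \<notin> Bad" using uncountable_UNIV_real by (metis UNIV_eq_I)
  then obtain \<theta> where \<theta>: "\<theta> \<notin> Bad" by blast
  have "inj_on (\<lambda>x. fst x + \<theta> * snd x) (A \<times> B)"
  proof (rule inj_onI)
    fix x y assume x: "x \<in> A \<times> B" and y: "y \<in> A \<times> B" and eq: "fst x + \<theta> * snd x = fst y + \<theta> * snd y"
    have "snd x = snd y"
    proof (rule ccontr)
      assume ne: "snd x \<noteq> snd y"
      have "(fst x - fst y) = \<theta> * (snd y - snd x)" using eq by (simp add: algebra_simps)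
      hence "\<theta> = (fst x - fst y) / (snd y - snd x)" using ne by simp
      hence "\<theta> \<in> Bad" unfolding Bad_def using x y
        by (intro image_eqI[of _ _ "(fst x, fst y, snd x, snd y)"]) auto
      thus False using \<theta> by simp
    qed
    thus "x = y" using eq by (simp add: prod_eq_iff)
  qed
  thus ?thesis by blast
qed

lemma measure_pmf_borel_prob:
  "prob_space (distr (measure_pmf \<pi>) borel (\<lambda>x. x :: 'a :: topological_space))"
  by (rule measure_pmf.prob_space_distr) simp

text \<open>A generic linear functional is injective on the countable product of the marginal supports,
  which reduces the statement to Levy's uniqueness theorem on the line.\<close>

lemma char_uniqueness_real_prod_pmf:
  fixes \<mu> :: "(real \<times> real) measure" and \<pi> :: "(real \<times> real) pmf"
  assumes "prob_space \<mu>" and sets: "sets \<mu> = sets borel"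
    and char: "\<And>z. (LINT x|\<mu>. iexp (z \<bullet> x)) = (LINT x|measure_pmf \<pi>. iexp (z \<bullet> x))"
  shows "\<mu> = distr (measure_pmf \<pi>) borel (\<lambda>x. x)"
proof -
  interpret \<mu>: prob_space \<mu> by fact
  define \<nu> where "\<nu> = distr (measure_pmf \<pi>) borel (\<lambda>x. x)"
  interpret \<nu>: prob_space \<nu> unfolding \<nu>_def by (rule measure_pmf_borel_prob)
  have sets\<nu>: "sets \<nu> = sets borel" by (simp add: \<nu>_def)
  note [measurable_cong] = sets sets\<nu>
  have lin: "distr \<mu> borel (\<lambda>x. z \<bullet> x) = distr \<nu> borel (\<lambda>x. z \<bullet> x)" for z
  proof (rule Levy_uniqueness)
    show "real_distribution (distr \<mu> borel (\<lambda>x. z \<bullet> x))" by (rule \<mu>.real_distribution_distr) measurable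
    show "real_distribution (distr \<nu> borel (\<lambda>x. z \<bullet> x))" by (rule \<nu>.real_distribution_distr) measurable
    have "char (distr \<mu> borel (\<lambda>x. z \<bullet> x)) t = char (distr \<nu> borel (\<lambda>x. z \<bullet> x)) t" for t
    proof -
      have "char (distr \<mu> borel (\<lambda>x. z \<bullet> x)) t = (LINT x|\<mu>. iexp ((t *\<^sub>R z) \<bullet> x))"
        unfolding char_def by (subst integral_distr) auto
      moreover have "char (distr \<nu> borel (\<lambda>x. z \<bullet> x)) t = (LINT x|\<nu>. iexp ((t *\<^sub>R z) \<bullet> x))"
        unfolding char_def by (subst integral_distr) auto
      moreover have "(LINT x|\<nu>. iexp ((t *\<^sub>R z) \<bullet> x)) = (LINT x|measure_pmf \<pi>. iexp ((t *\<^sub>R z) \<bullet> x))"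
        unfolding \<nu>_def by (subst integral_distr) auto
      ultimately show ?thesis by (simp only: char)
    qed
    thus "char (distr \<mu> borel (\<lambda>x. z \<bullet> x)) = char (distr \<nu> borel (\<lambda>x. z \<bullet> x))" by blast
  qed
  \<comment> \<open>Nothing is known about the support of \<mu> yet. It is transferred from \<pi>
    through the one-dimensional images, in particular through both coordinates, so that \<mu> is
    carried by a countable grid as well.\<close>
  have AE_lin: "AE x in \<mu>. z \<bullet> x \<in> (\<lambda>x. z \<bullet> x) ` set_pmf \<pi>" for z
  proof -
    have [measurable]: "(\<lambda>x. z \<bullet> x) ` set_pmf \<pi> \<in> sets borel"
      by (rule sets.countable) (auto intro!: countable_image countable_set_pmf)
    have "AE x in \<nu>. z \<bullet> x \<in> (\<lambda>x. z \<bullet> x) ` set_pmf \<pi>"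
      unfolding \<nu>_def by (subst AE_distr_iff) (auto simp: AE_measure_pmf_iff)
    hence "AE y in distr \<nu> borel (\<lambda>x. z \<bullet> x). y \<in> (\<lambda>x. z \<bullet> x) ` set_pmf \<pi>"
      by (subst AE_distr_iff) auto
    hence "AE y in distr \<mu> borel (\<lambda>x. z \<bullet> x). y \<in> (\<lambda>x. z \<bullet> x) ` set_pmf \<pi>" by (simp only: lin)
    thus ?thesis by (subst (asm) AE_distr_iff) auto
  qed
  define A where "A = fst ` set_pmf \<pi>"
  define B where "B = snd ` set_pmf \<pi>"
  have cnt: "countable A" "countable B" by (auto simp: A_def B_def)
  have AE\<mu>: "AE x in \<mu>. x \<in> A \<times> B"
    using AE_lin[of "(1, 0)"] AE_lin[of "(0, 1)"]
    by eventually_elim (auto simp: A_def B_def inner_prod_def mem_Times_iff)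
  have AE\<nu>: "AE x in \<nu>. x \<in> A \<times> B"
    unfolding \<nu>_def using cnt
  proof (subst AE_distr_iff)
    have "A \<times> B \<in> sets borel" by (rule sets.countable) (auto intro: cnt)
    thus "{x \<in> space borel. x \<in> A \<times> B} \<in> sets borel" by simp
  qed (auto simp: AE_measure_pmf_iff A_def B_def intro: rev_image_eqI)
  from exists_injective_combination[OF cnt]
  obtain \<theta> where \<theta>: "inj_on (\<lambda>x. fst x + \<theta> * snd x) (A \<times> B)" ..
  define g where "g x = (1, \<theta>) \<bullet> x" for x :: "real \<times> real"
  have g: "inj_on g (A \<times> B)" using \<theta> unfolding g_def[abs_def] inner_prod_def inner_real_def by simp
  have "emeasure \<mu> E = emeasure \<nu> E" if E: "E \<in> sets \<mu>" for E
  proof -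
    define G where "G = g ` (E \<inter> A \<times> B)"
    have G[measurable]: "G \<in> sets borel" 
    proof (rule sets.countable)
      show "countable G" unfolding G_def by (intro countable_image countable_Int2 countable_SIGMA cnt)
    qed simp
    have [measurable]: "g \<in> borel_measurable borel" unfolding g_def by measurable
    have iff: "x \<in> E \<longleftrightarrow> g x \<in> G" if "x \<in> A \<times> B" for x
      using that g unfolding G_def by (auto dest: inj_onD)
    have [measurable]: "E \<in> sets borel" using E sets by simp
    have *: "emeasure K E = emeasure (distr K borel g) G" if "AE x in K. x \<in> A \<times> B" and K[measurable_cong]: "sets K = sets borel" for K
    proof -
      have "emeasure K E = emeasure K (g -` G \<inter> space K)"
        using that(1) by (intro emeasure_eq_AE) (auto elim!: eventually_mono simp: iff)
      thus ?thesis by (simp add: emeasure_distr)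
    qed
    show ?thesis using *[OF AE\<mu> sets] *[OF AE\<nu> sets\<nu>] lin[of "(1, \<theta>)"] by (simp add: g_def[abs_def])
  qed
  hence "\<mu> = \<nu>" using sets sets\<nu> by (intro measure_eqI) auto
  thus ?thesis by (simp add: \<nu>_def)
qed

definition jump_pmf :: "real \<Rightarrow> real \<Rightarrow> real \<Rightarrow> real \<Rightarrow> (real \<times> real) pmf" where
  "jump_pmf d u v w = embed_pmf (\<lambda>x. (if x = (1, 0) then u else if x = (0, 1) then v else if x = (1, d) then w else 0) / (u + v + w))"

lemma jump_pmf:
  assumes d: "d > 1" and uvw: "u \<ge> 0" "v \<ge> 0" "w \<ge> 0" "u + v + w > 0"
  shows "set_pmf (jump_pmf d u v w) \<subseteq> {(1, 0), (0, 1), (1, d)}"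
    "(LINT x|measure_pmf (jump_pmf d u v w). f x) =
      (of_real u * f (1, 0) + of_real v * f (0, 1) + of_real w * f (1, d)) / (of_real (u + v + w) :: complex)"
proof -
  define h where "h = (\<lambda>x :: real \<times> real. (if x = (1, 0) then u else if x = (0, 1) then v else if x = (1, d) then w else 0) / (u + v + w))"
  have h0: "h x \<ge> 0" for x using uvw by (auto simp: h_def)
  have "(\<integral>\<^sup>+x. ennreal (h x) \<partial>count_space UNIV) = (\<Sum>x\<in>{(1, 0), (0, 1), (1, d)}. ennreal (h x))"
    by (rule nn_integral_count_space') (auto simp: h_def)
  also have "\<dots> = ennreal (\<Sum>x\<in>{(1, 0), (0, 1), (1, d)}. h x)" using h0 by (intro sum_ennreal) auto
  also have "(\<Sum>x\<in>{(1, 0), (0, 1), (1, d)}. h x) = (u + v + w) / (u + v + w)"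
    using d by (simp add: h_def add.assoc flip: add_divide_distrib)
  also have "\<dots> = 1" using uvw by simp
  finally have h1: "(\<integral>\<^sup>+x. ennreal (h x) \<partial>count_space UNIV) = 1" by simp
  have pmf: "pmf (jump_pmf d u v w) x = h x" for x
    unfolding jump_pmf_def h_def[symmetric] by (rule pmf_embed_pmf[OF h0 h1])
  show sub: "set_pmf (jump_pmf d u v w) \<subseteq> {(1, 0), (0, 1), (1, d)}"
    by (auto simp: set_pmf_eq pmf h_def split: if_splits)
  have "(LINT x|measure_pmf (jump_pmf d u v w). f x) = (\<Sum>x\<in>{(1, 0), (0, 1), (1, d)}. pmf (jump_pmf d u v w) x *\<^sub>R f x)"
    by (rule integral_measure_pmf) (use sub in auto)
  also have "\<dots> = (of_real u * f (1, 0) + of_real v * f (0, 1) + of_real w * f (1, d)) / of_real (u + v + w)"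
    using d by (simp add: pmf h_def scaleR_conv_of_real add_divide_distrib)
  finally show "(LINT x|measure_pmf (jump_pmf d u v w). f x) =
      (of_real u * f (1, 0) + of_real v * f (0, 1) + of_real w * f (1, d)) / (of_real (u + v + w) :: complex)" .
qed

lemma integral_jump_measure:
  fixes f :: "real \<times> real \<Rightarrow> complex"
  assumes c: "c powi (- k) > 1" and uvw: "u \<ge> 0" "v \<ge> 0" "w \<ge> 0" and f: "f \<in> borel_measurable borel"
  shows "(LINT x|jump_measure c k u v w. f x) =
    of_real u * f (1, 0) + of_real v * f (0, 1) + of_real w * f (1, c powi (- k))"
proof -
  let ?d = "c powi (- k)"
  have "(LINT x|jump_measure c k u v w. f x) =
    (LINT x|point_measure {(1, 0), (0, 1), (1, ?d)} (\<lambda>x. ennreal (if x = (1, 0) then u else if x = (0, 1) then v else w)). f x)"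
    unfolding jump_measure_def using f
    by (subst integral_distr) (auto simp: if_distrib[of ennreal] cong: if_cong)
  also have "\<dots> = (\<Sum>x\<in>{(1, 0), (0, 1), (1, ?d)}. (if x = (1, 0) then u else if x = (0, 1) then v else w) *\<^sub>R f x)"
    by (rule lebesgue_integral_point_measure_finite) (use uvw in auto)
  also have "\<dots> = of_real u * f (1, 0) + of_real v * f (0, 1) + of_real w * f (1, ?d)"
  proof -
    have "(\<Sum>x\<in>{(1, 0), (0, 1), (1, d)}. (if x = (1, 0) then u else if x = (0, 1) then v else w) *\<^sub>R f x) =
      of_real u * f (1, 0) + of_real v * f (0, 1) + of_real w * f (1, d)" if "d > 1" for d
      using that by (simp add: scaleR_conv_of_real)
    from this[OF c] show ?thesis .
  qed
  finally show ?thesis .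
qed

section \<open>The process and the one-jump identity\<close>

text \<open>Here \<kappa> stands for -k, and 0 < w < u for 0 < r < p; the exponent is used with q =
  v / (u + v + w) and \<rho> = w / u = r / p.\<close>

locale ou_process =
  fixes M :: "'a measure" and N L :: "real \<Rightarrow> 'a \<Rightarrow> real" and c u v w :: real and \<kappa> :: nat
  assumes c1: "c > 1" and \<kappa>: "\<kappa> \<ge> 1" and uvw: "v \<ge> 0" "0 < w" "w < u"
    and cpp: "compound_poisson_process M (jump_measure c (- int \<kappa>) u v w) (\<lambda>t \<omega>. (N t \<omega>, L t \<omega>))"
begin

abbreviation lam :: real where "lam \<equiv> u + v + w"

lemma lam: "lam > 0" using uvw by simp

sublocale ou_exponent c "v / lam" "w / u" \<kappa>
  by unfold_locales (use c1 uvw in \<open>auto simp: divide_less_eq_1\<close>)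

abbreviation X :: "real \<Rightarrow> 'a \<Rightarrow> real \<times> real" where "X \<equiv> \<lambda>t \<omega>. (N t \<omega>, L t \<omega>)"

lemma levy: "levy_process M X" using cpp by (simp add: compound_poisson_process_def)

sublocale prob_space M using levy by (simp add: levy_process_def)

lemma X_measurable [measurable]: "t \<ge> 0 \<Longrightarrow> X t \<in> borel_measurable M"
  using levy by (simp add: levy_process_def)

lemma N_measurable [measurable]: "t \<ge> 0 \<Longrightarrow> N t \<in> borel_measurable M"
  using measurable_compose[OF X_measurable borel_measurable_continuous_onI[OF continuous_on_fst[OF continuous_on_id]]] by simp

lemma L_measurable [measurable]: "t \<ge> 0 \<Longrightarrow> L t \<in> borel_measurable M"
  using measurable_compose[OF X_measurable borel_measurable_continuous_onI[OF continuous_on_snd[OF continuous_on_id]]] by simp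

abbreviation Q :: "(real \<times> real) pmf" where "Q \<equiv> jump_pmf (c ^ \<kappa>) u v w"

definition quadrant :: "(real \<times> real) set" where "quadrant = {0..} \<times> {0..}"

lemma d1: "c ^ \<kappa> > 1" using c1 \<kappa> by (intro one_less_power) auto

lemma Q_integral: "(LINT x|measure_pmf Q. f x) =
      (of_real u * f (1, 0) + of_real v * f (0, 1) + of_real w * f (1, c ^ \<kappa>)) / (of_real lam :: complex)"
  using jump_pmf(2)[OF d1, of u v w f] uvw lam by simp

lemma quadrant: "0 \<in> quadrant" "\<And>a b. a \<in> quadrant \<Longrightarrow> b \<in> quadrant \<Longrightarrow> a + b \<in> quadrant" "set_pmf Q \<subseteq> quadrant"
  using jump_pmf(1)[OF d1, of u v w] uvw lam c1 by (auto simp: quadrant_def zero_prod_def)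

lemma X_law:
  assumes t: "t > 0"
  shows "distr M borel (X t) = distr (measure_pmf (compound_poisson_pmf (lam * t) Q)) borel (\<lambda>x. x)"
proof (rule char_uniqueness_real_prod_pmf)
  have [measurable]: "X t \<in> borel_measurable M" using t by simp
  show "prob_space (distr M borel (X t))" by (rule prob_space_distr) measurable
  fix z :: "real \<times> real"
  have "(LINT x|distr M borel (X t). iexp (z \<bullet> x)) = (LINT \<omega>|M. iexp (z \<bullet> X t \<omega>))"
    by (subst integral_distr) auto
  also have "\<dots> = exp (complex_of_real t * (LINT x|jump_measure c (- int \<kappa>) u v w. iexp (z \<bullet> x) - 1))"
    using cpp less_imp_le[OF t] unfolding compound_poisson_process_def by blast
  also have "(LINT x|jump_measure c (- int \<kappa>) u v w. iexp (z \<bullet> x) - 1) = of_real lam * ((LINT x|measure_pmf Q. iexp (z \<bullet> x)) - 1)"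
  proof -
    have "(LINT x|jump_measure c (- int \<kappa>) u v w. iexp (z \<bullet> x) - 1) =
      of_real u * (iexp (z \<bullet> (1, 0)) - 1) + of_real v * (iexp (z \<bullet> (0, 1)) - 1) + of_real w * (iexp (z \<bullet> (1, c powi (- (- int \<kappa>)))) - 1)"
      by (rule integral_jump_measure) (use d1 uvw in auto)
    moreover have "of_real lam * (LINT x|measure_pmf Q. iexp (z \<bullet> x)) =
      of_real u * iexp (z \<bullet> (1, 0)) + of_real v * iexp (z \<bullet> (0, 1)) + of_real w * iexp (z \<bullet> (1, c ^ \<kappa>))"
    proof -
      have "complex_of_real lam \<noteq> 0" using lam by (metis of_real_eq_0_iff less_irrefl)
      thus ?thesis unfolding Q_integral times_divide_eq_right by (rule nonzero_mult_div_cancel_left)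
    qed
    ultimately show ?thesis by (simp add: algebra_simps power_int_minus)
  qed
  also have "exp (complex_of_real t * (of_real lam * ((LINT x|measure_pmf Q. iexp (z \<bullet> x)) - 1))) =
    exp (of_real (lam * t) * ((LINT x|measure_pmf Q. iexp (z \<bullet> x)) - 1))" by (simp add: mult_ac)
  also have "\<dots> = (LINT x|measure_pmf (compound_poisson_pmf (lam * t) Q). iexp (z \<bullet> x))"
    by (rule integral_compound_poisson_pmf_mult[where S = UNIV, symmetric])
      (use mult_pos_pos[OF lam t] in \<open>auto simp: inner_add_right distrib_left exp_add\<close>)
  finally show "(LINT x|distr M borel (X t). iexp (z \<bullet> x)) = (LINT x|measure_pmf (compound_poisson_pmf (lam * t) Q). iexp (z \<bullet> x))" .
qed simp

lemma increment_law:
  assumes "0 \<le> s" "s < t"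
  shows "distr M borel (\<lambda>\<omega>. X t \<omega> - X s \<omega>) = distr (measure_pmf (compound_poisson_pmf (lam * (t - s)) Q)) borel (\<lambda>x. x)"
proof -
  have "distr M borel (\<lambda>\<omega>. X (s + (t - s)) \<omega> - X s \<omega>) = distr M borel (X (t - s))"
  proof -
    have "\<forall>s\<ge>0. \<forall>t\<ge>0. distr M borel (\<lambda>\<omega>. X (s + t) \<omega> - X s \<omega>) = distr M borel (X t)"
      using levy unfolding levy_process_def by (elim conjE)
    moreover have "t - s \<ge> 0" using assms by simp
    ultimately show ?thesis using assms(1) by blast
  qed
  thus ?thesis using X_law[of "t - s"] assms by simp
qed

lemma increment_AE_quadrant:
  assumes "0 \<le> s" "s < t"
  shows "AE \<omega> in M. X t \<omega> - X s \<omega> \<in> quadrant"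
proof -
  have m: "(\<lambda>\<omega>. X t \<omega> - X s \<omega>) \<in> borel_measurable M"
    using assms by (intro borel_measurable_diff X_measurable) auto
  have q: "quadrant \<in> sets borel" unfolding quadrant_def by (intro borel_closed closed_Times closed_atLeast)
  have "AE x in distr (measure_pmf (compound_poisson_pmf (lam * (t - s)) Q)) borel (\<lambda>x. x). x \<in> quadrant"
    using set_compound_poisson_pmf[OF quadrant, of "lam * (t - s)"] q
    by (subst AE_distr_iff) (auto simp: AE_measure_pmf_iff)
  hence "AE x in distr M borel (\<lambda>\<omega>. X t \<omega> - X s \<omega>). x \<in> quadrant" by (simp only: increment_law[OF assms])
  thus ?thesis using q m by (subst (asm) AE_distr_iff) auto
qed

text \<open>The functional equation, multiplied by the total rate, says that averaging over a single
  jump reproduces phi \<zeta>. A jump (1, c^\<kappa>) adds c^\<kappa> at the old scale and only then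
  divides the scale by c, as the left limit in the integrand demands. Hence only two or more jumps
  contribute to the error.\<close>

lemma integral_near_phi:
  assumes h: "h > 0" and \<zeta>: "Re \<zeta> \<le> 0"
  shows "norm ((LINT x|measure_pmf (compound_poisson_pmf (lam * h) Q). exp (\<zeta> * of_real (snd x)) * phi (\<zeta> * of_real (c powr (- fst x)))) - phi \<zeta>)
    \<le> 2 * (lam * h)\<^sup>2"
proof -
  define f where "f x = exp (\<zeta> * of_real (snd x)) * phi (\<zeta> * of_real (c powr (- fst x)))" for x :: "real \<times> real"
  have Re_le: "Re (\<zeta> * of_real x) \<le> 0" if "x \<ge> 0" for x using \<zeta> that by (simp add: mult_nonpos_nonneg)
  have f0: "f 0 = phi \<zeta>" using c1 by (simp add: f_def)
  have "norm (f x) \<le> 1" if "x \<in> quadrant" for x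
  proof -
    have "norm (f x) \<le> 1 * 1"
      unfolding f_def norm_mult
      using that Re_le[of "snd x"] norm_phi_le_1[OF Re_le[of "c powr (- fst x)"]]
      by (intro mult_mono) (auto simp: quadrant_def)
    thus ?thesis by simp
  qed
  moreover have "(LINT y|measure_pmf Q. f y) = f 0"
  proof -
    define P where "P = phi (\<zeta> / of_real c)"
    have cp: "c powr - 1 = 1 / c" using c1 by (simp add: powr_minus_divide)
    have f: "f (1, 0) = P" "f (0, 1) = exp \<zeta> * phi \<zeta>" "f (1, c ^ \<kappa>) = exp (\<zeta> * of_real c ^ \<kappa>) * P"
      using c1 by (simp_all add: f_def P_def cp)
    have lz: "complex_of_real lam \<noteq> 0" "complex_of_real u \<noteq> 0" using lam uvw by (simp_all only: of_real_eq_0_iff)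
    have fe: "phi \<zeta> * (1 - of_real (v / lam) * exp \<zeta>) * (1 + of_real (w / u)) =
      (1 - of_real (v / lam)) * (1 + of_real (w / u) * exp (of_real c ^ \<kappa> * \<zeta>)) * P"
      unfolding P_def by (rule phi_functional_equation[OF \<zeta>])
    have s: "complex_of_real lam = of_real u + of_real v + of_real w" by simp
    have uw: "complex_of_real u + of_real w \<noteq> 0" using uvw by (simp flip: of_real_add)
    \<comment> \<open>Clearing the denominators of q and \<rho> and using lam - v = u + w produces
      the factor u + w on both sides, which is cancelled.\<close>
    have "phi \<zeta> * (of_real lam - of_real v * exp \<zeta>) * (of_real u + of_real w) =
      (of_real lam * of_real u) * (phi \<zeta> * (1 - of_real (v / lam) * exp \<zeta>) * (1 + of_real (w / u)))"
      using lz by (simp add: of_real_divide field_simps del: of_real_add)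
    also have "\<dots> = (of_real lam * of_real u) * ((1 - of_real (v / lam)) * (1 + of_real (w / u) * exp (of_real c ^ \<kappa> * \<zeta>)) * P)"
      by (simp only: fe)
    also have "\<dots> = (of_real lam - of_real v) * (of_real u + of_real w * exp (of_real c ^ \<kappa> * \<zeta>)) * P"
      using lz by (simp add: of_real_divide field_simps del: of_real_add)
    also have "of_real lam - of_real v = complex_of_real u + of_real w" by simp
    finally have "(of_real u + of_real w) * (phi \<zeta> * (of_real lam - of_real v * exp \<zeta>)) =
      (of_real u + of_real w) * ((of_real u + of_real w * exp (of_real c ^ \<kappa> * \<zeta>)) * P)" by (simp only: mult_ac)
    hence "phi \<zeta> * (of_real lam - of_real v * exp \<zeta>) = (of_real u + of_real w * exp (of_real c ^ \<kappa> * \<zeta>)) * P"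
      using uw by (simp only: mult_cancel_left simp_thms)
    hence "of_real u * P + of_real v * (exp \<zeta> * phi \<zeta>) + of_real w * (exp (\<zeta> * of_real c ^ \<kappa>) * P) = of_real lam * phi \<zeta>"
      by (simp add: algebra_simps)
    thus ?thesis unfolding Q_integral f f0 using lz by (simp del: of_real_add)
  qed
  ultimately show ?thesis
    using integral_compound_poisson_pmf_near[OF quadrant, of f "lam * h"] h lam by (simp add: f0 f_def[symmetric])
qed

end

section \<open>Riemann sums of the path integral\<close>

definition path_integral :: "real \<Rightarrow> (real \<Rightarrow> real) \<Rightarrow> (real \<Rightarrow> real) \<Rightarrow> real \<Rightarrow> real" where
  "path_integral c n l T =
     (LINT s:{0<..T}|interval_measure (\<lambda>s. l (max 0 s)). c powr (- Lim (at_left s) n))"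

text \<open>Left endpoints are essential: they converge to the left limits of the integrand, and
  they make each coefficient a function of the increments before the one that it multiplies.\<close>

definition riemann_sum :: "real \<Rightarrow> (real \<Rightarrow> real) \<Rightarrow> (real \<Rightarrow> real) \<Rightarrow> real \<Rightarrow> nat \<Rightarrow> real" where
  "riemann_sum c n l T k = (\<Sum>i<k. c powr (- n (real i * (T / real k))) *
     (l (real (Suc i) * (T / real k)) - l (real i * (T / real k))))"

locale increasing_paths =
  fixes c :: real and n l :: "real \<Rightarrow> real"
  assumes c: "c > 1"
    and n_nonneg: "\<And>s. s \<ge> 0 \<Longrightarrow> n s \<ge> 0"
    and left_limits: "\<And>t. t > 0 \<Longrightarrow> \<exists>x. (n \<longlongrightarrow> x) (at_left t)"
    and l_mono: "\<And>s t. 0 \<le> s \<Longrightarrow> s \<le> t \<Longrightarrow> l s \<le> l t"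
    and l_right: "\<And>t. t \<ge> 0 \<Longrightarrow> continuous (at_right t) l"
begin

lemma ext_mono: "x \<le> y \<Longrightarrow> l (max 0 x) \<le> l (max 0 y)"
  by (rule l_mono) auto

lemma ext_right_continuous: "continuous (at_right a) (\<lambda>s. l (max 0 s))"
proof (cases "a \<ge> 0")
  case True
  have "(l \<longlongrightarrow> l a) (at_right a)" using l_right[OF True] by (simp add: continuous_within)
  moreover have "\<forall>\<^sub>F s in at_right a. l s = l (max 0 s)"
    using eventually_at_right_less[of a] by eventually_elim (use True in auto)
  ultimately have "((\<lambda>s. l (max 0 s)) \<longlongrightarrow> l a) (at_right a)" by (rule Lim_transform_eventually)
  thus ?thesis using True by (simp add: continuous_within)
next
  case False
  hence "\<forall>\<^sub>F s in at_right a. s < 0"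
    by (intro eventually_at_rightI[of a 0]) auto
  hence "\<forall>\<^sub>F s in at_right a. l (max 0 a) = l (max 0 s)"
    by eventually_elim (use False in auto)
  hence "((\<lambda>s. l (max 0 s)) \<longlongrightarrow> l (max 0 a)) (at_right a)" by (intro Lim_transform_eventually[OF tendsto_const])
  thus ?thesis by (simp add: continuous_within)
qed

abbreviation stieltjes :: "real measure" where "stieltjes \<equiv> interval_measure (\<lambda>s. l (max 0 s))"

lemma emeasure_stieltjes: "a \<le> b \<Longrightarrow> emeasure stieltjes {a<..b} = ennreal (l (max 0 b) - l (max 0 a))"
  by (rule emeasure_interval_measure_Ioc[OF _ ext_mono ext_right_continuous])

lemma measure_stieltjes: "a \<le> b \<Longrightarrow> measure stieltjes {a<..b} = l (max 0 b) - l (max 0 a)"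
  by (rule measure_interval_measure_Ioc[OF _ ext_mono ext_right_continuous])

lemma left_limit:
  assumes t: "t > 0"
  shows "(n \<longlongrightarrow> Lim (at_left t) n) (at_left t)" "Lim (at_left t) n \<ge> 0"
proof -
  obtain x where x: "(n \<longlongrightarrow> x) (at_left t)" using left_limits[OF t] by blast
  have eq: "Lim (at_left t) n = x" by (rule tendsto_Lim[OF _ x]) simp
  show "(n \<longlongrightarrow> Lim (at_left t) n) (at_left t)" using x eq by simp
  have "\<forall>\<^sub>F s in at_left t. 0 \<le> n s"
    using t by (intro eventually_at_leftI[of 0]) (auto intro: n_nonneg)
  thus "Lim (at_left t) n \<ge> 0" unfolding eq using tendsto_lowerbound[OF x] by simp
qed

text \<open>The step functions g k evaluate n at a point \<tau> k s strictly to the left of s and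
  tending to s, so they converge to the integrand at every point of (0, T]; there they are bounded
  by 1, and the Stieltjes mass of (0, T] is finite.\<close>

lemma riemann_sum_tendsto:
  assumes T: "T > 0"
  shows "set_integrable stieltjes {0<..T} (\<lambda>s. c powr (- Lim (at_left s) n))"
    and "(\<lambda>k. riemann_sum c n l T (Suc k)) \<longlonglongrightarrow> path_integral c n l T"
proof -
  define h where "h k = T / real (Suc k)" for k
  have h: "h k > 0" for k using T by (simp add: h_def)
  define g where "g k s = (\<Sum>i<Suc k. c powr (- n (real i * h k)) * indicator {real i * h k<..real (Suc i) * h k} s)" for k and s :: real
  define f where "f s = indicator {0<..T} s *\<^sub>R c powr (- Lim (at_left s) n)" for s
  \<comment> \<open>The left endpoint of the cell that contains s. Cells are open on the left and
    closed on the right, hence ceiling minus 1 rather than floor.\<close>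
  define \<tau> where "\<tau> k s = real (nat (\<lceil>s / h k\<rceil> - 1)) * h k" for k s
  have g_eq: "g k s = c powr (- n (\<tau> k s))" and \<tau>: "\<tau> k s < s" "s \<le> \<tau> k s + h k" "\<tau> k s \<ge> 0"
    if s: "s \<in> {0<..T}" for k s
  proof -
    define i0 where "i0 = nat (\<lceil>s / h k\<rceil> - 1)"
    have pos: "s / h k > 0" using s h[of k] by simp
    have "real (Suc k) * h k = T" by (simp add: h_def)
    hence le: "s / h k \<le> real_of_int (int (Suc k))" using s h[of k] by (simp add: pos_divide_le_eq del: of_nat_Suc)
    have ceil: "1 \<le> \<lceil>s / h k\<rceil>" "\<lceil>s / h k\<rceil> \<le> int (Suc k)"
      unfolding one_le_ceiling ceiling_le_iff by (rule pos, rule le)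
    have i0: "i0 < Suc k" unfolding i0_def using ceil by (simp add: nat_less_iff)
    have iff: "s \<in> {real i * h k<..real (Suc i) * h k} \<longleftrightarrow> i = i0" for i
    proof -
      have "s \<in> {real i * h k<..real (Suc i) * h k} \<longleftrightarrow> real i < s / h k \<and> s / h k \<le> real i + 1"
        using h[of k] by (auto simp: field_simps)
      also have "\<dots> \<longleftrightarrow> \<lceil>s / h k\<rceil> = int i + 1" by (simp add: ceiling_eq_iff)
      also have "\<dots> \<longleftrightarrow> i = i0" unfolding i0_def using ceil(1) by auto
      finally show ?thesis .
    qed
    have "g k s = (\<Sum>i<Suc k. if i = i0 then c powr (- n (real i * h k)) else 0)"
      unfolding g_def indicator_def iff by (intro sum.cong) auto
    also have "\<dots> = c powr (- n (real i0 * h k))" using i0 by simp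
    finally show "g k s = c powr (- n (\<tau> k s))" by (simp add: \<tau>_def i0_def)
    have "s \<in> {real i0 * h k<..real (Suc i0) * h k}" by (simp only: iff)
    thus "\<tau> k s < s" "s \<le> \<tau> k s + h k" by (auto simp: \<tau>_def i0_def algebra_simps)
    show "\<tau> k s \<ge> 0" using h[of k] by (simp add: \<tau>_def)
  qed
  have g_le: "norm (indicator {0<..T} s *\<^sub>R g k s) \<le> indicator {0<..T} s" for k s
  proof (cases "s \<in> {0<..T}")
    case True
    have "c powr (- n (\<tau> k s)) \<le> c powr 0" using c n_nonneg[OF \<tau>(3)[OF True, of k]] by (intro powr_mono) auto
    thus ?thesis using c True by (simp add: g_eq[OF True] indicator_def)
  qed simp
  have lim: "(\<lambda>k. indicator {0<..T} s *\<^sub>R g k s) \<longlonglongrightarrow> f s" for s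
  proof (cases "s \<in> {0<..T}")
    case True
    have "(\<lambda>k. T * inverse (real (Suc k))) \<longlonglongrightarrow> T * 0"
      by (intro tendsto_mult tendsto_const LIMSEQ_inverse_real_of_nat)
    hence hlim: "h \<longlonglongrightarrow> 0" unfolding h_def[abs_def] divide_inverse mult_zero_right .
    have "(\<lambda>k. \<tau> k s) \<longlonglongrightarrow> s"
    proof (rule tendsto_sandwich)
      show "(\<lambda>k. s - h k) \<longlonglongrightarrow> s" using tendsto_diff[OF tendsto_const[of s] hlim] by simp
    qed (use \<tau>[OF True] in \<open>auto intro!: always_eventually less_imp_le simp: algebra_simps\<close>)
    hence "filterlim (\<lambda>k. \<tau> k s) (at_left s) sequentially"
      unfolding filterlim_at using \<tau>(1)[OF True] by (auto intro!: always_eventually simp: less_imp_neq)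
    moreover have "s > 0" using True by simp
    ultimately have "(\<lambda>k. n (\<tau> k s)) \<longlonglongrightarrow> Lim (at_left s) n"
      by (intro filterlim_compose[OF left_limit(1)])
    hence "(\<lambda>k. c powr (- n (\<tau> k s))) \<longlonglongrightarrow> c powr (- Lim (at_left s) n)"
      using c by (intro tendsto_powr tendsto_const tendsto_minus) auto
    thus ?thesis using True by (simp add: f_def g_eq)
  qed (simp add: f_def)
  have gm: "(\<lambda>s. indicator {0<..T} s *\<^sub>R g k s) \<in> borel_measurable stieltjes" for k
    unfolding g_def by measurable
  have fm: "f \<in> borel_measurable stieltjes" by (rule borel_measurable_LIMSEQ_metric[OF gm lim])
  have wi: "integrable stieltjes (\<lambda>s. indicator {0<..T} s :: real)"
    using T by (intro integrable_real_indicator) (auto simp: emeasure_stieltjes less_top[symmetric])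
  note dct = integral_dominated_convergence[OF fm gm wi AE_I2[OF lim] AE_I2[OF g_le]]
    integrable_dominated_convergence[OF fm gm wi AE_I2[OF lim] AE_I2[OF g_le]]
  show "set_integrable stieltjes {0<..T} (\<lambda>s. c powr (- Lim (at_left s) n))"
    using dct(2) by (simp add: f_def[abs_def] set_integrable_def)
  have "(LINT s|stieltjes. indicator {0<..T} s *\<^sub>R g k s) = riemann_sum c n l T (Suc k)" for k
  proof -
    have "(LINT s|stieltjes. indicator {0<..T} s *\<^sub>R g k s) =
      (LINT s|stieltjes. (\<Sum>i<Suc k. c powr (- n (real i * h k)) * indicator {real i * h k<..real (Suc i) * h k} s))"
    proof (intro Bochner_Integration.integral_cong refl)
      fix s
      show "indicator {0<..T} s *\<^sub>R g k s = (\<Sum>i<Suc k. c powr (- n (real i * h k)) * indicator {real i * h k<..real (Suc i) * h k} s)"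
      proof (cases "s \<in> {0<..T}")
        case False
        have "s \<notin> {real i * h k<..real (Suc i) * h k}" if i: "i < Suc k" for i
        proof
          assume s: "s \<in> {real i * h k<..real (Suc i) * h k}"
          have "0 \<le> real i * h k" using h[of k] by simp
          moreover have "real (Suc i) * h k \<le> real (Suc k) * h k"
            using i h[of k] by (intro mult_right_mono) auto
          moreover have "real (Suc k) * h k = T" by (simp add: h_def)
          ultimately have "s \<in> {0<..T}" using s unfolding greaterThanAtMost_iff by linarith
          thus False using False by simp
        qed
        hence "(\<Sum>i<Suc k. c powr (- n (real i * h k)) * indicator {real i * h k<..real (Suc i) * h k} s) = (\<Sum>i<Suc k. 0)"
          by (intro sum.cong refl) (simp add: indicator_def)
        thus ?thesis using False by simp
      qed (simp add: g_def)
    qed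
    also have "\<dots> = (\<Sum>i<Suc k. c powr (- n (real i * h k)) * measure stieltjes {real i * h k<..real (Suc i) * h k})"
    proof (subst Bochner_Integration.integral_sum)
      fix i
      have "emeasure stieltjes {real i * h k<..real (Suc i) * h k} < \<infinity>"
        using h[of k] by (subst emeasure_stieltjes) (auto intro!: mult_right_mono)
      thus "integrable stieltjes (\<lambda>s. c powr (- n (real i * h k)) * indicator {real i * h k<..real (Suc i) * h k} s)"
        by (intro integrable_mult_right integrable_real_indicator) auto
    qed simp
    also have "\<dots> = riemann_sum c n l T (Suc k)"
      unfolding riemann_sum_def
    proof (intro sum.cong refl)
      fix i
      have "measure stieltjes {real i * h k<..real (Suc i) * h k} = l (real (Suc i) * h k) - l (real i * h k)"
        using h[of k] by (subst measure_stieltjes) (auto intro!: mult_right_mono simp: max_def)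
      thus "c powr (- n (real i * h k)) * measure stieltjes {real i * h k<..real (Suc i) * h k} =
        c powr (- n (real i * (T / real (Suc k)))) * (l (real (Suc i) * (T / real (Suc k))) - l (real i * (T / real (Suc k))))"
        by (simp add: h_def)
    qed
    finally show ?thesis .
  qed
  thus "(\<lambda>k. riemann_sum c n l T (Suc k)) \<longlonglongrightarrow> path_integral c n l T"
    using dct(1) by (simp add: f_def[abs_def] path_integral_def set_lebesgue_integral_def)
qed

lemma path_integral_mono:
  assumes "0 < S" "S \<le> T"
  shows "path_integral c n l S \<le> path_integral c n l T"
  unfolding path_integral_def set_lebesgue_integral_def
proof (rule integral_mono)
  show "integrable stieltjes (\<lambda>s. indicator {0<..S} s *\<^sub>R c powr (- Lim (at_left s) n))"
    "integrable stieltjes (\<lambda>s. indicator {0<..T} s *\<^sub>R c powr (- Lim (at_left s) n))"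
    using riemann_sum_tendsto(1)[of S] riemann_sum_tendsto(1)[of T] assms by (auto simp: set_integrable_def)
qed (use assms in \<open>auto simp: indicator_def\<close>)

lemma path_integral_nonneg: "path_integral c n l T \<ge> 0"
  unfolding path_integral_def set_lebesgue_integral_def by (intro integral_nonneg_AE) (auto simp: indicator_def)

text \<open>Monotonicity in T reduces the limit along all real times to the limit along
  integers.\<close>

lemma path_integral_tendsto_at_top:
  assumes "(\<lambda>m. path_integral c n l (real (Suc m))) \<longlonglongrightarrow> R"
  shows "(path_integral c n l \<longlongrightarrow> R) at_top"
proof (rule order_tendstoI)
  fix a assume a: "a < R"
  from eventually_happens'[OF sequentially_bot order_tendstoD(1)[OF assms a]]
  obtain m where m: "a < path_integral c n l (real (Suc m))" ..
  show "\<forall>\<^sub>F t in at_top. a < path_integral c n l t"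
    using eventually_ge_at_top[of "real (Suc m)"]
  proof eventually_elim
    case (elim t)
    have "path_integral c n l (real (Suc m)) \<le> path_integral c n l t" by (rule path_integral_mono[OF _ elim]) simp
    thus ?case using m by linarith
  qed
next
  fix a assume a: "R < a"
  have le: "path_integral c n l (real (Suc m)) \<le> R" for m
    by (rule incseq_le[OF _ assms]) (auto simp: incseq_def intro!: path_integral_mono)
  show "\<forall>\<^sub>F t in at_top. path_integral c n l t < a"
    using eventually_gt_at_top[of 0]
  proof eventually_elim
    case (elim t)
    obtain m where "t \<le> real m" using real_arch_simple by blast
    hence "path_integral c n l t \<le> path_integral c n l (real (Suc m))" using elim by (intro path_integral_mono) auto
    thus ?case using le[of m] a by linarith
  qed
qed

end

lemma exp_integral_upto_eq: "exp_integral_upto c N L t \<omega> = path_integral c (\<lambda>r. N r \<omega>) (\<lambda>s. L s \<omega>) t"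
  by (simp add: exp_integral_upto_def path_integral_def)

text \<open>Almost sure monotonicity is obtained for countably many pairs of times only. If f t < f
  s, right continuity keeps the strict inequality at rational times slightly to the right of s and
  t.\<close>

lemma right_continuous_mono_extend:
  fixes f :: "real \<Rightarrow> real"
  assumes mono: "\<And>s t. s \<in> \<rat> \<Longrightarrow> t \<in> \<rat> \<Longrightarrow> 0 \<le> s \<Longrightarrow> s < t \<Longrightarrow> f s \<le> f t"
    and right: "\<And>t. t \<ge> 0 \<Longrightarrow> continuous (at_right t) f" and st: "0 \<le> s" "s \<le> t"
  shows "f s \<le> f t"
proof (rule ccontr)
  assume "\<not> f s \<le> f t"
  hence lt: "f t < f s" by simp
  hence "s \<noteq> t" by auto
  hence s_t: "s < t" using st by simp
  define m where "m = (f s + f t) / 2"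
  have m: "f t < m" "m < f s" using lt by (auto simp: m_def field_simps)
  have "(f \<longlongrightarrow> f s) (at_right s)" "(f \<longlongrightarrow> f t) (at_right t)"
    using right[of s] right[of t] st by (auto simp: continuous_within)
  hence "\<forall>\<^sub>F x in at_right s. m < f x" "\<forall>\<^sub>F x in at_right t. f x < m"
    using m order_tendstoD by blast+
  then obtain b1 b2 where b1: "b1 > s" "\<And>x. s < x \<Longrightarrow> x < b1 \<Longrightarrow> m < f x"
    and b2: "b2 > t" "\<And>x. t < x \<Longrightarrow> x < b2 \<Longrightarrow> f x < m"
    unfolding eventually_at_right_field by blast
  obtain x where x: "x \<in> \<rat>" "s < x" "x < min b1 t" using Rats_dense_in_real[of s "min b1 t"] b1(1) s_t by auto
  obtain y where y: "y \<in> \<rat>" "t < y" "y < b2" using Rats_dense_in_real[of t b2] b2(1) by auto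
  have "f x \<le> f y" using x y st by (intro mono) auto
  moreover have "m < f x" "f y < m" using x y b1(2) b2(2) by auto
  ultimately show False by simp
qed

section \<open>The law of the exponential integral\<close>

text \<open>The Riemann sum as a function of the increments. Truncating at \<open>0\<close>, which almost surely changes
  nothing, keeps \<open>Re \<le> 0\<close> and hence \<open>phi\<close> bounded everywhere.\<close>

definition level :: "nat \<Rightarrow> (nat \<Rightarrow> real \<times> real) \<Rightarrow> real" where
  "level i v = (\<Sum>j<i. max 0 (fst (v j)))"

definition scheme :: "real \<Rightarrow> nat \<Rightarrow> (nat \<Rightarrow> real \<times> real) \<Rightarrow> real" where
  "scheme c i v = (\<Sum>j<i. c powr (- level j v) * max 0 (snd (v j)))"

lemma level_cong: "(\<And>j. j < i \<Longrightarrow> v j = v' j) \<Longrightarrow> level i v = level i v'"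
  unfolding level_def by (intro sum.cong) auto

lemma scheme_cong:
  assumes "\<And>j. j < i \<Longrightarrow> v j = v' j"
  shows "scheme c i v = scheme c i v'"
  unfolding scheme_def
proof (intro sum.cong refl)
  fix j assume j: "j \<in> {..<i}"
  have "level j v = level j v'" by (rule level_cong) (use assms j in auto)
  thus "c powr (- level j v) * max 0 (snd (v j)) = c powr (- level j v') * max 0 (snd (v' j))"
    using assms j by simp
qed

lemma scheme_nonneg: "scheme c i v \<ge> 0"
  unfolding scheme_def by (intro sum_nonneg) auto

lemma fst_snd_borel [measurable]:
  "fst \<in> borel_measurable (borel :: ('a :: {second_countable_topology} \<times> 'b :: {second_countable_topology}) measure)"
  "snd \<in> borel_measurable (borel :: ('a :: {second_countable_topology} \<times> 'b :: {second_countable_topology}) measure)"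
  by (auto intro!: borel_measurable_continuous_onI continuous_on_fst continuous_on_snd continuous_on_id)

lemma level_measurable:
  assumes "\<And>j. j < i \<Longrightarrow> (\<lambda>\<omega>. v \<omega> j) \<in> borel_measurable M"
  shows "(\<lambda>\<omega>. level i (v \<omega>)) \<in> borel_measurable M"
  unfolding level_def
proof (intro borel_measurable_sum borel_measurable_max borel_measurable_const)
  fix j assume "j \<in> {..<i}"
  thus "(\<lambda>\<omega>. fst (v \<omega> j)) \<in> borel_measurable M" using assms by (intro measurable_compose[OF _ fst_snd_borel(1)]) auto
qed

lemma scheme_measurable:
  assumes "\<And>j. j < i \<Longrightarrow> (\<lambda>\<omega>. v \<omega> j) \<in> borel_measurable M"
  shows "(\<lambda>\<omega>. scheme c i (v \<omega>)) \<in> borel_measurable M"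
  unfolding scheme_def
proof (rule borel_measurable_sum)
  fix j assume "j \<in> {..<i}"
  hence [measurable]: "(\<lambda>\<omega>. snd (v \<omega> j)) \<in> borel_measurable M" "(\<lambda>\<omega>. level j (v \<omega>)) \<in> borel_measurable M"
    using assms by (auto intro!: measurable_compose[OF _ fst_snd_borel(2)] level_measurable)
  show "(\<lambda>\<omega>. c powr (- level j (v \<omega>)) * max 0 (snd (v \<omega> j))) \<in> borel_measurable M" by measurable
qed

lemma Re_mult_le_0: "Re \<zeta> \<le> 0 \<Longrightarrow> x \<ge> 0 \<Longrightarrow> Re (\<zeta> * of_real x) \<le> 0"
  by (simp add: mult_nonpos_nonneg)

text \<open>Induction on the number of increments: the next one is independent of the first i and,
  by \<open>near\<close> at \<zeta> c^(-level), changes the mean by at most \<epsilon>, since the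
  factor exp (\<zeta> scheme) has modulus at most 1. The errors add up linearly.\<close>

lemma (in ou_exponent) scheme_expectation:
  fixes \<pi> :: "(real \<times> real) pmf"
  assumes M: "prob_space M"
    and indep: "prob_space.indep_vars M (\<lambda>_. borel) V {..<k}"
    and law: "\<And>i. i < k \<Longrightarrow> distr M borel (V i) = distr (measure_pmf \<pi>) borel (\<lambda>x. x)"
    and supp: "set_pmf \<pi> \<subseteq> {0..} \<times> {0..}"
    and near: "\<And>\<zeta>. Re \<zeta> \<le> 0 \<Longrightarrow>
      norm ((LINT x|measure_pmf \<pi>. exp (\<zeta> * of_real (snd x)) * phi (\<zeta> * of_real (c powr (- fst x)))) - phi \<zeta>) \<le> \<epsilon>"
    and \<zeta>: "Re \<zeta> \<le> 0" and i: "i \<le> k"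
  shows "norm ((LINT \<omega>|M. exp (\<zeta> * of_real (scheme c i (\<lambda>j. V j \<omega>))) * phi (\<zeta> * of_real (c powr (- level i (\<lambda>j. V j \<omega>))))) - phi \<zeta>)
    \<le> real i * \<epsilon>"
  using i
proof (induction i)
  case 0
  interpret prob_space M by (rule M)
  show ?case using c by (simp add: scheme_def level_def prob_space)
next
  case (Suc i)
  interpret prob_space M by (rule M)
  have rv: "V j \<in> borel_measurable M" if "j < k" for j using indep that by (auto simp: indep_vars_def)
  \<comment> \<open>This pair depends on the increments before i only, and it is all that is needed
    from the past.\<close>
  define U where "U \<omega> = (scheme c i (\<lambda>j. V j \<omega>), level i (\<lambda>j. V j \<omega>))" for \<omega>
  \<comment> \<open>Here u ranges over all pairs of reals, not only over values of \<open>U\<close>;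
    max 0 keeps the modulus at most 1 everywhere and changes nothing on those values, because
    \<open>scheme\<close> is nonnegative.\<close>
  define f where "f = (\<lambda>(u :: real \<times> real, x :: real \<times> real). exp (\<zeta> * of_real (max 0 (fst u))) *
    (exp (\<zeta> * of_real (c powr (- snd u) * max 0 (snd x))) * phi (\<zeta> * of_real (c powr (- snd u) * c powr (- max 0 (fst x))))))"
  define G where "G u = exp (\<zeta> * of_real (max 0 (fst u))) * phi (\<zeta> * of_real (c powr (- snd u)))" for u :: "real \<times> real"
  have Um: "U \<in> M \<rightarrow>\<^sub>M borel \<Otimes>\<^sub>M borel"
    unfolding U_def using Suc.prems rv by (intro measurable_Pair scheme_measurable level_measurable) auto
  have ind: "indep_var (borel \<Otimes>\<^sub>M borel) U borel (V i)"
  proof -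
    have "indep_var (PiM {..<i} (\<lambda>_. borel)) (\<lambda>\<omega>. restrict (\<lambda>j. V j \<omega>) {..<i}) (PiM {i} (\<lambda>_. borel)) (\<lambda>\<omega>. restrict (\<lambda>j. V j \<omega>) {i})"
      using Suc.prems by (intro indep_var_restrict[OF indep]) auto
    moreover have "(\<lambda>v. (scheme c i v, level i v)) \<in> PiM {..<i} (\<lambda>_. borel) \<rightarrow>\<^sub>M borel \<Otimes>\<^sub>M borel"
      by (intro measurable_Pair scheme_measurable level_measurable measurable_component_singleton) auto
    moreover have "(\<lambda>v. v i) \<in> PiM {i} (\<lambda>_. borel) \<rightarrow>\<^sub>M borel"
      by (rule measurable_component_singleton) simp
    ultimately have "indep_var (borel \<Otimes>\<^sub>M borel) ((\<lambda>v. (scheme c i v, level i v)) \<circ> (\<lambda>\<omega>. restrict (\<lambda>j. V j \<omega>) {..<i}))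
      borel ((\<lambda>v. v i) \<circ> (\<lambda>\<omega>. restrict (\<lambda>j. V j \<omega>) {i}))"
      by (rule indep_var_compose)
    moreover have "(\<lambda>v. (scheme c i v, level i v)) \<circ> (\<lambda>\<omega>. restrict (\<lambda>j. V j \<omega>) {..<i}) = U"
      unfolding U_def comp_def
      by (intro ext prod_eqI) (auto intro!: scheme_cong level_cong)
    moreover have "(\<lambda>v. v i) \<circ> (\<lambda>\<omega>. restrict (\<lambda>j. V j \<omega>) {i}) = V i" by auto
    ultimately show ?thesis by simp
  qed
  note ind' = ind[unfolded indep_var_distribution_eq]
  interpret DU: prob_space "distr M (borel \<Otimes>\<^sub>M borel) U" by (rule prob_space_distr[OF Um])
  interpret DV: prob_space "distr M borel (V i)" by (rule prob_space_distr) (use rv Suc.prems in auto)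
  interpret P: pair_prob_space "distr M (borel \<Otimes>\<^sub>M borel) U" "distr M borel (V i)" ..
  have fm: "f \<in> borel_measurable ((borel \<Otimes>\<^sub>M borel) \<Otimes>\<^sub>M borel)"
  proof -
    have [measurable]: "(\<lambda>x. fst (snd x)) \<in> borel_measurable ((borel \<Otimes>\<^sub>M borel) \<Otimes>\<^sub>M (borel :: (real \<times> real) measure))"
      "(\<lambda>x. snd (snd x)) \<in> borel_measurable ((borel \<Otimes>\<^sub>M borel) \<Otimes>\<^sub>M (borel :: (real \<times> real) measure))"
      by (rule measurable_compose[OF measurable_snd fst_snd_borel(1)], rule measurable_compose[OF measurable_snd fst_snd_borel(2)])
    have m: "(\<lambda>x. exp (\<zeta> * of_real (max 0 (fst (fst x))))) \<in> borel_measurable ((borel \<Otimes>\<^sub>M borel) \<Otimes>\<^sub>M (borel :: (real \<times> real) measure))"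
      "(\<lambda>x. exp (\<zeta> * of_real (c powr (- snd (fst x)) * max 0 (snd (snd x))))) \<in> borel_measurable ((borel \<Otimes>\<^sub>M borel) \<Otimes>\<^sub>M (borel :: (real \<times> real) measure))"
      "(\<lambda>x. \<zeta> * of_real (c powr (- snd (fst x)) * c powr (- max 0 (fst (snd x))))) \<in> borel_measurable ((borel \<Otimes>\<^sub>M borel) \<Otimes>\<^sub>M (borel :: (real \<times> real) measure))"
      by measurable
    have "(\<lambda>x. phi (\<zeta> * of_real (c powr (- snd (fst x)) * c powr (- max 0 (fst (snd x)))))) \<in> borel_measurable ((borel \<Otimes>\<^sub>M borel) \<Otimes>\<^sub>M (borel :: (real \<times> real) measure))"
      by (rule phi_measurable[OF m(3)], rule Re_mult_le_0[OF \<zeta>]) simp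
    thus ?thesis unfolding f_def case_prod_unfold by (intro borel_measurable_times m)
  qed
  have e1: "norm (exp (\<zeta> * of_real x)) \<le> 1" if "x \<ge> 0" for x
    using Re_mult_le_0[OF \<zeta> that] by simp
  have p1: "norm (phi (\<zeta> * of_real x)) \<le> 1" if "x \<ge> 0" for x
    by (rule norm_phi_le_1[OF Re_mult_le_0[OF \<zeta> that]])
  have f_le: "norm (f z) \<le> 1" for z
  proof -
    have "norm (f z) \<le> 1 * (1 * 1)"
      unfolding f_def case_prod_unfold norm_mult by (intro mult_mono e1 p1) auto
    thus ?thesis by simp
  qed
  have fint: "integrable (distr M (borel \<Otimes>\<^sub>M borel) U \<Otimes>\<^sub>M distr M borel (V i)) f"
    by (rule P.integrable_const_bound[where B = 1]) (use f_le fm in auto)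
  have Gm: "G \<in> borel_measurable (borel \<Otimes>\<^sub>M borel)"
  proof -
    have m: "(\<lambda>u. exp (\<zeta> * of_real (max 0 (fst u)))) \<in> borel_measurable (borel \<Otimes>\<^sub>M borel)"
      "(\<lambda>u. \<zeta> * of_real (c powr (- snd u))) \<in> borel_measurable (borel \<Otimes>\<^sub>M borel)" by measurable
    have "(\<lambda>u. phi (\<zeta> * of_real (c powr (- snd u)))) \<in> borel_measurable (borel \<Otimes>\<^sub>M borel)"
      by (rule phi_measurable[OF m(2)], rule Re_mult_le_0[OF \<zeta>]) simp
    thus ?thesis unfolding G_def by (intro borel_measurable_times m)
  qed
  have G_le: "norm (G u) \<le> 1" for u
    unfolding G_def norm_mult using mult_mono[OF e1 p1] by simp
  have Gint: "integrable (distr M (borel \<Otimes>\<^sub>M borel) U) G"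
    by (rule DU.integrable_const_bound[where B = 1]) (use G_le Gm in auto)
  have "(LINT \<omega>|M. exp (\<zeta> * of_real (scheme c (Suc i) (\<lambda>j. V j \<omega>))) * phi (\<zeta> * of_real (c powr (- level (Suc i) (\<lambda>j. V j \<omega>))))) =
    (LINT \<omega>|M. f (U \<omega>, V i \<omega>))"
  proof (intro Bochner_Integration.integral_cong refl)
    fix \<omega>
    have "scheme c (Suc i) (\<lambda>j. V j \<omega>) = max 0 (fst (U \<omega>)) + c powr (- snd (U \<omega>)) * max 0 (snd (V i \<omega>))"
      using scheme_nonneg[of c i "\<lambda>j. V j \<omega>"] by (simp add: U_def scheme_def)
    moreover have "c powr (- level (Suc i) (\<lambda>j. V j \<omega>)) = c powr (- snd (U \<omega>)) * c powr (- max 0 (fst (V i \<omega>)))"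
      by (simp add: U_def level_def flip: powr_add)
    ultimately show "exp (\<zeta> * of_real (scheme c (Suc i) (\<lambda>j. V j \<omega>))) * phi (\<zeta> * of_real (c powr (- level (Suc i) (\<lambda>j. V j \<omega>)))) = f (U \<omega>, V i \<omega>)"
      unfolding f_def case_prod_conv by (simp only: of_real_add distrib_left exp_add mult.assoc)
  qed
  also have "\<dots> = (LINT z|distr M ((borel \<Otimes>\<^sub>M borel) \<Otimes>\<^sub>M borel) (\<lambda>\<omega>. (U \<omega>, V i \<omega>)). f z)"
    using Um rv Suc.prems fm by (subst integral_distr) (auto intro!: measurable_Pair)
  also have "\<dots> = (LINT z|(distr M (borel \<Otimes>\<^sub>M borel) U \<Otimes>\<^sub>M distr M borel (V i)). f z)"
    using ind' by simp
  also have "\<dots> = (LINT u|distr M (borel \<Otimes>\<^sub>M borel) U. LINT x|distr M borel (V i). f (u, x))"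
    by (rule P.integral_fst'[OF fint, symmetric])
  finally have E1: "(LINT \<omega>|M. exp (\<zeta> * of_real (scheme c (Suc i) (\<lambda>j. V j \<omega>))) * phi (\<zeta> * of_real (c powr (- level (Suc i) (\<lambda>j. V j \<omega>))))) = \<dots>" .
  have E0: "(LINT \<omega>|M. exp (\<zeta> * of_real (scheme c i (\<lambda>j. V j \<omega>))) * phi (\<zeta> * of_real (c powr (- level i (\<lambda>j. V j \<omega>))))) =
    (LINT u|distr M (borel \<Otimes>\<^sub>M borel) U. G u)"
    using scheme_nonneg[of c i] by (subst integral_distr[OF Um Gm]) (simp add: G_def U_def max_def)
  have inner: "norm ((LINT x|distr M borel (V i). f (u, x)) - G u) \<le> \<epsilon>" for u
  proof -
    define z where "z = \<zeta> * of_real (c powr (- snd u))"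
    have z: "Re z \<le> 0" unfolding z_def by (rule Re_mult_le_0[OF \<zeta>]) simp
    have fu: "(\<lambda>x. f (u, x)) \<in> borel_measurable borel"
      using fm by (rule measurable_compose[rotated]) (auto intro!: measurable_Pair simp: space_pair_measure)
    have "(LINT x|distr M borel (V i). f (u, x)) = (LINT x|measure_pmf \<pi>. f (u, x))"
      using law[of i] Suc.prems fu by (simp add: integral_distr)
    also have "\<dots> = (LINT x|measure_pmf \<pi>. exp (\<zeta> * of_real (max 0 (fst u))) * (exp (z * of_real (snd x)) * phi (z * of_real (c powr (- fst x)))))"
    proof (intro integral_cong_AE)
      show "AE x in measure_pmf \<pi>. f (u, x) = exp (\<zeta> * of_real (max 0 (fst u))) * (exp (z * of_real (snd x)) * phi (z * of_real (c powr (- fst x))))"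
        unfolding AE_measure_pmf_iff
      proof
        fix x assume "x \<in> set_pmf \<pi>"
        hence "fst x \<ge> 0" "snd x \<ge> 0" using supp by auto
        thus "f (u, x) = exp (\<zeta> * of_real (max 0 (fst u))) * (exp (z * of_real (snd x)) * phi (z * of_real (c powr (- fst x))))"
          unfolding f_def z_def case_prod_conv by (simp only: max_absorb2 of_real_mult mult.assoc)
      qed
    qed auto
    also have "\<dots> = exp (\<zeta> * of_real (max 0 (fst u))) * (LINT x|measure_pmf \<pi>. exp (z * of_real (snd x)) * phi (z * of_real (c powr (- fst x))))"
      by simp
    also have "\<dots> - G u = exp (\<zeta> * of_real (max 0 (fst u))) * ((LINT x|measure_pmf \<pi>. exp (z * of_real (snd x)) * phi (z * of_real (c powr (- fst x)))) - phi z)"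
      by (simp only: G_def z_def right_diff_distrib)
    also have "norm \<dots> \<le> 1 * \<epsilon>"
      unfolding norm_mult by (intro mult_mono e1 near z) auto
    finally show ?thesis by simp
  qed
  have "norm ((LINT u|distr M (borel \<Otimes>\<^sub>M borel) U. LINT x|distr M borel (V i). f (u, x)) - (LINT u|distr M (borel \<Otimes>\<^sub>M borel) U. G u)) =
    norm (LINT u|distr M (borel \<Otimes>\<^sub>M borel) U. (LINT x|distr M borel (V i). f (u, x)) - G u)"
    using P.integrable_fst'[OF fint] Gint by simp
  also have "\<dots> \<le> (LINT u|distr M (borel \<Otimes>\<^sub>M borel) U. norm ((LINT x|distr M borel (V i). f (u, x)) - G u))"
    by (rule integral_norm_bound)
  also have "\<dots> \<le> \<epsilon>"
    by (rule DU.integral_le_const) (use inner P.integrable_fst'[OF fint] Gint in auto)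
  finally have "norm ((LINT \<omega>|M. exp (\<zeta> * of_real (scheme c (Suc i) (\<lambda>j. V j \<omega>))) * phi (\<zeta> * of_real (c powr (- level (Suc i) (\<lambda>j. V j \<omega>))))) -
     (LINT \<omega>|M. exp (\<zeta> * of_real (scheme c i (\<lambda>j. V j \<omega>))) * phi (\<zeta> * of_real (c powr (- level i (\<lambda>j. V j \<omega>)))))) \<le> \<epsilon>"
    unfolding E1 E0 .
  moreover have "norm ((LINT \<omega>|M. exp (\<zeta> * of_real (scheme c i (\<lambda>j. V j \<omega>))) * phi (\<zeta> * of_real (c powr (- level i (\<lambda>j. V j \<omega>))))) - phi \<zeta>) \<le> real i * \<epsilon>"
    using Suc by simp
  moreover have "norm (a - d) \<le> real (Suc i) * \<epsilon>" if "norm (a - b) \<le> \<epsilon>" "norm (b - d) \<le> real i * \<epsilon>" for a b d :: complex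
    using norm_triangle_ineq[of "a - b" "b - d"] that by (simp add: algebra_simps)
  ultimately show ?case by blast
qed

section \<open>Riemann sums along the process\<close>

context ou_process
begin

definition good :: "'a \<Rightarrow> bool" where
  "good \<omega> \<longleftrightarrow> N 0 \<omega> = 0 \<and> L 0 \<omega> = 0 \<and>
     (\<forall>s t. 0 \<le> s \<longrightarrow> s \<le> t \<longrightarrow> N s \<omega> \<le> N t \<omega> \<and> L s \<omega> \<le> L t \<omega>) \<and>
     increasing_paths c (\<lambda>s. N s \<omega>) (\<lambda>s. L s \<omega>)"

text \<open>Each of the countably many pairs of rational times has its increment in the quadrant
  almost surely; right continuity extends monotonicity to all real times.\<close>

lemma AE_good: "AE \<omega> in M. good \<omega>"
proof -
  have zero: "AE \<omega> in M. X 0 \<omega> = 0" using levy unfolding levy_process_def by (elim conjE)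
  have cadlag: "AE \<omega> in M. \<forall>t\<ge>0. continuous (at_right t) (\<lambda>s. X s \<omega>) \<and>
     (t > 0 \<longrightarrow> (\<exists>x. ((\<lambda>s. X s \<omega>) \<longlongrightarrow> x) (at_left t)))"
    using levy unfolding levy_process_def by (elim conjE)
  have inc: "AE \<omega> in M. \<forall>p \<in> {(s, t) \<in> \<rat> \<times> \<rat>. 0 \<le> s \<and> s < t}. X (snd p) \<omega> - X (fst p) \<omega> \<in> quadrant"
  proof (subst AE_ball_countable)
    show "countable {(s :: real, t) \<in> \<rat> \<times> \<rat>. 0 \<le> s \<and> s < t}"
      by (rule countable_subset[of _ "\<rat> \<times> \<rat>"]) (auto intro: countable_rat)
    show "\<forall>p \<in> {(s, t) \<in> \<rat> \<times> \<rat>. 0 \<le> s \<and> s < t}. AE \<omega> in M. X (snd p) \<omega> - X (fst p) \<omega> \<in> quadrant"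
    proof
      fix p :: "real \<times> real" assume "p \<in> {(s, t) \<in> \<rat> \<times> \<rat>. 0 \<le> s \<and> s < t}"
      thus "AE \<omega> in M. X (snd p) \<omega> - X (fst p) \<omega> \<in> quadrant" by (intro increment_AE_quadrant) auto
    qed
  qed
  from zero cadlag inc show ?thesis
  proof eventually_elim
    case (elim \<omega>)
    have z: "N 0 \<omega> = 0" "L 0 \<omega> = 0" using elim(1) by (auto simp: zero_prod_def)
    have rc: "continuous (at_right t) (\<lambda>s. N s \<omega>)" "continuous (at_right t) (\<lambda>s. L s \<omega>)" if "t \<ge> 0" for t
    proof -
      have "continuous (at_right t) (\<lambda>s. X s \<omega>)" using elim(2) that by blast
      from continuous_fst[OF this] continuous_snd[OF this]
      show "continuous (at_right t) (\<lambda>s. N s \<omega>)" "continuous (at_right t) (\<lambda>s. L s \<omega>)" by simp_all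
    qed
    have q: "N s \<omega> \<le> N t \<omega>" "L s \<omega> \<le> L t \<omega>" if "s \<in> \<rat>" "t \<in> \<rat>" "0 \<le> s" "s < t" for s t
      using elim(3)[rule_format, of "(s, t)"] that by (auto simp: quadrant_def)
    have mono: "N s \<omega> \<le> N t \<omega>" "L s \<omega> \<le> L t \<omega>" if "0 \<le> s" "s \<le> t" for s t
      by (rule right_continuous_mono_extend[of "\<lambda>s. N s \<omega>"]; use q rc that in blast)
        (rule right_continuous_mono_extend[of "\<lambda>s. L s \<omega>"]; use q rc that in blast)
    have "increasing_paths c (\<lambda>s. N s \<omega>) (\<lambda>s. L s \<omega>)"
    proof
      show "c > 1" by (rule c1)
      show "N s \<omega> \<ge> 0" if "s \<ge> 0" for s using mono(1)[of 0 s] that z by simp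
      show "\<exists>x. ((\<lambda>s. N s \<omega>) \<longlongrightarrow> x) (at_left t)" if t: "t > 0" for t
      proof -
        obtain x where "((\<lambda>s. X s \<omega>) \<longlongrightarrow> x) (at_left t)" using elim(2) t by (meson less_imp_le)
        from tendsto_fst[OF this] show ?thesis by auto
      qed
    qed (use mono rc in auto)
    thus ?case unfolding good_def using z mono by blast
  qed
qed

definition increments :: "real \<Rightarrow> nat \<Rightarrow> nat \<Rightarrow> 'a \<Rightarrow> real \<times> real" where
  "increments T k j \<omega> = X (real (Suc j) * (T / real k)) \<omega> - X (real j * (T / real k)) \<omega>"

lemma increments_measurable: "T > 0 \<Longrightarrow> increments T k j \<in> borel_measurable M"
  unfolding increments_def[abs_def] by (intro borel_measurable_diff X_measurable) auto

lemma increments_good: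
  assumes "good \<omega>" "T > 0" "k > 0"
  shows "j \<le> k \<Longrightarrow> level j (\<lambda>j. increments T k j \<omega>) = N (real j * (T / real k)) \<omega>"
    "scheme c k (\<lambda>j. increments T k j \<omega>) = riemann_sum c (\<lambda>s. N s \<omega>) (\<lambda>s. L s \<omega>) T k"
    "level k (\<lambda>j. increments T k j \<omega>) = N T \<omega>"
proof -
  have inc: "max 0 (fst (increments T k j \<omega>)) = N (real (Suc j) * (T / real k)) \<omega> - N (real j * (T / real k)) \<omega>"
    "max 0 (snd (increments T k j \<omega>)) = L (real (Suc j) * (T / real k)) \<omega> - L (real j * (T / real k)) \<omega>" for j
  proof -
    have "real j * (T / real k) \<le> real (Suc j) * (T / real k)" using assms by (intro mult_right_mono) auto
    moreover have "0 \<le> real j * (T / real k)" using assms by simp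
    ultimately have "N (real j * (T / real k)) \<omega> \<le> N (real (Suc j) * (T / real k)) \<omega>" "L (real j * (T / real k)) \<omega> \<le> L (real (Suc j) * (T / real k)) \<omega>"
      using assms(1) unfolding good_def by blast+
    thus "max 0 (fst (increments T k j \<omega>)) = N (real (Suc j) * (T / real k)) \<omega> - N (real j * (T / real k)) \<omega>"
      "max 0 (snd (increments T k j \<omega>)) = L (real (Suc j) * (T / real k)) \<omega> - L (real j * (T / real k)) \<omega>"
      unfolding increments_def by simp_all
  qed
  have lev: "level j (\<lambda>j. increments T k j \<omega>) = N (real j * (T / real k)) \<omega>" for j
    unfolding level_def inc
    using sum_lessThan_telescope[of "\<lambda>j. N (real j * (T / real k)) \<omega>" j] assms(1) by (simp add: good_def)
  thus "level j (\<lambda>j. increments T k j \<omega>) = N (real j * (T / real k)) \<omega>" .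
  show "scheme c k (\<lambda>j. increments T k j \<omega>) = riemann_sum c (\<lambda>s. N s \<omega>) (\<lambda>s. L s \<omega>) T k"
    unfolding scheme_def riemann_sum_def inc lev ..
  show "level k (\<lambda>j. increments T k j \<omega>) = N T \<omega>" using lev[of k] assms(3) by simp
qed

text \<open>The integral up to T as a limit of functions of finitely many increments: this version
  is measurable in \<omega> by construction and agrees with the path integral on good paths.\<close>

definition Y :: "real \<Rightarrow> 'a \<Rightarrow> real" where
  "Y T \<omega> = lim (\<lambda>k. scheme c (Suc k) (\<lambda>j. increments T (Suc k) j \<omega>))"

lemma Y_measurable:
  assumes "T > 0"
  shows "Y T \<in> borel_measurable M"
  unfolding Y_def[abs_def]
  by (rule borel_measurable_lim_metric, rule scheme_measurable, rule increments_measurable, rule assms)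

lemma Y_good:
  assumes "good \<omega>" "T > 0"
  shows "(\<lambda>k. scheme c (Suc k) (\<lambda>j. increments T (Suc k) j \<omega>)) \<longlonglongrightarrow> Y T \<omega>"
    "Y T \<omega> = path_integral c (\<lambda>s. N s \<omega>) (\<lambda>s. L s \<omega>) T"
proof -
  interpret increasing_paths c "\<lambda>s. N s \<omega>" "\<lambda>s. L s \<omega>" using assms(1) by (simp add: good_def)
  have *: "(\<lambda>k. scheme c (Suc k) (\<lambda>j. increments T (Suc k) j \<omega>)) \<longlonglongrightarrow> path_integral c (\<lambda>s. N s \<omega>) (\<lambda>s. L s \<omega>) T"
    using riemann_sum_tendsto(2)[OF assms(2)] increments_good(2)[OF assms] by simp
  thus "Y T \<omega> = path_integral c (\<lambda>s. N s \<omega>) (\<lambda>s. L s \<omega>) T" unfolding Y_def by (rule limI)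
  thus "(\<lambda>k. scheme c (Suc k) (\<lambda>j. increments T (Suc k) j \<omega>)) \<longlonglongrightarrow> Y T \<omega>" using * by simp
qed

lemma Y_nonneg: "good \<omega> \<Longrightarrow> T > 0 \<Longrightarrow> Y T \<omega> \<ge> 0"
  using Y_good(2) increasing_paths.path_integral_nonneg[of c "\<lambda>s. N s \<omega>" "\<lambda>s. L s \<omega>" T] by (simp add: good_def)

lemma norm_exp_mult_le_1: "Re \<zeta> \<le> 0 \<Longrightarrow> x \<ge> 0 \<Longrightarrow> norm (exp (\<zeta> * of_real x)) \<le> 1"
  using Re_mult_le_0[of \<zeta> x] by simp

lemma norm_phi_mult_le_1: "Re \<zeta> \<le> 0 \<Longrightarrow> x \<ge> 0 \<Longrightarrow> norm (phi (\<zeta> * of_real x)) \<le> 1"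
  using norm_phi_le_1[OF Re_mult_le_0[of \<zeta> x]] by simp

lemma phi_powr_measurable:
  assumes "Re \<zeta> \<le> 0" "f \<in> borel_measurable M"
  shows "(\<lambda>\<omega>. phi (\<zeta> * of_real (c powr (- f \<omega>)))) \<in> borel_measurable M"
proof (rule phi_measurable)
  show "(\<lambda>\<omega>. \<zeta> * of_real (c powr (- f \<omega>))) \<in> borel_measurable M" using assms(2) by measurable
qed (rule Re_mult_le_0[OF assms(1)], simp)

text \<open>Each of the \<open>k\<close> steps of length \<open>T / k\<close> contributes an error of order \<open>k ^ -2\<close>.\<close>

lemma expectation_exp_Y_phi:
  assumes T: "T > 0" and \<zeta>: "Re \<zeta> \<le> 0"
  shows "(LINT \<omega>|M. exp (\<zeta> * of_real (Y T \<omega>)) * phi (\<zeta> * of_real (c powr (- N T \<omega>)))) = phi \<zeta>"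
proof (rule LIMSEQ_unique)
  let ?S = "\<lambda>k \<omega>. scheme c (Suc k) (\<lambda>j. increments T (Suc k) j \<omega>)"
  let ?A = "\<lambda>k \<omega>. level (Suc k) (\<lambda>j. increments T (Suc k) j \<omega>)"
  let ?E = "\<lambda>k. LINT \<omega>|M. exp (\<zeta> * of_real (?S k \<omega>)) * phi (\<zeta> * of_real (c powr (- ?A k \<omega>)))"
  have Sm: "?S k \<in> borel_measurable M" and Am: "?A k \<in> borel_measurable M" for k
    by (intro scheme_measurable level_measurable increments_measurable T)+
  show "?E \<longlonglongrightarrow> (LINT \<omega>|M. exp (\<zeta> * of_real (Y T \<omega>)) * phi (\<zeta> * of_real (c powr (- N T \<omega>))))"
  proof (rule integral_dominated_convergence[where w = "\<lambda>_. 1"])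
    have [measurable]: "Y T \<in> borel_measurable M" "N T \<in> borel_measurable M"
      using Y_measurable[OF T] T by simp_all
    show "(\<lambda>\<omega>. exp (\<zeta> * of_real (Y T \<omega>)) * phi (\<zeta> * of_real (c powr (- N T \<omega>)))) \<in> borel_measurable M"
      by (rule borel_measurable_times[OF _ phi_powr_measurable[OF \<zeta>]]) measurable
    show "(\<lambda>\<omega>. exp (\<zeta> * of_real (?S k \<omega>)) * phi (\<zeta> * of_real (c powr (- ?A k \<omega>)))) \<in> borel_measurable M" for k
      by (rule borel_measurable_times[OF _ phi_powr_measurable[OF \<zeta> Am]]) (use Sm in measurable)
    show "AE \<omega> in M. (\<lambda>k. exp (\<zeta> * of_real (?S k \<omega>)) * phi (\<zeta> * of_real (c powr (- ?A k \<omega>))))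
      \<longlonglongrightarrow> exp (\<zeta> * of_real (Y T \<omega>)) * phi (\<zeta> * of_real (c powr (- N T \<omega>)))"
      using AE_good
    proof eventually_elim
      case (elim \<omega>)
      have "?A k \<omega> = N T \<omega>" for k by (rule increments_good(3)[OF elim T]) simp
      thus ?case by (auto intro!: tendsto_intros Y_good[OF elim T])
    qed
    show "AE \<omega> in M. norm (exp (\<zeta> * of_real (?S k \<omega>)) * phi (\<zeta> * of_real (c powr (- ?A k \<omega>)))) \<le> 1" for k
    proof (rule AE_I2)
      fix \<omega>
      have "norm (exp (\<zeta> * of_real (?S k \<omega>)) * phi (\<zeta> * of_real (c powr (- ?A k \<omega>)))) \<le> 1 * 1"
        unfolding norm_mult by (intro mult_mono norm_exp_mult_le_1 norm_phi_mult_le_1 \<zeta> scheme_nonneg) auto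
      thus "norm (exp (\<zeta> * of_real (?S k \<omega>)) * phi (\<zeta> * of_real (c powr (- ?A k \<omega>)))) \<le> 1" by simp
    qed
  qed simp
  have bd: "norm (?E k - phi \<zeta>) \<le> 2 * (lam * T)\<^sup>2 * inverse (real (Suc k))" for k
  proof -
    define h where "h = T / real (Suc k)"
    have h: "h > 0" using T by (simp add: h_def)
    have "norm (?E k - phi \<zeta>) \<le> real (Suc k) * (2 * (lam * h)\<^sup>2)"
    proof (rule scheme_expectation[where \<pi> = "compound_poisson_pmf (lam * h) Q" and k = "Suc k"])
      show "prob_space M" by (rule prob_space_axioms)
      have indep: "\<forall>(n::nat) t. 0 \<le> t 0 \<and> strict_mono_on {..n} t \<longrightarrow>
        indep_vars (\<lambda>_. borel) (\<lambda>i \<omega>. X (t (Suc i)) \<omega> - X (t i) \<omega>) {..<n}"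
        using levy unfolding levy_process_def by (elim conjE)
      have "strict_mono_on {..Suc k} (\<lambda>i. real i * h)"
        using h by (intro strict_mono_onI) simp
      with indep[rule_format, of "\<lambda>i. real i * h" "Suc k"]
      show "indep_vars (\<lambda>_. borel) (\<lambda>j. increments T (Suc k) j) {..<Suc k}"
        by (simp add: increments_def[abs_def] h_def)
      fix i
      show "distr M borel (increments T (Suc k) i) = distr (measure_pmf (compound_poisson_pmf (lam * h) Q)) borel (\<lambda>x. x)"
      proof -
        have "0 \<le> real i * h" "real i * h < real (Suc i) * h" using h by (auto simp: algebra_simps)
        from increment_law[OF this]
        have "distr M borel (\<lambda>\<omega>. X (real (Suc i) * h) \<omega> - X (real i * h) \<omega>) =
          distr (measure_pmf (compound_poisson_pmf (lam * (real (Suc i) * h - real i * h)) Q)) borel (\<lambda>x. x)" .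
        moreover have "real (Suc i) * h - real i * h = h" by (simp add: algebra_simps)
        ultimately show ?thesis by (simp only: increments_def[abs_def] h_def[symmetric])
      qed
    next
      show "set_pmf (compound_poisson_pmf (lam * h) Q) \<subseteq> {0..} \<times> {0..}"
        unfolding quadrant_def[symmetric] by (rule set_compound_poisson_pmf[OF quadrant])
      show "norm ((LINT x|measure_pmf (compound_poisson_pmf (lam * h) Q). exp (\<zeta> * of_real (snd x)) * phi (\<zeta> * of_real (c powr (- fst x)))) - phi \<zeta>)
        \<le> 2 * (lam * h)\<^sup>2" if "Re \<zeta> \<le> 0" for \<zeta>
        by (rule integral_near_phi[OF h that])
    qed (use \<zeta> in auto)
    also have "\<dots> = 2 * (lam * T)\<^sup>2 * inverse (real (Suc k))"
      unfolding h_def by (simp add: power_divide power_mult_distrib power2_eq_square divide_inverse del: of_nat_Suc)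
    finally show ?thesis .
  qed
  have "(\<lambda>k. 2 * (lam * T)\<^sup>2 * inverse (real (Suc k))) \<longlonglongrightarrow> 0"
    by (intro tendsto_mult_right_zero LIMSEQ_inverse_real_of_nat)
  from Lim_null_comparison[OF always_eventually[OF allI[OF bd]] this]
  show "?E \<longlonglongrightarrow> phi \<zeta>" by (rule LIM_zero_cancel)
qed

text \<open>c powr (- x) is multiplicative and bounded on the quadrant, so the compound Poisson
  formula applies: jumps with first coordinate 1 come at rate u + w and each multiplies by 1 / c.
  The exponential decay replaces a pathwise statement that N tends to infinity.\<close>

lemma expectation_powr_N:
  assumes T: "T > 0"
  shows "(LINT \<omega>|M. c powr (- N T \<omega>)) \<le> exp (- (T * (u + w) * (1 - 1 / c)))"
    "integrable M (\<lambda>\<omega>. c powr (- N T \<omega>))"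
proof -
  have Nm[measurable]: "N T \<in> borel_measurable M" using T by simp
  have "AE \<omega> in M. norm (c powr (- N T \<omega>)) \<le> 1"
    using AE_good
  proof eventually_elim
    case (elim \<omega>)
    hence "N 0 \<omega> \<le> N T \<omega>" "N 0 \<omega> = 0" using T unfolding good_def by (blast intro: less_imp_le)+
    hence "c powr (- N T \<omega>) \<le> c powr 0" using c1 by (intro powr_mono) auto
    thus ?case using c1 by simp
  qed
  thus "integrable M (\<lambda>\<omega>. c powr (- N T \<omega>))" by (intro integrable_const_bound[where B = 1]) auto
  define f where "f x = complex_of_real (c powr (- fst x))" for x :: "real \<times> real"
  have fm: "f \<in> borel_measurable borel" unfolding f_def by measurable
  have "complex_of_real (LINT \<omega>|M. c powr (- N T \<omega>)) = (LINT \<omega>|M. f (X T \<omega>))"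
    by (simp add: f_def)
  also have "\<dots> = (LINT x|distr M borel (X T). f x)"
    using T fm by (subst integral_distr) auto
  also have "\<dots> = (LINT x|measure_pmf (compound_poisson_pmf (lam * T) Q). f x)"
    unfolding X_law[OF T] using fm by (subst integral_distr) auto
  also have "\<dots> = exp (of_real (lam * T) * ((LINT x|measure_pmf Q. f x) - 1))"
  proof (rule integral_compound_poisson_pmf_mult[OF quadrant])
    show "norm (f x) \<le> 1" if "x \<in> quadrant" for x
    proof -
      have "c powr (- fst x) \<le> c powr 0" using c1 that by (intro powr_mono) (auto simp: quadrant_def)
      thus ?thesis using c1 by (simp add: f_def)
    qed
    show "f 0 = 1" using c1 by (simp add: f_def)
    show "f (a + b) = f a * f b" for a b by (simp add: f_def flip: powr_add of_real_mult)
    show "lam * T > 0" using lam T by (rule mult_pos_pos)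
  qed
  also have "(LINT x|measure_pmf Q. f x) = of_real ((u / c + v + w / c) / lam)"
    unfolding Q_integral using c1 by (simp add: f_def powr_minus_divide)
  also have "of_real (lam * T) * (complex_of_real ((u / c + v + w / c) / lam) - 1) = of_real (- (T * (u + w) * (1 - 1 / c)))"
  proof -
    have "lam * T * ((u / c + v + w / c) / lam - 1) = T * ((u / c + v + w / c) - lam)"
    proof -
      have gen: "a * T * (x / a - 1) = T * (x - a)" if "a \<noteq> 0" for a x :: real using that by (simp add: field_simps)
      show ?thesis by (rule gen) (rule less_imp_neq[OF lam, symmetric])
    qed
    also have "\<dots> = - (T * (u + w) * (1 - 1 / c))" by (simp add: algebra_simps add_divide_distrib)
    finally have "lam * T * ((u / c + v + w / c) / lam - 1) = - (T * (u + w) * (1 - 1 / c))" .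
    moreover have "of_real A * (complex_of_real B - 1) = of_real (A * (B - 1))" for A B :: real by simp
    ultimately show ?thesis by metis
  qed
  also have "exp (complex_of_real (- (T * (u + w) * (1 - 1 / c)))) = complex_of_real (exp (- (T * (u + w) * (1 - 1 / c))))"
    by (rule exp_of_real)
  finally show "(LINT \<omega>|M. c powr (- N T \<omega>)) \<le> exp (- (T * (u + w) * (1 - 1 / c)))"
    by (simp only: of_real_eq_iff order_refl)
qed

text \<open>In the exact identity at time T the factor phi (\<zeta> c^(-N_T)) differs from 1 by at
  most K |\<zeta>| c^(-N_T), whose mean decays exponentially in T.\<close>

lemma expectation_exp_Y_tendsto:
  assumes \<zeta>: "Re \<zeta> \<le> 0"
  shows "(\<lambda>m. LINT \<omega>|M. exp (\<zeta> * of_real (Y (real (Suc m)) \<omega>))) \<longlonglongrightarrow> phi \<zeta>"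
proof -
  define a where "a = (u + w) * (1 - 1 / c)"
  have a: "a > 0" using uvw c1 by (auto simp: a_def intro!: mult_pos_pos)
  have "norm ((LINT \<omega>|M. exp (\<zeta> * of_real (Y T \<omega>))) - phi \<zeta>) \<le> K * norm \<zeta> * exp (- (T * a))" if T: "T > 0" for T
  proof -
    have Ym[measurable]: "Y T \<in> borel_measurable M" by (rule Y_measurable[OF T])
    have Nm[measurable]: "N T \<in> borel_measurable M" using T by simp
    let ?p = "\<lambda>\<omega>. phi (\<zeta> * of_real (c powr (- N T \<omega>)))"
    have pm[measurable]: "?p \<in> borel_measurable M" by (rule phi_powr_measurable[OF \<zeta> Nm])
    have e1: "AE \<omega> in M. norm (exp (\<zeta> * of_real (Y T \<omega>))) \<le> 1"
      using AE_good by eventually_elim (intro norm_exp_mult_le_1 \<zeta> Y_nonneg T)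
    have p1: "norm (?p \<omega>) \<le> 1" for \<omega> by (rule norm_phi_mult_le_1[OF \<zeta>]) simp
    have i1: "integrable M (\<lambda>\<omega>. exp (\<zeta> * of_real (Y T \<omega>)))"
      by (rule integrable_const_bound[where B = 1, OF e1]) measurable
    have "AE \<omega> in M. norm (exp (\<zeta> * of_real (Y T \<omega>)) * ?p \<omega>) \<le> 1"
      using e1
    proof eventually_elim
      case (elim \<omega>)
      have "norm (exp (\<zeta> * of_real (Y T \<omega>)) * ?p \<omega>) \<le> 1 * 1"
        unfolding norm_mult by (rule mult_mono[OF elim p1]) auto
      thus ?case by simp
    qed
    hence i2: "integrable M (\<lambda>\<omega>. exp (\<zeta> * of_real (Y T \<omega>)) * ?p \<omega>)"
      by (rule integrable_const_bound[where B = 1]) measurable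
    have eq: "(LINT \<omega>|M. exp (\<zeta> * of_real (Y T \<omega>))) - phi \<zeta> = (LINT \<omega>|M. exp (\<zeta> * of_real (Y T \<omega>)) - exp (\<zeta> * of_real (Y T \<omega>)) * ?p \<omega>)"
      using expectation_exp_Y_phi[OF T \<zeta>] Bochner_Integration.integral_diff[OF i1 i2] by simp
    have "norm ((LINT \<omega>|M. exp (\<zeta> * of_real (Y T \<omega>))) - phi \<zeta>) \<le> (LINT \<omega>|M. norm (exp (\<zeta> * of_real (Y T \<omega>)) - exp (\<zeta> * of_real (Y T \<omega>)) * ?p \<omega>))"
      unfolding eq by (rule integral_norm_bound)
    also have "\<dots> \<le> (LINT \<omega>|M. K * norm \<zeta> * (c powr (- N T \<omega>)))"
    proof -
      have 1: "integrable M (\<lambda>\<omega>. norm (exp (\<zeta> * of_real (Y T \<omega>)) - exp (\<zeta> * of_real (Y T \<omega>)) * ?p \<omega>))"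
        by (rule integrable_norm, rule Bochner_Integration.integrable_diff[OF i1 i2])
      have 2: "integrable M (\<lambda>\<omega>. K * norm \<zeta> * (c powr (- N T \<omega>)))"
        by (rule integrable_mult_right, rule expectation_powr_N(2)[OF T])
      have 3: "AE \<omega> in M. norm (exp (\<zeta> * of_real (Y T \<omega>)) - exp (\<zeta> * of_real (Y T \<omega>)) * ?p \<omega>) \<le> K * norm \<zeta> * (c powr (- N T \<omega>))"
        using e1
      proof eventually_elim
        case (elim \<omega>)
        have "norm (?p \<omega> - 1) \<le> K * norm (\<zeta> * of_real (c powr (- N T \<omega>)))"
          by (rule norm_phi_minus_1_le[OF Re_mult_le_0[OF \<zeta>]]) simp
        hence "norm (1 - ?p \<omega>) \<le> K * norm \<zeta> * (c powr (- N T \<omega>))" by (simp add: norm_mult norm_minus_commute)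
        hence "norm (exp (\<zeta> * of_real (Y T \<omega>))) * norm (1 - ?p \<omega>) \<le> 1 * (K * norm \<zeta> * (c powr (- N T \<omega>)))"
          using elim by (intro mult_mono) auto
        moreover have "exp (\<zeta> * of_real (Y T \<omega>)) - exp (\<zeta> * of_real (Y T \<omega>)) * ?p \<omega> = exp (\<zeta> * of_real (Y T \<omega>)) * (1 - ?p \<omega>)"
          by (simp add: right_diff_distrib)
        ultimately show ?case by (simp only: norm_mult mult_1)
      qed
      show ?thesis by (rule integral_mono_AE[OF 1 2 3])
    qed
    also have "\<dots> = K * norm \<zeta> * (LINT \<omega>|M. c powr (- N T \<omega>))" by simp
    also have "\<dots> \<le> K * norm \<zeta> * exp (- (T * a))"
    proof (rule mult_left_mono)
      show "(LINT \<omega>|M. c powr (- N T \<omega>)) \<le> exp (- (T * a))"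
        using expectation_powr_N(1)[OF T] by (simp add: a_def mult.assoc)
      show "0 \<le> K * norm \<zeta>" using norm_phi_minus_1_le[OF \<zeta>] norm_ge_zero order_trans by blast
    qed
    finally show ?thesis .
  qed
  note bd = this[OF of_nat_0_less_iff[THEN iffD2, OF zero_less_Suc]]
  have "(\<lambda>m. K * norm \<zeta> * exp (- (real (Suc m) * a))) \<longlonglongrightarrow> 0"
  proof (rule tendsto_mult_right_zero)
    have "(\<lambda>m. exp (- a) ^ Suc m) \<longlonglongrightarrow> 0" using a by (intro LIMSEQ_Suc LIMSEQ_realpow_zero) auto
    moreover have "exp (- a) ^ Suc m = exp (- (real (Suc m) * a))" for m
      by (simp only: exp_of_nat_mult[symmetric] mult_minus_right)
    ultimately show "(\<lambda>m. exp (- (real (Suc m) * a))) \<longlonglongrightarrow> 0" by (simp only:)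
  qed
  from Lim_null_comparison[OF always_eventually[OF allI[OF bd]] this]
  show ?thesis by (rule LIM_zero_cancel)
qed

section \<open>The limit at infinite time\<close>

text \<open>With values in [0, \<infinity>] the supremum exists and is measurable without any
  convergence statement; finiteness is proved afterwards.\<close>

definition Z :: "'a \<Rightarrow> ennreal" where "Z \<omega> = (SUP m. ennreal (Y (real (Suc m)) \<omega>))"

lemma Z_measurable [measurable]: "Z \<in> borel_measurable M"
  unfolding Z_def[abs_def]
proof (rule borel_measurable_SUP)
  fix m
  have [measurable]: "Y (real (Suc m)) \<in> borel_measurable M" by (rule Y_measurable) simp
  show "(\<lambda>\<omega>. ennreal (Y (real (Suc m)) \<omega>)) \<in> borel_measurable M" by measurable
qed simp

lemma Y_tendsto_Z:
  assumes good: "good \<omega>"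
  shows "(\<lambda>m. ennreal (Y (real (Suc m)) \<omega>)) \<longlonglongrightarrow> Z \<omega>"
  unfolding Z_def
proof (rule LIMSEQ_SUP)
  interpret increasing_paths c "\<lambda>s. N s \<omega>" "\<lambda>s. L s \<omega>" using good by (simp add: good_def)
  show "incseq (\<lambda>m. ennreal (Y (real (Suc m)) \<omega>))"
    unfolding incseq_def
  proof (intro allI impI ennreal_leI)
    fix m n :: nat assume "m \<le> n"
    thus "Y (real (Suc m)) \<omega> \<le> Y (real (Suc n)) \<omega>"
      using Y_good(2)[OF good, of "real (Suc m)"] Y_good(2)[OF good, of "real (Suc n)"]
        path_integral_mono[of "real (Suc m)" "real (Suc n)"] by simp
  qed
qed

lemma Y_tendsto_finite:
  assumes good: "good \<omega>" and fin: "Z \<omega> < \<infinity>"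
  shows "(\<lambda>m. Y (real (Suc m)) \<omega>) \<longlonglongrightarrow> enn2real (Z \<omega>)"
proof -
  have "ennreal (enn2real (Z \<omega>)) = Z \<omega>" using fin by simp
  hence "(\<lambda>m. ennreal (Y (real (Suc m)) \<omega>)) \<longlonglongrightarrow> ennreal (enn2real (Z \<omega>))"
    using Y_tendsto_Z[OF good] by simp
  thus ?thesis
    by (subst (asm) tendsto_ennreal_iff) (auto intro!: always_eventually Y_nonneg good)
qed

lemma exp_Y_tendsto:
  assumes good: "good \<omega>" and s: "s > 0"
  shows "(\<lambda>m. exp (- s * Y (real (Suc m)) \<omega>)) \<longlonglongrightarrow> (if Z \<omega> < \<infinity> then exp (- s * enn2real (Z \<omega>)) else 0)"
proof (cases "Z \<omega> < \<infinity>")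
  case True
  thus ?thesis using Y_tendsto_finite[OF good True] by (auto intro!: tendsto_intros)
next
  case False
  hence "Z \<omega> = \<infinity>" by (metis infinity_ennreal_def top.not_eq_extremum)
  hence top: "(\<lambda>m. ennreal (Y (real (Suc m)) \<omega>)) \<longlonglongrightarrow> \<infinity>" using Y_tendsto_Z[OF good] by simp
  have "filterlim (\<lambda>m. Y (real (Suc m)) \<omega>) at_top sequentially"
    unfolding filterlim_at_top
  proof
    fix b
    have "\<forall>\<^sub>F m in sequentially. ennreal b < ennreal (Y (real (Suc m)) \<omega>)"
      using order_tendstoD(1)[OF top, of "ennreal b"] by simp
    thus "\<forall>\<^sub>F m in sequentially. b \<le> Y (real (Suc m)) \<omega>"
    proof eventually_elim
      case (elim m)
      thus ?case by (meson ennreal_leI leD linorder_le_cases)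
    qed
  qed
  hence "filterlim (\<lambda>m. s * Y (real (Suc m)) \<omega>) at_top sequentially"
    by (intro filterlim_tendsto_pos_mult_at_top[OF tendsto_const s])
  hence "filterlim (\<lambda>m. - (s * Y (real (Suc m)) \<omega>)) at_bot sequentially"
    by (simp add: filterlim_uminus_at_top)
  hence "(\<lambda>m. exp (- (s * Y (real (Suc m)) \<omega>))) \<longlonglongrightarrow> 0"
    by (rule filterlim_compose[OF exp_at_bot])
  thus ?thesis using False by simp
qed

text \<open>Monotone limits exist in \<open>[0, \<infinity>]\<close>; letting \<open>s\<close> tend to \<open>0\<close> in the Laplace transform excludes \<open>\<infinity>\<close>.\<close>

lemma AE_Z_finite: "AE \<omega> in M. Z \<omega> < \<infinity>"
proof -
  define p where "p = prob {\<omega> \<in> space M. Z \<omega> < \<infinity>}"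
  have ge: "1 - K * s \<le> p" if s: "s > 0" for s
  proof -
    \<comment> \<open>The limit of exp (- s Y), with value 0 where Z is infinite; its mean phi (- s)
      is therefore at most p.\<close>
    define G where "G \<omega> = (if Z \<omega> < \<infinity> then exp (- s * enn2real (Z \<omega>)) else 0)" for \<omega>
    have G01: "0 \<le> G \<omega>" "G \<omega> \<le> indicator {\<omega> \<in> space M. Z \<omega> < \<infinity>} \<omega>" if "\<omega> \<in> space M" for \<omega>
      using s that by (auto simp: G_def indicator_def)
    have Gm[measurable]: "G \<in> borel_measurable M" unfolding G_def[abs_def] by measurable
    have Ym[measurable]: "Y (real (Suc m)) \<in> borel_measurable M" for m by (rule Y_measurable) simp
    have l1: "(\<lambda>m. LINT \<omega>|M. complex_of_real (exp (- s * Y (real (Suc m)) \<omega>))) \<longlonglongrightarrow> (LINT \<omega>|M. complex_of_real (G \<omega>))"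
    proof (rule integral_dominated_convergence[where w = "\<lambda>_. 1"])
      show "AE \<omega> in M. (\<lambda>m. complex_of_real (exp (- s * Y (real (Suc m)) \<omega>))) \<longlonglongrightarrow> complex_of_real (G \<omega>)"
        using AE_good
      proof eventually_elim
        case (elim \<omega>)
        from tendsto_of_real[OF exp_Y_tendsto[OF elim s]] show ?case unfolding G_def .
      qed
      show "AE \<omega> in M. norm (complex_of_real (exp (- s * Y (real (Suc m)) \<omega>))) \<le> 1" for m
        using AE_good
      proof eventually_elim
        case (elim \<omega>)
        have "Y (real (Suc m)) \<omega> \<ge> 0" by (rule Y_nonneg[OF elim]) simp
        thus ?case using s by simp
      qed
      show "(\<lambda>\<omega>. complex_of_real (G \<omega>)) \<in> borel_measurable M" by measurable
      show "(\<lambda>\<omega>. complex_of_real (exp (- s * Y (real (Suc m)) \<omega>))) \<in> borel_measurable M" for m by measurable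
    qed simp
    have ex: "exp (of_real (- s) * of_real y) = complex_of_real (exp (- s * y))" for y
      by (simp only: of_real_mult[symmetric] exp_of_real)
    have l2: "(\<lambda>m. LINT \<omega>|M. complex_of_real (exp (- s * Y (real (Suc m)) \<omega>))) \<longlonglongrightarrow> phi (of_real (- s))"
      using expectation_exp_Y_tendsto[of "of_real (- s)", unfolded ex] s by simp
    from LIMSEQ_unique[OF l2 l1] have eq: "phi (of_real (- s)) = complex_of_real (LINT \<omega>|M. G \<omega>)"
      by (simp only: integral_complex_of_real)
    have "(LINT \<omega>|M. G \<omega>) \<le> (LINT \<omega>|M. indicator {\<omega> \<in> space M. Z \<omega> < \<infinity>} \<omega>)"
    proof (rule integral_mono_AE)
      show "integrable M G"
      proof (rule integrable_const_bound[where B = 1])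
        show "AE \<omega> in M. norm (G \<omega>) \<le> 1"
        proof (rule AE_I2)
          fix \<omega> assume \<omega>: "\<omega> \<in> space M"
          show "norm (G \<omega>) \<le> 1"
            using G01(1)[OF \<omega>] order_trans[OF G01(2)[OF \<omega>] indicator_le_1] by simp
        qed
      qed (rule Gm)
      show "integrable M (indicator {\<omega> \<in> space M. Z \<omega> < \<infinity>} :: 'a \<Rightarrow> real)"
      proof (rule integrable_real_indicator)
        show "{\<omega> \<in> space M. Z \<omega> < \<infinity>} \<in> sets M" by measurable
      qed (simp add: emeasure_eq_measure)
    qed (use G01 in auto)
    also have "\<dots> = p" by (simp add: p_def)
    finally have "(LINT \<omega>|M. G \<omega>) \<le> p" .
    moreover have "norm (phi (of_real (- s)) - 1) \<le> K * s"
      using norm_phi_minus_1_le[of "of_real (- s)"] s by simp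
    moreover have "norm (phi (of_real (- s)) - 1) = \<bar>(LINT \<omega>|M. G \<omega>) - 1\<bar>"
    proof -
      have "phi (of_real (- s)) - 1 = complex_of_real ((LINT \<omega>|M. G \<omega>) - 1)" unfolding eq by simp
      thus ?thesis by (simp only: norm_of_real)
    qed
    ultimately show ?thesis by linarith
  qed
  have "p \<ge> 1"
  proof (rule tendsto_upperbound)
    have "((\<lambda>s. 1 - K * s) \<longlongrightarrow> 1 - K * 0) (at_right 0)" by (intro tendsto_intros)
    thus "((\<lambda>s. 1 - K * s) \<longlongrightarrow> 1) (at_right 0)" by simp
    show "\<forall>\<^sub>F s in at_right 0. 1 - K * s \<le> p"
      using eventually_at_right_less[of 0] by eventually_elim (rule ge)
  qed simp
  hence "p = 1" unfolding p_def by (intro antisym prob_le_1)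
  thus ?thesis unfolding p_def by (subst (asm) prob_Collect_eq_1) auto
qed

definition R :: "'a \<Rightarrow> real" where "R \<omega> = enn2real (Z \<omega>)"

lemma R_measurable [measurable]: "R \<in> borel_measurable M"
  unfolding R_def[abs_def] by measurable

lemma char_R: "char (distr M borel R) z = phi (\<i> * of_real z)"
proof (rule LIMSEQ_unique)
  have Ym[measurable]: "Y (real (Suc m)) \<in> borel_measurable M" for m by (rule Y_measurable) simp
  show "(\<lambda>m. LINT \<omega>|M. exp ((\<i> * of_real z) * of_real (Y (real (Suc m)) \<omega>))) \<longlonglongrightarrow> phi (\<i> * of_real z)"
    by (rule expectation_exp_Y_tendsto) simp
  have "(\<lambda>m. LINT \<omega>|M. exp ((\<i> * of_real z) * of_real (Y (real (Suc m)) \<omega>))) \<longlonglongrightarrow> (LINT \<omega>|M. exp ((\<i> * of_real z) * of_real (R \<omega>)))"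
  proof (rule integral_dominated_convergence[where w = "\<lambda>_. 1"])
    show "AE \<omega> in M. (\<lambda>m. exp ((\<i> * of_real z) * of_real (Y (real (Suc m)) \<omega>))) \<longlonglongrightarrow> exp ((\<i> * of_real z) * of_real (R \<omega>))"
      using AE_good AE_Z_finite
    proof eventually_elim
      case (elim \<omega>)
      from Y_tendsto_finite[OF elim] show ?case unfolding R_def by (intro tendsto_intros)
    qed
    show "(\<lambda>\<omega>. exp ((\<i> * of_real z) * of_real (R \<omega>))) \<in> borel_measurable M" by measurable
    show "(\<lambda>\<omega>. exp ((\<i> * of_real z) * of_real (Y (real (Suc m)) \<omega>))) \<in> borel_measurable M" for m by measurable
  qed auto
  also have "(LINT \<omega>|M. exp ((\<i> * of_real z) * of_real (R \<omega>))) = char (distr M borel R) z"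
    unfolding char_def by (subst integral_distr) (auto simp: mult.assoc)
  finally show "(\<lambda>m. LINT \<omega>|M. exp ((\<i> * of_real z) * of_real (Y (real (Suc m)) \<omega>))) \<longlonglongrightarrow> char (distr M borel R) z" .
qed

lemma AE_limit_eq_R: "AE \<omega> in M. Lim at_top (\<lambda>t. exp_integral_upto c N L t \<omega>) = R \<omega>"
  using AE_good AE_Z_finite
proof eventually_elim
  case (elim \<omega>)
  interpret increasing_paths c "\<lambda>s. N s \<omega>" "\<lambda>s. L s \<omega>" using elim(1) by (simp add: good_def)
  have "(\<lambda>m. path_integral c (\<lambda>s. N s \<omega>) (\<lambda>s. L s \<omega>) (real (Suc m))) \<longlonglongrightarrow> R \<omega>"
    using Y_tendsto_finite[OF elim] Y_good(2)[OF elim(1)] by (simp add: R_def)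
  hence "(path_integral c (\<lambda>s. N s \<omega>) (\<lambda>s. L s \<omega>) \<longlongrightarrow> R \<omega>) at_top" by (rule path_integral_tendsto_at_top)
  thus ?case unfolding exp_integral_upto_eq by (intro tendsto_Lim) auto
qed

theorem exp_integral_law_char:
  shows "real_distribution (exp_integral_law M c N L)"
    and "char (exp_integral_law M c N L) z = phi (\<i> * of_real z)"
proof -
  let ?f = "\<lambda>\<omega>. Lim at_top (\<lambda>t. exp_integral_upto c N L t \<omega>)"
  have ae: "AE \<omega> in completion M. ?f \<omega> = R \<omega>" by (rule AE_completion[OF AE_limit_eq_R])
  have Rm: "R \<in> borel_measurable (completion M)" by (rule measurable_completion[OF R_measurable])
  \<comment> \<open>The limit functional is only known to agree with R off a null set, so its
    preimages are measurable in the completed space.\<close>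
  have fm: "?f \<in> borel_measurable (completion M)"
  proof (rule measurableI)
    fix A :: "real set" assume A: "A \<in> sets borel"
    have "R -` A \<inter> space (completion M) \<in> sets (completion M)" using measurable_sets[OF Rm A] .
    moreover have "AE \<omega> in completion M. \<omega> \<in> R -` A \<inter> space (completion M) \<longleftrightarrow> \<omega> \<in> ?f -` A \<inter> space (completion M)"
      using ae by eventually_elim auto
    ultimately show "?f -` A \<inter> space (completion M) \<in> sets (completion M)"
      using completion.in_sets_AE Int_lower2 by blast
  qed simp
  have "exp_integral_law M c N L = distr (completion M) borel R"
    unfolding exp_integral_law_def by (rule distr_cong_AE[OF refl refl ae fm Rm])
  also have "\<dots> = distr M borel R" by (rule distr_completion[OF R_measurable])
  finally have eq: "exp_integral_law M c N L = distr M borel R" .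
  show "real_distribution (exp_integral_law M c N L)" unfolding eq by (rule real_distribution_distr[OF R_measurable])
  show "char (exp_integral_law M c N L) z = phi (\<i> * of_real z)" unfolding eq by (rule char_R)
qed

end

section \<open>Arithmetic of the atoms\<close>

lemma Rats_pos_fraction:
  fixes x :: real
  assumes "x \<in> \<rat>" "x > 0"
  obtains a b :: nat where "a > 0" "b > 0" "coprime a b" "x = real a / real b"
proof -
  obtain a b :: nat where ab: "b \<noteq> 0" "\<bar>x\<bar> = real a / real b" "coprime a b"
    using Rats_abs_nat_div_natE[OF assms(1)] by metis
  hence "a > 0" using assms(2) by (cases "a = 0") auto
  thus ?thesis using that[of a b] ab assms(2) by simp
qed

text \<open>In lowest terms x = a / b, the power b^n divides a^n while being coprime to it, so b =
  1.\<close>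

lemma Rats_power_Nats_imp_Nats:
  fixes x :: real
  assumes "x \<in> \<rat>" "x > 0" "x ^ n \<in> \<nat>" "n \<ge> 1"
  shows "x \<in> \<nat>"
proof -
  obtain a b :: nat where ab: "a > 0" "b > 0" "coprime a b" "x = real a / real b"
    by (rule Rats_pos_fraction[OF assms(1,2)])
  obtain m where "x ^ n = real m" using assms(3) by (rule Nats_cases)
  hence "real (a ^ n) = real (m * b ^ n)" using ab by (simp add: power_divide field_simps)
  hence "a ^ n = m * b ^ n" by (simp only: of_nat_eq_iff)
  hence "b ^ n dvd a ^ n" by simp
  moreover have "coprime (a ^ n) (b ^ n)" using ab by simp
  ultimately have "is_unit (b ^ n)" by (metis coprime_absorb_right coprime_commute)
  hence "b = 1" using assms(4) by (simp add: is_unit_power_iff)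
  thus ?thesis using ab by simp
qed

lemma multiplicity_2_power_mult:
  fixes a b n :: nat
  assumes "a > 0" "b > 0" "odd n" "a ^ j * 2 ^ i = n ^ i' * b ^ j"
  shows "j * multiplicity 2 a + i = j * multiplicity 2 b"
proof -
  have n: "n > 0" "multiplicity 2 n = 0" using assms(3) by (auto simp: not_dvd_imp_multiplicity_0 odd_pos)
  have "multiplicity 2 (a ^ j * 2 ^ i) = j * multiplicity 2 a + i"
    using assms(1) by (simp add: prime_elem_multiplicity_mult_distrib prime_elem_multiplicity_power_distrib)
  moreover have "multiplicity 2 (n ^ i' * b ^ j) = j * multiplicity 2 b"
    using assms(2) n by (simp add: prime_elem_multiplicity_mult_distrib prime_elem_multiplicity_power_distrib)
  ultimately show ?thesis using assms(4) by simp
qed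

lemma half_odd_power_not_Nats:
  fixes c :: real
  assumes n: "odd n" "2 * c ^ j = real n" and j': "j' \<ge> 1"
  shows "c ^ j' \<notin> \<nat>"
proof
  assume "c ^ j' \<in> \<nat>"
  then obtain m where m: "c ^ j' = real m" by (rule Nats_cases)
  have "real (n ^ j') = (2 * c ^ j) ^ j'" using n by simp
  also have "\<dots> = 2 ^ j' * (c ^ j') ^ j" by (simp add: power_mult_distrib mult.commute flip: power_mult)
  also have "\<dots> = real (2 ^ j' * m ^ j)" by (simp add: m)
  finally have "n ^ j' = 2 ^ j' * m ^ j" by (simp only: of_nat_eq_iff)
  moreover have "odd (n ^ j')" using n by simp
  ultimately show False using j' by simp
qed

text \<open>Raising the two equations to cross powers gives a^j 2^i = b^i 2^j with a and b odd; the
  2-adic valuations of the sides are i and j.\<close>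

lemma half_odd_power_unique:
  fixes c :: real
  assumes "odd a" "2 * c ^ i = real a" "odd b" "2 * c ^ j = real b"
  shows "i = j"
proof -
  have "real (a ^ j * 2 ^ i) = (2 * c ^ i) ^ j * 2 ^ i" using assms by simp
  also have "\<dots> = (2 * c ^ j) ^ i * 2 ^ j" by (simp add: power_mult_distrib mult_ac flip: power_mult)
  also have "\<dots> = real (b ^ i * 2 ^ j)" using assms by simp
  finally have "a ^ j * 2 ^ i = b ^ i * 2 ^ j" by (simp only: of_nat_eq_iff)
  hence "multiplicity 2 (a ^ j * 2 ^ i) = multiplicity 2 (b ^ i * 2 ^ j)" by simp
  moreover have "a > 0" "b > 0" "multiplicity 2 a = 0" "multiplicity 2 b = 0"
    using assms by (auto simp: not_dvd_imp_multiplicity_0 odd_pos)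
  ultimately show ?thesis
    by (simp add: prime_elem_multiplicity_mult_distrib prime_elem_multiplicity_power_distrib)
qed

context ou_exponent
begin

lemma scales_nat:
  assumes "m \<ge> 1" "i \<in> scales (real m)"
  shows "c ^ i \<in> \<rat>"
proof -
  have "real m * c ^ i \<in> \<rat>" using assms(2) Nats_subset_Rats by (auto simp: scales_def)
  moreover have "c ^ i = real m * c ^ i / real m" using assms(1) by simp
  ultimately show ?thesis by (metis Rats_divide Rats_of_nat)
qed

text \<open>The index 0 contributes - \<rho>^2 / 2. All indices lie below \<kappa>, so no q-weight
  enters. Even integers 2 c^i contribute negatively, and at most one i makes 2 c^i an odd integer;
  that integer is at least 3 and contributes at most \<rho>^3 / 3 < \<rho>^2 / 2.\<close>

lemma mass_2_neg:
  assumes \<kappa>: "\<kappa> \<ge> 1" and no: "\<And>i. i \<ge> \<kappa> \<Longrightarrow> 2 * c ^ i \<notin> \<nat>"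
  shows "mass 2 < 0"
proof -
  have sub: "scales 2 \<subseteq> {..<\<kappa>}" using no by (auto simp: scales_def not_le[symmetric])
  have fin: "finite (scales 2)" by (rule finite_subset[OF sub]) simp
  define mm where "mm i = nat \<lfloor>2 * c ^ i\<rfloor>" for i
  define w where "w i = weight i (mm i)" for i
  define Od where "Od = {i \<in> scales 2. odd (mm i)}"
  have M: "real (mm i) = 2 * c ^ i" if "i \<in> scales 2" for i
  proof -
    have "2 * c ^ i \<in> \<nat>" using that by (simp add: scales_def)
    then obtain m where "2 * c ^ i = real m" by (rule Nats_cases)
    thus ?thesis by (simp add: mm_def)
  qed
  have w: "w i = - ((- \<rho>) ^ mm i) / real (mm i)" if "i \<in> scales 2" for i
    using that sub by (auto simp: w_def weight_def)
  have 0: "0 \<in> scales 2" "0 \<notin> Od" "w 0 = - (\<rho>\<^sup>2 / 2)"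
    using w[of 0] by (auto simp: scales_def Od_def mm_def)
  have O1: "w i \<le> \<rho> ^ 3 / 3" if i: "i \<in> Od" for i
  proof -
    have i': "i \<in> scales 2" "odd (mm i)" using i by (auto simp: Od_def)
    have "i \<noteq> 0" using i 0(2) by metis
    have "c ^ i > 1" using c \<open>i \<noteq> 0\<close> by (intro one_less_power) auto
    hence "real (mm i) > real 2" unfolding M[OF i'(1)] by simp
    hence "mm i > 2" by (simp only: of_nat_less_iff)
    hence m3: "mm i \<ge> 3" by simp
    have "w i = \<rho> ^ mm i / real (mm i)" using w[OF i'(1)] i'(2) by simp
    also have "\<dots> \<le> \<rho> ^ 3 / 3"
      using m3 \<rho> by (intro frac_le power_decreasing) auto
    finally show ?thesis .
  qed
  have "\<exists>i0. Od \<subseteq> {i0}"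
  proof (cases "Od = {}")
    case False
    then obtain i0 where i0: "i0 \<in> Od" by blast
    have "i = i0" if "i \<in> Od" for i
      using half_odd_power_unique[of "mm i" c i "mm i0" i0] that i0 M by (auto simp: Od_def)
    thus ?thesis by blast
  qed simp
  then obtain i0 where "Od \<subseteq> {i0}" ..
  hence "(\<Sum>i\<in>Od. w i) \<le> \<rho> ^ 3 / 3"
  proof (cases "Od = {}")
    case False
    hence "Od = {i0}" using \<open>Od \<subseteq> {i0}\<close> by auto
    thus ?thesis using O1[of i0] by simp
  qed (use \<rho> in simp)
  moreover have "(\<Sum>i\<in>scales 2 - Od - {0}. w i) \<le> 0"
    using w by (intro sum_nonpos) (auto simp: Od_def)
  moreover have "mass 2 = (\<Sum>i\<in>scales 2. w i)" unfolding mass_def w_def mm_def by (rule infsum_finite[OF fin])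
  moreover have "(\<Sum>i\<in>scales 2. w i) = w 0 + (\<Sum>i\<in>Od. w i) + (\<Sum>i\<in>scales 2 - Od - {0}. w i)"
  proof -
    have "scales 2 = insert 0 (Od \<union> (scales 2 - Od - {0}))" using 0 by (auto simp: Od_def)
    hence "(\<Sum>i\<in>scales 2. w i) = (\<Sum>i\<in>insert 0 (Od \<union> (scales 2 - Od - {0})). w i)" by (rule arg_cong)
    also have "\<dots> = w 0 + (\<Sum>i\<in>Od \<union> (scales 2 - Od - {0}). w i)"
      using fin 0 by (intro sum.insert) (auto simp: Od_def)
    also have "(\<Sum>i\<in>Od \<union> (scales 2 - Od - {0}). w i) = (\<Sum>i\<in>Od. w i) + (\<Sum>i\<in>scales 2 - Od - {0}. w i)"
      using fin by (intro sum.union_disjoint) (auto simp: Od_def)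
    finally show ?thesis by simp
  qed
  moreover have "\<rho> ^ 3 / 3 < \<rho>\<^sup>2 / 2"
  proof -
    have "\<rho> ^ 3 \<le> \<rho>\<^sup>2" using \<rho> by (intro power_decreasing) auto
    moreover have "\<rho>\<^sup>2 > 0" using \<rho> by simp
    ultimately show ?thesis by linarith
  qed
  ultimately show ?thesis using 0(3) by linarith
qed

section \<open>Bases with an integer power\<close>

text \<open>If m c^i is an integer and i = l t + s with s < l, then c^s is rational with integral
  l-th power \<alpha>^s, hence itself an integer; minimality of l leaves s = 0.\<close>

lemma scales_integer_base:
  assumes l: "l \<ge> 1" "\<And>i. 1 \<le> i \<Longrightarrow> i < l \<Longrightarrow> c ^ i \<notin> \<nat>" and \<alpha>: "real \<alpha> = c ^ l" and m: "m \<ge> 1"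
  shows "scales (real m) = range (\<lambda>t. l * t)"
proof (intro equalityI subsetI)
  fix i assume i: "i \<in> scales (real m)"
  define t where "t = i div l"
  define s where "s = i mod l"
  have i_eq: "i = l * t + s" and s: "s < l" using l(1) by (auto simp: t_def s_def)
  have "c ^ i \<in> \<rat>" by (rule scales_nat[OF m i])
  moreover have "c ^ s = c ^ i / real (\<alpha> ^ t)" using c by (simp add: i_eq power_add power_mult \<alpha>)
  ultimately have "c ^ s \<in> \<rat>" by (metis Rats_divide Rats_of_nat)
  moreover have "(c ^ s) ^ l = real (\<alpha> ^ s)" by (simp add: \<alpha> mult.commute flip: power_mult)
  hence "(c ^ s) ^ l \<in> \<nat>" by (simp only: of_nat_in_Nats)
  ultimately have "c ^ s \<in> \<nat>" using c l(1) by (intro Rats_power_Nats_imp_Nats[of "c ^ s" l]) auto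
  hence "s = 0" using l(2)[of s] s by (cases "s = 0") auto
  thus "i \<in> range (\<lambda>t. l * t)" using i_eq by auto
next
  fix i assume "i \<in> range (\<lambda>t. l * t)"
  then obtain t where "i = l * t" by auto
  hence "real m * c ^ i = real (m * \<alpha> ^ t)" by (simp add: power_mult \<alpha>)
  thus "i \<in> scales (real m)" unfolding scales_def by (simp only: mem_Collect_eq of_nat_in_Nats)
qed

lemma mass_integer_base:
  assumes l: "l \<ge> 1" "\<And>i. 1 \<le> i \<Longrightarrow> i < l \<Longrightarrow> c ^ i \<notin> \<nat>" and \<alpha>: "real \<alpha> = c ^ l" and m: "m \<ge> 1"
  shows "(\<lambda>t. weight (l * t) (m * \<alpha> ^ t)) sums mass (real m)"
proof -
  have S: "scales (real m) = range (\<lambda>t. l * t)" by (rule scales_integer_base[OF assms])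
  have bij: "bij_betw (\<lambda>t. l * t) UNIV (scales (real m))"
    unfolding S using l(1) by (intro inj_on_imp_bij_betw inj_onI) auto
  have e: "nat \<lfloor>real m * c ^ (l * t)\<rfloor> = m * \<alpha> ^ t" for t
  proof -
    have "real m * c ^ (l * t) = real (m * \<alpha> ^ t)" by (simp add: power_mult \<alpha>)
    thus ?thesis by (simp only: floor_of_nat nat_int)
  qed
  have "((\<lambda>n. weight n (nat \<lfloor>real m * c ^ n\<rfloor>)) has_sum mass (real m)) (scales (real m))"
    unfolding mass_def by (rule has_sum_infsum[OF mass_eq_atom(2)]) (use m in simp)
  hence "((\<lambda>t. weight (l * t) (m * \<alpha> ^ t)) has_sum mass (real m)) UNIV"
    using has_sum_reindex_bij_betw[OF bij, of "\<lambda>n. weight n (nat \<lfloor>real m * c ^ n\<rfloor>)"] by (simp add: e)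
  thus ?thesis by (rule has_sum_imp_sums)
qed

lemma mass_integer_base_nonneg_iff:
  assumes l: "l \<ge> 1" "\<And>i. 1 \<le> i \<Longrightarrow> i < l \<Longrightarrow> c ^ i \<notin> \<nat>" and \<alpha>: "real \<alpha> = c ^ l"
    and \<kappa>: "\<kappa> \<ge> 1" and \<beta>: "\<beta> = nat \<lceil>real \<kappa> / real l\<rceil>"
  shows "(\<forall>m::nat\<ge>1. mass (real m) \<ge> 0) \<longleftrightarrow> q > 0 \<and> \<rho> \<le> h_fun \<alpha> \<beta> (q ^ (\<alpha> ^ \<beta>))"
proof -
  have "real \<alpha> > 1" unfolding \<alpha> using c l(1) by (intro one_less_power) auto
  hence \<alpha>2: "\<alpha> \<ge> 2" by simp
  have "real \<kappa> / real l > 0" using \<kappa> l(1) by simp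
  hence "\<lceil>real \<kappa> / real l\<rceil> \<ge> 1" by (simp only: one_le_ceiling)
  hence \<beta>1: "\<beta> \<ge> 1" unfolding \<beta> by (simp add: le_nat_iff)
  \<comment> \<open>The ceiling in \<beta> marks the first multiple of l that reaches \<kappa>:
    q-weights enter exactly from t = \<beta> on.\<close>
  have \<beta>iff: "l * t \<ge> \<kappa> \<longleftrightarrow> t \<ge> \<beta>" for t
  proof -
    have "t \<ge> \<beta> \<longleftrightarrow> \<lceil>real \<kappa> / real l\<rceil> \<le> int t" unfolding \<beta> by linarith
    also have "\<dots> \<longleftrightarrow> real \<kappa> / real l \<le> real t" by (simp add: ceiling_le_iff)
    also have "\<dots> \<longleftrightarrow> real \<kappa> \<le> real (l * t)" using l(1) by (simp add: pos_divide_le_eq mult.commute)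
    also have "\<dots> \<longleftrightarrow> \<kappa> \<le> l * t" by (simp only: of_nat_le_iff)
    finally show ?thesis by simp
  qed
  have wsum: "(\<lambda>t. - ((- \<rho>) ^ (m * \<alpha> ^ t)) / real \<alpha> ^ t + (if t \<ge> \<beta> then q ^ (m * \<alpha> ^ t) / real \<alpha> ^ t else 0)) sums (real m * mass (real m))"
    if m: "m \<ge> 1" for m
  proof -
    have "(\<lambda>t. real m * weight (l * t) (m * \<alpha> ^ t)) sums (real m * mass (real m))"
      by (rule sums_mult[OF mass_integer_base[OF l \<alpha> m]])
    also have "(\<lambda>t. real m * weight (l * t) (m * \<alpha> ^ t)) =
      (\<lambda>t. - ((- \<rho>) ^ (m * \<alpha> ^ t)) / real \<alpha> ^ t + (if t \<ge> \<beta> then q ^ (m * \<alpha> ^ t) / real \<alpha> ^ t else 0))"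
      using m \<alpha>2 by (simp add: fun_eq_iff weight_def \<beta>iff distrib_left right_diff_distrib)
    finally show ?thesis .
  qed
  \<comment> \<open>For odd m the term t = 0 is + \<rho>^m. The later terms, which may be negative
    when \<alpha> is even, are at least - \<rho>^m 2^(-t), and these bounds sum over t \<ge> 1 to -
    \<rho>^m.\<close>
  have odd_nonneg: "mass (real m) \<ge> 0" if m: "odd m" for m
  proof -
    have m1: "m \<ge> 1" using m by (simp add: Suc_leI odd_pos)
    have s: "(\<lambda>t. if t = 0 then \<rho> ^ m else 0) sums \<rho> ^ m" by (rule sums_single)
    have g: "(\<lambda>t. \<rho> ^ m * (1 / 2) ^ Suc t) sums \<rho> ^ m"
      using sums_mult[OF power_half_series, of "\<rho> ^ m"] by simp
    have g': "(\<lambda>t. if t = 0 then 0 else \<rho> ^ m * (1 / 2) ^ t) sums \<rho> ^ m"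
    proof -
      let ?G = "\<lambda>t. if t = 0 then 0 else \<rho> ^ m * (1 / 2) ^ t"
      have "(\<lambda>t. ?G (Suc t)) sums \<rho> ^ m" using g by simp
      hence "?G sums (\<rho> ^ m + ?G 0)" by (rule sums_Suc_iff[THEN iffD1])
      thus ?thesis by simp
    qed
    define lo where "lo t = (if t = 0 then \<rho> ^ m else 0) - (if t = 0 then 0 else \<rho> ^ m * (1 / 2) ^ t)" for t :: nat
    define hi where "hi t = - ((- \<rho>) ^ (m * \<alpha> ^ t)) / real \<alpha> ^ t + (if t \<ge> \<beta> then q ^ (m * \<alpha> ^ t) / real \<alpha> ^ t else 0)" for t
    have z: "lo sums 0" unfolding lo_def using sums_diff[OF s g'] by simp
    have "lo t \<le> hi t" for t
    proof (cases "t = 0")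
      case True
      thus ?thesis using m q \<beta>1 by (simp add: lo_def hi_def)
    next
      case False
      define B where "B = (- \<rho>) ^ (m * \<alpha> ^ t) / real \<alpha> ^ t"
      define A where "A = q ^ (m * \<alpha> ^ t) / real \<alpha> ^ t"
      have "A \<ge> 0" using q by (simp add: A_def)
      have "B \<le> \<bar>(- \<rho>) ^ (m * \<alpha> ^ t)\<bar> / real \<alpha> ^ t"
        unfolding B_def by (rule divide_right_mono[OF abs_ge_self]) simp
      also have "\<dots> = \<rho> ^ (m * \<alpha> ^ t) / real \<alpha> ^ t" using \<rho> by (simp add: power_abs)
      also have "\<dots> \<le> \<rho> ^ m / 2 ^ t"
      proof (rule frac_le)
        have "m * 1 \<le> m * \<alpha> ^ t" using \<alpha>2 by (intro mult_le_mono2) simp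
        thus "\<rho> ^ (m * \<alpha> ^ t) \<le> \<rho> ^ m" using \<rho> by (intro power_decreasing) auto
        show "(2 :: real) ^ t \<le> real \<alpha> ^ t" using \<alpha>2 by (intro power_mono) auto
      qed (use \<rho> in auto)
      also have "\<dots> = \<rho> ^ m * (1 / 2) ^ t" by (simp add: power_one_over)
      finally have "B \<le> \<rho> ^ m * (1 / 2) ^ t" .
      moreover have "hi t = - B + (if t \<ge> \<beta> then A else 0)" by (simp add: hi_def A_def B_def)
      moreover have "lo t = - (\<rho> ^ m * (1 / 2) ^ t)" using False by (simp add: lo_def)
      ultimately show ?thesis using \<open>A \<ge> 0\<close> by (cases "t \<ge> \<beta>") auto
    qed
    moreover have "hi sums (real m * mass (real m))" unfolding hi_def by (rule wsum[OF m1])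
    ultimately have "0 \<le> real m * mass (real m)" using sums_le[of lo hi] z by blast
    thus ?thesis using m1 by (simp add: zero_le_mult_iff)
  qed
  define Q where "Q = q ^ (\<alpha> ^ \<beta>)"
  have "\<alpha> ^ \<beta> > 0" using \<alpha>2 by simp
  hence Q: "0 \<le> Q" "Q < 1" using q unfolding Q_def by (simp_all add: power_less_one_iff)
  have even_iff: "mass (real (2 * m)) \<ge> 0 \<longleftrightarrow> F_fun \<alpha> (\<rho> ^ m) \<le> (1 / real \<alpha>) ^ \<beta> * F_fun \<alpha> (Q ^ m)" if m: "m \<ge> 1" for m
  proof -
    have \<rho>m: "0 \<le> \<rho> ^ m" "\<rho> ^ m \<le> 1" and Qm: "0 \<le> Q ^ m" "Q ^ m \<le> 1" using \<rho> Q by (auto intro!: power_le_one)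
    have F1: "(\<lambda>t. - ((1 / real \<alpha>) ^ t * (\<rho> ^ m) ^ (2 * \<alpha> ^ t))) sums (- F_fun \<alpha> (\<rho> ^ m))"
      unfolding F_fun_def by (intro sums_minus summable_sums F_fun_summable \<alpha>2 \<rho>m)
    have "(\<lambda>t. (1 / real \<alpha>) ^ \<beta> * ((1 / real \<alpha>) ^ t * (Q ^ m) ^ (2 * \<alpha> ^ t))) sums ((1 / real \<alpha>) ^ \<beta> * F_fun \<alpha> (Q ^ m))"
      unfolding F_fun_def by (intro sums_mult summable_sums F_fun_summable \<alpha>2 Qm)
    moreover have "(1 / real \<alpha>) ^ \<beta> * ((1 / real \<alpha>) ^ t * (Q ^ m) ^ (2 * \<alpha> ^ t)) =
      (if t + \<beta> \<ge> \<beta> then q ^ (2 * m * \<alpha> ^ (t + \<beta>)) / real \<alpha> ^ (t + \<beta>) else 0)" for t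
    proof -
      have "(Q ^ m) ^ (2 * \<alpha> ^ t) = q ^ (2 * m * \<alpha> ^ (t + \<beta>))"
        unfolding Q_def power_mult[symmetric] by (simp add: power_add mult_ac)
      thus ?thesis by (simp add: power_one_over power_add)
    qed
    ultimately have "(\<lambda>t. if t + \<beta> \<ge> \<beta> then q ^ (2 * m * \<alpha> ^ (t + \<beta>)) / real \<alpha> ^ (t + \<beta>) else 0) sums ((1 / real \<alpha>) ^ \<beta> * F_fun \<alpha> (Q ^ m))"
      by (simp only:)
    \<comment> \<open>The first \<beta> terms vanish; shifting past them extracts the factor
      \<alpha>^(-\<beta>) and replaces q by Q = q^(\<alpha>^\<beta>).\<close>
    hence F2: "(\<lambda>t. if t \<ge> \<beta> then q ^ (2 * m * \<alpha> ^ t) / real \<alpha> ^ t else 0) sums ((1 / real \<alpha>) ^ \<beta> * F_fun \<alpha> (Q ^ m))"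
      using sums_iff_shift[of "\<lambda>t. if t \<ge> \<beta> then q ^ (2 * m * \<alpha> ^ t) / real \<alpha> ^ t else 0" \<beta>] by simp
    have neg: "- ((- \<rho>) ^ (2 * m * \<alpha> ^ t)) / real \<alpha> ^ t = - ((1 / real \<alpha>) ^ t * (\<rho> ^ m) ^ (2 * \<alpha> ^ t))" for t
    proof -
      have "(- \<rho>) ^ (2 * m * \<alpha> ^ t) = (\<rho> ^ m) ^ (2 * \<alpha> ^ t)"
        unfolding power_mult[symmetric] by (simp add: power_minus_Bit0 mult_ac)
      thus ?thesis by (simp add: power_one_over)
    qed
    have "2 * m \<ge> 1" using m by simp
    from sums_unique2[OF wsum[OF this, unfolded neg] sums_add[OF F1 F2]]
    have "real (2 * m) * mass (real (2 * m)) = - F_fun \<alpha> (\<rho> ^ m) + (1 / real \<alpha>) ^ \<beta> * F_fun \<alpha> (Q ^ m)" .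
    moreover have "mass (real (2 * m)) \<ge> 0 \<longleftrightarrow> real (2 * m) * mass (real (2 * m)) \<ge> 0"
      using m by (simp add: zero_le_mult_iff)
    ultimately show ?thesis by simp
  qed
  have "(\<forall>m::nat\<ge>1. mass (real m) \<ge> 0) \<longleftrightarrow> (\<forall>m\<ge>1. F_fun \<alpha> (\<rho> ^ m) \<le> (1 / real \<alpha>) ^ \<beta> * F_fun \<alpha> (Q ^ m))"
  proof (intro iffI allI impI)
    fix m :: nat assume "\<forall>m::nat\<ge>1. mass (real m) \<ge> 0" "m \<ge> 1"
    moreover from this have "2 * m \<ge> 1" by simp
    ultimately show "F_fun \<alpha> (\<rho> ^ m) \<le> (1 / real \<alpha>) ^ \<beta> * F_fun \<alpha> (Q ^ m)" using even_iff[of m] by blast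
  next
    fix m :: nat assume *: "\<forall>m\<ge>1. F_fun \<alpha> (\<rho> ^ m) \<le> (1 / real \<alpha>) ^ \<beta> * F_fun \<alpha> (Q ^ m)" "m \<ge> 1"
    show "mass (real m) \<ge> 0"
    proof (cases "odd m")
      case False
      hence "even m" by simp
      then obtain m' where m': "m = 2 * m'" by (rule evenE)
      hence "m' \<ge> 1" using *(2) by simp
      thus ?thesis using even_iff[of m'] *(1) unfolding m' by blast
    qed (rule odd_nonneg)
  qed
  also have "\<dots> \<longleftrightarrow> q > 0 \<and> \<rho> \<le> h_fun \<alpha> \<beta> Q"
  proof (cases "q > 0")
    case True
    hence "Q > 0" by (simp add: Q_def)
    thus ?thesis using h_fun_ge_iff[OF \<alpha>2 \<beta>1 \<rho> _ Q(2)] True by simp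
  next
    \<comment> \<open>For q = 0 the definite description gives no information on h at 0, so the
      right side is refuted by its conjunct q > 0; the left side fails at m = 1 because F \<rho> > 0
      = F 0.\<close>
    case False
    hence "Q = 0" using q \<alpha>2 by (simp add: Q_def)
    hence "\<not> F_fun \<alpha> (\<rho> ^ 1) \<le> (1 / real \<alpha>) ^ \<beta> * F_fun \<alpha> (Q ^ 1)"
      using F_fun_pos[OF \<alpha>2 \<rho>(1)] \<rho> F_fun_0[OF \<alpha>2] by simp
    thus ?thesis using False by blast
  qed
  finally show ?thesis unfolding Q_def .
qed

section \<open>Bases with a half-odd power\<close>

text \<open>\<open>a_seq\<close> depends on p and r only through r / p, so p = 1 and r = \<rho> are
  inserted. The sum collects the terms of positive scale in the mass at the even integer 2 m, with s
  lowered by one.\<close>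

definition atom_sum :: "nat \<Rightarrow> nat \<Rightarrow> real" where
  "atom_sum n m = (\<Sum>s = 0..multiplicity 2 m. a_seq 1 q \<rho> (n ^ (s + 1) * m div 2 ^ s))"

lemma a_seq_eq: "a_seq 1 q \<rho> m = (q ^ m - (- \<rho>) ^ m) / real m"
  by (simp add: a_seq_def)

text \<open>m c^(j s) = m n^s / 2^s is an integer iff 2^s divides m, as n is odd. For an exponent j
  t + s with s < j, rationality c^s = a / b gives a^j 2^s = n^s b^j, and comparing 2-adic valuations
  shows that j divides s.\<close>

lemma scales_half_odd_base:
  assumes n: "odd n" "2 * c ^ j = real n" and j: "j \<ge> 1" and m: "m \<ge> 1"
  shows "scales (real m) = (\<lambda>s. j * s) ` {0..multiplicity 2 m}"
    and "s \<le> multiplicity 2 m \<Longrightarrow> nat \<lfloor>real m * c ^ (j * s)\<rfloor> = n ^ s * m div 2 ^ s"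
proof -
  have cj: "c ^ j = real n / 2" using n(2) by simp
  have n0: "n > 0" using n(1) by (rule odd_pos)
  have pw: "real m * c ^ (j * s) = real (m * n ^ s) / real (2 ^ s)" for s
    by (simp add: power_mult cj power_divide)
  have int_iff: "real m * c ^ (j * s) \<in> \<nat> \<longleftrightarrow> s \<le> multiplicity 2 m" for s
  proof
    assume "real m * c ^ (j * s) \<in> \<nat>"
    then obtain M where "real m * c ^ (j * s) = real M" by (rule Nats_cases)
    hence "real (m * n ^ s) = real (M * 2 ^ s)" unfolding pw by (simp add: field_simps)
    hence "m * n ^ s = M * 2 ^ s" by (simp only: of_nat_eq_iff)
    hence "2 ^ s dvd m * n ^ s" by simp
    moreover have "coprime (2 ^ s) (n ^ s)" using n(1) by (simp add: coprime_left_2_iff_odd)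
    ultimately have "2 ^ s dvd m" by (simp add: coprime_dvd_mult_left_iff)
    thus "s \<le> multiplicity 2 m" using m by (intro multiplicity_geI) auto
  next
    assume "s \<le> multiplicity 2 m"
    hence "2 ^ s dvd m" by (rule multiplicity_dvd')
    then obtain M where "m = 2 ^ s * M" ..
    hence "real m * c ^ (j * s) = real (M * n ^ s)" unfolding pw by simp
    thus "real m * c ^ (j * s) \<in> \<nat>" by (simp only: of_nat_in_Nats)
  qed
  show "nat \<lfloor>real m * c ^ (j * s)\<rfloor> = n ^ s * m div 2 ^ s" if "s \<le> multiplicity 2 m"
  proof -
    have "\<lfloor>real (m * n ^ s) / real (2 ^ s)\<rfloor> = int (m * n ^ s div 2 ^ s)" by (rule floor_divide_of_nat_eq)
    thus ?thesis unfolding pw by (simp only: nat_int mult.commute)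
  qed
  show "scales (real m) = (\<lambda>s. j * s) ` {0..multiplicity 2 m}"
  proof (intro equalityI subsetI)
    fix i assume i: "i \<in> scales (real m)"
    define t where "t = i div j"
    define s where "s = i mod j"
    have i_eq: "i = j * t + s" and s: "s < j" using j by (auto simp: t_def s_def)
    have "c ^ i \<in> \<rat>" by (rule scales_nat[OF m i])
    moreover have "c ^ s = c ^ i * real (2 ^ t) / real (n ^ t)"
      using c n0 by (simp add: i_eq power_add power_mult cj power_divide)
    ultimately have "c ^ s \<in> \<rat>" by (metis Rats_divide Rats_mult Rats_of_nat)
    moreover have "c ^ s > 0" using c by simp
    ultimately obtain a b :: nat where ab: "a > 0" "b > 0" "c ^ s = real a / real b"
      by (metis Rats_pos_fraction)
    have "(real a / real b) ^ j = (real n / 2) ^ s"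
      unfolding ab(3)[symmetric] cj[symmetric] by (simp add: mult.commute flip: power_mult)
    hence "real (a ^ j * 2 ^ s) = real (n ^ s * b ^ j)" using ab by (simp add: power_divide field_simps)
    hence "a ^ j * 2 ^ s = n ^ s * b ^ j" by (simp only: of_nat_eq_iff)
    from multiplicity_2_power_mult[OF ab(1,2) n(1) this]
    have "j dvd j * multiplicity 2 a + s" by simp
    hence "j dvd s" by (simp add: dvd_add_right_iff)
    hence "s = 0" using s by (auto dest: dvd_imp_le)
    hence "i = j * t" using i_eq by simp
    moreover from i this have "t \<le> multiplicity 2 m"
      unfolding scales_def mem_Collect_eq using int_iff[of t] by metis
    ultimately show "i \<in> (\<lambda>s. j * s) ` {0..multiplicity 2 m}" by auto
  next
    fix i assume "i \<in> (\<lambda>s. j * s) ` {0..multiplicity 2 m}"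
    then obtain s where "i = j * s" "s \<in> {0..multiplicity 2 m}" by (rule imageE)
    thus "i \<in> scales (real m)" unfolding scales_def mem_Collect_eq using int_iff[of s] by simp
  qed
qed

text \<open>Every positive multiple of j is at least \<kappa>, so all terms but s = 0 carry both
  families of weights.\<close>

lemma mass_half_odd_base:
  assumes n: "odd n" "2 * c ^ j = real n" and j: "j \<ge> 1" "j \<ge> \<kappa>" and \<kappa>: "\<kappa> \<ge> 1" and m: "m \<ge> 1"
  shows "mass (real m) = - ((- \<rho>) ^ m) / real m + (\<Sum>s = 1..multiplicity 2 m. a_seq 1 q \<rho> (n ^ s * m div 2 ^ s))"
proof -
  note S = scales_half_odd_base[OF n j(1) m]
  have "mass (real m) = (\<Sum>i\<in>scales (real m). weight i (nat \<lfloor>real m * c ^ i\<rfloor>))"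
    unfolding mass_def S(1) by (rule infsum_finite) simp
  also have "\<dots> = (\<Sum>s\<in>{0..multiplicity 2 m}. weight (j * s) (nat \<lfloor>real m * c ^ (j * s)\<rfloor>))"
    unfolding S(1) using j(1) by (subst sum.reindex) (auto intro!: inj_onI)
  also have "\<dots> = (\<Sum>s\<in>{0..multiplicity 2 m}. weight (j * s) (n ^ s * m div 2 ^ s))"
    using S(2) by (intro sum.cong) auto
  also have "\<dots> = weight 0 m + (\<Sum>s = 1..multiplicity 2 m. weight (j * s) (n ^ s * m div 2 ^ s))"
    by (subst sum.atLeast_Suc_atMost) auto
  also have "weight 0 m = - ((- \<rho>) ^ m) / real m" using \<kappa> by (simp add: weight_def)
  also have "(\<Sum>s = 1..multiplicity 2 m. weight (j * s) (n ^ s * m div 2 ^ s)) =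
    (\<Sum>s = 1..multiplicity 2 m. a_seq 1 q \<rho> (n ^ s * m div 2 ^ s))"
  proof (intro sum.cong refl)
    fix s assume "s \<in> {1..multiplicity 2 m}"
    hence "j * s \<ge> j * 1" by (intro mult_le_mono2) auto
    hence "j * s \<ge> \<kappa>" using j(2) by linarith
    thus "weight (j * s) (n ^ s * m div 2 ^ s) = a_seq 1 q \<rho> (n ^ s * m div 2 ^ s)"
      by (simp add: weight_def a_seq_eq diff_divide_distrib)
  qed
  finally show ?thesis .
qed

text \<open>For odd m only s = 0 occurs and the mass is \<rho>^m / m > 0. At 2 m the term s = 0 is -
  \<rho>^(2 m) / (2 m) and the others form \<open>atom_sum n m\<close>.\<close>

lemma mass_half_odd_base_nonneg_iff:
  assumes n: "odd n" "2 * c ^ j = real n" and j: "j \<ge> 1" "j \<ge> \<kappa>" and \<kappa>: "\<kappa> \<ge> 1"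
  shows "(\<forall>m::nat\<ge>1. mass (real m) \<ge> 0) \<longleftrightarrow> (\<forall>m\<ge>1. atom_sum n m \<ge> \<rho> ^ (2 * m) / (2 * real m))"
proof -
  note mass = mass_half_odd_base[OF n j \<kappa>]
  have even: "mass (real (2 * m)) = atom_sum n m - \<rho> ^ (2 * m) / (2 * real m)" if m: "m \<ge> 1" for m
  proof -
    have mult: "multiplicity 2 (2 * m) = Suc (multiplicity 2 m)"
      using m by (intro multiplicity_times_same) auto
    have "(\<Sum>s = 1..multiplicity 2 (2 * m). a_seq 1 q \<rho> (n ^ s * (2 * m) div 2 ^ s)) =
      (\<Sum>s = 0..multiplicity 2 m. a_seq 1 q \<rho> (n ^ Suc s * (2 * m) div 2 ^ Suc s))"
      unfolding mult One_nat_def by (rule sum.shift_bounds_cl_Suc_ivl)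
    also have "\<dots> = atom_sum n m" unfolding atom_sum_def
    proof (intro sum.cong refl)
      fix s
      have "n ^ Suc s * (2 * m) div 2 ^ Suc s = (2 * (n ^ (s + 1) * m)) div (2 * 2 ^ s)" by (simp add: mult_ac)
      also have "\<dots> = n ^ (s + 1) * m div 2 ^ s" by (rule div_mult_mult1) simp
      finally show "a_seq 1 q \<rho> (n ^ Suc s * (2 * m) div 2 ^ Suc s) = a_seq 1 q \<rho> (n ^ (s + 1) * m div 2 ^ s)" by (simp only:)
    qed
    finally show ?thesis using mass[of "2 * m"] m by simp
  qed
  show ?thesis
  proof (intro iffI allI impI)
    fix m :: nat assume "\<forall>m::nat\<ge>1. mass (real m) \<ge> 0" "m \<ge> 1"
    moreover from this have "2 * m \<ge> 1" by simp
    ultimately have "mass (real (2 * m)) \<ge> 0" by blast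
    thus "atom_sum n m \<ge> \<rho> ^ (2 * m) / (2 * real m)" using even[OF \<open>m \<ge> 1\<close>] by linarith
  next
    fix m :: nat assume *: "\<forall>m\<ge>1. atom_sum n m \<ge> \<rho> ^ (2 * m) / (2 * real m)" "m \<ge> 1"
    show "mass (real m) \<ge> 0"
    proof (cases "odd m")
      case True
      hence "multiplicity 2 m = 0" by (rule not_dvd_imp_multiplicity_0)
      thus ?thesis using mass[OF *(2)] True \<rho> by simp
    next
      case False
      hence "even m" by simp
      then obtain m' where m': "m = 2 * m'" by (rule evenE)
      hence "m' \<ge> 1" using *(2) by simp
      thus ?thesis using even[of m'] *(1) unfolding m' by simp
    qed
  qed
qed

lemma atom_sum_ge:
  assumes q\<rho>: "\<rho> \<le> q"
  shows "atom_sum n m \<ge> a_seq 1 q \<rho> (n * m)"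
proof -
  have nonneg: "a_seq 1 q \<rho> M \<ge> 0" for M
  proof -
    have "(- \<rho>) ^ M \<le> \<bar>(- \<rho>) ^ M\<bar>" by (rule abs_ge_self)
    also have "\<dots> = \<rho> ^ M" using \<rho> by (simp add: power_abs)
    also have "\<dots> \<le> q ^ M" using q\<rho> \<rho> by (intro power_mono) auto
    finally show ?thesis by (simp add: a_seq_eq)
  qed
  have "atom_sum n m = a_seq 1 q \<rho> (n * m) + (\<Sum>s = Suc 0..multiplicity 2 m. a_seq 1 q \<rho> (n ^ (s + 1) * m div 2 ^ s))"
    unfolding atom_sum_def by (subst sum.atLeast_Suc_atMost) auto
  thus ?thesis using nonneg by (simp add: sum_nonneg)
qed

text \<open>Keeping only s = 0 in \<open>atom_sum\<close>, giving (-\<rho>)^(n m) its worse sign and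
  dividing by \<rho>^(2 m) leaves the requirement Q^m - P^m \<ge> n / 2 with Q = q^n / \<rho>^2 and
  P = \<rho>^(n - 2).\<close>

lemma atom_sum_bound:
  assumes n: "n \<ge> 3" and m: "m \<ge> 1" and q\<rho>: "\<rho> \<le> q"
    and Q: "(q ^ n / \<rho>\<^sup>2) ^ m - (\<rho> ^ (n - 2)) ^ m \<ge> real n / 2"
  shows "atom_sum n m \<ge> \<rho> ^ (2 * m) / (2 * real m)"
proof -
  have \<rho>p: "\<rho> ^ (2 * m) > 0" using \<rho> by simp
  have n2: "n = n - 2 + 2" using n by simp
  have e1: "q ^ (n * m) = (q ^ n / \<rho>\<^sup>2) ^ m * \<rho> ^ (2 * m)"
    using \<rho> by (simp add: power_divide power_mult)
  have e2: "\<rho> ^ (n * m) = (\<rho> ^ (n - 2)) ^ m * \<rho> ^ (2 * m)"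
  proof -
    have "\<rho> ^ (n * m) = (\<rho> ^ (n - 2) * \<rho> ^ 2) ^ m" by (subst n2) (simp only: power_mult power_add)
    thus ?thesis by (simp add: power_mult_distrib power_mult)
  qed
  have "\<rho> ^ (2 * m) / (2 * real m) = (real n / 2) * \<rho> ^ (2 * m) / real (n * m)"
    using n by (simp add: field_simps)
  also have "\<dots> \<le> ((q ^ n / \<rho>\<^sup>2) ^ m - (\<rho> ^ (n - 2)) ^ m) * \<rho> ^ (2 * m) / real (n * m)"
    using Q \<rho>p by (intro divide_right_mono mult_right_mono) auto
  also have "\<dots> = (q ^ (n * m) - \<rho> ^ (n * m)) / real (n * m)" unfolding e1 e2 by (simp add: algebra_simps)
  also have "\<dots> \<le> (q ^ (n * m) - (- \<rho>) ^ (n * m)) / real (n * m)"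
  proof (intro divide_right_mono diff_left_mono)
    have "(- \<rho>) ^ (n * m) \<le> \<bar>(- \<rho>) ^ (n * m)\<bar>" by (rule abs_ge_self)
    thus "(- \<rho>) ^ (n * m) \<le> \<rho> ^ (n * m)" using \<rho> by (simp add: power_abs)
  qed simp
  also have "\<dots> = a_seq 1 q \<rho> (n * m)" by (simp add: a_seq_eq)
  also have "\<dots> \<le> atom_sum n m" by (rule atom_sum_ge[OF q\<rho>])
  finally show ?thesis .
qed

text \<open>Because n is odd, the condition at m = 1 reads Q + P \<ge> n / 2 for Q = q^n / \<rho>^2
  and P = \<rho>^(n - 2). It has to be turned into the difference bound Q^m - P^m \<ge> n / 2 for m
  \<ge> 2.\<close>

lemma atom_sum_condition_ge_5:
  assumes n: "odd n" "n \<ge> 5"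
  shows "(\<forall>m\<ge>1. atom_sum n m \<ge> \<rho> ^ (2 * m) / (2 * real m)) \<longleftrightarrow> q ^ n + \<rho> ^ n \<ge> real n / 2 * \<rho>\<^sup>2"
proof -
  have one: "atom_sum n 1 \<ge> \<rho> ^ (2 * 1) / (2 * real 1) \<longleftrightarrow> q ^ n + \<rho> ^ n \<ge> real n / 2 * \<rho>\<^sup>2"
    using n by (simp add: atom_sum_def a_seq_eq field_simps power2_eq_square)
  show ?thesis
  proof (intro iffI allI impI)
    assume "\<forall>m\<ge>1. atom_sum n m \<ge> \<rho> ^ (2 * m) / (2 * real m)"
    thus "q ^ n + \<rho> ^ n \<ge> real n / 2 * \<rho>\<^sup>2" using one by blast
  next
    fix m :: nat assume h: "q ^ n + \<rho> ^ n \<ge> real n / 2 * \<rho>\<^sup>2" and m: "m \<ge> 1"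
    show "atom_sum n m \<ge> \<rho> ^ (2 * m) / (2 * real m)"
    proof (cases "m = 1")
      case True
      show ?thesis unfolding True using one h by blast
    next
      case False
      define Q where "Q = q ^ n / \<rho>\<^sup>2"
      define P where "P = \<rho> ^ (n - 2)"
      have \<rho>2: "0 < \<rho>\<^sup>2" "\<rho>\<^sup>2 < 1" using \<rho> by (auto simp: power_less_one_iff)
      have n2: "n = n - 2 + 2" using n by simp
      have \<rho>n: "\<rho> ^ n = P * \<rho>\<^sup>2" unfolding P_def by (subst n2) (simp only: power_add)
      have P: "0 \<le> P" "P \<le> \<rho>\<^sup>2" unfolding P_def using \<rho> n by (auto intro!: power_decreasing)
      have qn: "q ^ n = Q * \<rho>\<^sup>2" using \<rho> by (simp add: Q_def)
      have "(Q + P) * \<rho>\<^sup>2 \<ge> real n / 2 * \<rho>\<^sup>2" using h by (simp add: \<rho>n qn algebra_simps)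
      hence QP: "Q + P \<ge> real n / 2" using \<rho>2 by simp
      have n5: "real n / 2 \<ge> 5 / 2" using n by simp
      \<comment> \<open>Bootstrapping: P < 1 gives Q \<ge> 3 / 2; then Q \<rho>^2 = q^n < 1 gives P
        \<le> \<rho>^2 < 2 / 3, so Q - P = (Q + P) - 2 P > 5 / 2 - 4 / 3 > 1. For m = 2 the product
        (Q - P) (Q + P) suffices, and larger m only help since Q \<ge> 1 \<ge> P.\<close>
      have Q15: "Q \<ge> 3 / 2" using QP P \<rho>2 n5 by linarith
      have "q ^ n < 1" using q n by (intro power_less_one_iff[THEN iffD2]) auto
      moreover have "3 / 2 * \<rho>\<^sup>2 \<le> Q * \<rho>\<^sup>2" using Q15 \<rho>2 by (intro mult_right_mono) auto
      ultimately have P23: "P < 2 / 3" using P qn by linarith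
      have "P \<le> 1" "Q \<ge> 1" using P23 Q15 by linarith+
      have "Q - P \<ge> 1" using QP P23 n5 by linarith
      hence "(Q - P) * (Q + P) \<ge> 1 * (real n / 2)" using QP n5 by (intro mult_mono) auto
      hence 2: "Q\<^sup>2 - P\<^sup>2 \<ge> real n / 2" by (simp add: power2_eq_square algebra_simps)
      have m2: "m = 2 + (m - 2)" using m False by simp
      have "Q ^ m \<ge> Q\<^sup>2 * 1" using \<open>Q \<ge> 1\<close> by (subst m2, subst power_add, intro mult_left_mono one_le_power) auto
      moreover have "P ^ m \<le> P\<^sup>2 * 1" using \<open>P \<le> 1\<close> P by (subst m2, subst power_add, intro mult_left_mono power_le_one) auto
      ultimately have "Q ^ m - P ^ m \<ge> real n / 2" using 2 by linarith
      moreover have "\<rho> \<le> q"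
      proof (rule ccontr)
        assume "\<not> \<rho> \<le> q"
        hence "q ^ n \<le> \<rho> ^ n" using q by (intro power_mono) auto
        hence "Q * \<rho>\<^sup>2 \<le> P * \<rho>\<^sup>2" by (simp only: qn \<rho>n)
        hence "Q \<le> P" using \<rho>2 by simp
        thus False using \<open>Q - P \<ge> 1\<close> by linarith
      qed
      ultimately show ?thesis using atom_sum_bound[of n m] n m by (simp add: Q_def P_def)
    qed
  qed
qed

text \<open>For n = 3 the condition at m = 1 yields only Q > 1 / 2 for Q = q^3 / \<rho>^2, which
  does not make Q^m grow; m = 2 bounds Q away from 1, and Bernoulli's inequality does the
  rest.\<close>

lemma atom_sum_condition_3:
  "(\<forall>m\<ge>1. atom_sum 3 m \<ge> \<rho> ^ (2 * m) / (2 * real m)) \<longleftrightarrow>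
   (\<forall>m\<in>{1..149}. atom_sum 3 m \<ge> \<rho> ^ (2 * m) / (2 * real m))"
proof (intro iffI allI impI)
  fix m :: nat
  assume h: "\<forall>m\<in>{1..149}. atom_sum 3 m \<ge> \<rho> ^ (2 * m) / (2 * real m)" and m: "m \<ge> 1"
  show "atom_sum 3 m \<ge> \<rho> ^ (2 * m) / (2 * real m)"
  proof (cases "m \<le> 149")
    case True
    thus ?thesis using h m by simp
  next
    case False
    have \<rho>2: "0 < \<rho>\<^sup>2" "\<rho>\<^sup>2 < 1" using \<rho> by (auto simp: power_less_one_iff)
    define Q where "Q = q ^ 3 / \<rho>\<^sup>2"
    have q3: "q ^ 3 = Q * \<rho>\<^sup>2" and Q0: "Q \<ge> 0" using \<rho> q by (simp_all add: Q_def)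
    \<comment> \<open>The case \<open>m = 2\<close> alone makes \<open>Q\<close> large enough for all \<open>m \<ge> 150\<close>.\<close>
    have Q103: "Q \<ge> 103 / 100"
    proof (rule ccontr)
      assume "\<not> Q \<ge> 103 / 100"
      hence Q: "Q \<le> 103 / 100" by simp
      define x where "x = \<rho>\<^sup>2"
      have x: "0 < x" "x < 1" using \<rho>2 by (auto simp: x_def)
      \<comment> \<open>At m = 2 both s = 0 and s = 1 occur, with the indices 6 and 9.\<close>
      have mult2: "multiplicity 2 (2::nat) = 1" by (rule multiplicity_self) auto
      have "atom_sum 3 2 = a_seq 1 q \<rho> 6 + a_seq 1 q \<rho> 9"
        unfolding atom_sum_def mult2 by simp
      also have "\<dots> = (q ^ 6 - \<rho> ^ 6) / 6 + (q ^ 9 + \<rho> ^ 9) / 9" by (simp add: a_seq_eq)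
      also have "\<dots> = (Q\<^sup>2 * x\<^sup>2 - x ^ 3) / 6 + (Q ^ 3 * x ^ 3 + \<rho> ^ 9) / 9"
      proof -
        have "q ^ 6 = (q ^ 3) ^ 2" "q ^ 9 = (q ^ 3) ^ 3" "\<rho> ^ 6 = (\<rho>\<^sup>2) ^ 3" by (simp_all flip: power_mult)
        thus ?thesis by (simp only: q3 x_def power_mult_distrib)
      qed
      finally have "atom_sum 3 2 = (Q\<^sup>2 * x\<^sup>2 - x ^ 3) / 6 + (Q ^ 3 * x ^ 3 + \<rho> ^ 9) / 9" .
      moreover have "\<rho> ^ (2 * 2) / (2 * real 2) = x\<^sup>2 / 4" by (simp add: x_def flip: power_mult)
      ultimately have ge: "x\<^sup>2 / 4 \<le> (Q\<^sup>2 * x\<^sup>2 - x ^ 3) / 6 + (Q ^ 3 * x ^ 3 + \<rho> ^ 9) / 9"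
        using h[rule_format, of 2] by simp
      have "Q\<^sup>2 \<le> (103 / 100)\<^sup>2" "Q ^ 3 \<le> (103 / 100) ^ 3" using Q Q0 by (auto intro!: power_mono)
      hence Q2: "Q\<^sup>2 * x\<^sup>2 \<le> (103 / 100)\<^sup>2 * x\<^sup>2" and Q3: "Q ^ 3 * x ^ 3 \<le> (103 / 100) ^ 3 * x ^ 3"
        using x by (auto intro!: mult_right_mono)
      have "\<rho> ^ 9 \<le> \<rho> ^ 6" using \<rho> by (intro power_decreasing) auto
      hence r9: "\<rho> ^ 9 \<le> x ^ 3" by (simp add: x_def flip: power_mult)
      have x3: "x ^ 3 \<le> x\<^sup>2" using x by (intro power_decreasing) auto
      have x2: "x\<^sup>2 > 0" using x by simp
      have num: "(103 / 100 :: real)\<^sup>2 = 10609 / 10000" "(103 / 100 :: real) ^ 3 = 1092727 / 1000000"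
        by (simp_all add: power_divide)
      \<comment> \<open>X stands for x^2 and Y for x^3. By Y \<le> X the right side is at most X
        (1.0609 / 6 - 1 / 6 + 2.092727 / 9) after collecting terms, which stays below 0.243 X and
        hence below X / 4. The constant 103 / 100 exceeds 1 and is small enough for this.\<close>
      have contra: False if "X / 4 \<le> (A - Y) / 6 + (B + R) / 9" "A \<le> 10609 / 10000 * X"
        "B \<le> 1092727 / 1000000 * Y" "R \<le> Y" "Y \<le> X" "0 < X" for A B X Y R :: real
        using that by argo
      show False by (rule contra[OF ge Q2[unfolded num] Q3[unfolded num] r9 x3 x2])
    qed
    \<comment> \<open>The target is Q^m \<ge> 5 / 2: the difference bound needs n / 2 = 3 / 2, and
      P^m costs at most 1.\<close>
    have "1 + real m * (3 / 100) \<le> (1 + 3 / 100) ^ m" by (rule Bernoulli_inequality) simp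
    also have "\<dots> \<le> Q ^ m" using Q103 by (intro power_mono) auto
    finally have Qm: "Q ^ m \<ge> 5 / 2" using False by simp
    have Pm: "(\<rho> ^ (3 - 2)) ^ m \<le> 1" using \<rho> by (intro power_le_one) auto
    have "\<rho> \<le> q"
    proof (rule ccontr)
      assume "\<not> \<rho> \<le> q"
      hence "q ^ 3 \<le> \<rho> ^ 3" using q by (intro power_mono) auto
      also have "\<dots> \<le> \<rho>\<^sup>2" using \<rho> by (intro power_decreasing) auto
      finally have "Q * \<rho>\<^sup>2 \<le> 1 * \<rho>\<^sup>2" using q3 by simp
      hence "Q \<le> 1" using \<rho>2 by simp
      thus False using Q103 by simp
    qed
    thus ?thesis using Qm Pm m by (intro atom_sum_bound) (auto simp: Q_def)
  qed
qed simp

end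

section \<open>Assembly of the three cases\<close>

theorem theorem6p3:
  fixes M :: "'a measure" and N L :: "real \<Rightarrow> 'a \<Rightarrow> real"
    and k :: int and c u v w p q r :: real and \<mu> :: "real measure"
  assumes "k < 0" and "c > 1"
    and "u \<ge> 0" and "v \<ge> 0" and "w \<ge> 0" and "u + v + w > 0"
    and "p = u / (u + v + w)" and "q = v / (u + v + w)" and "r = w / (u + v + w)"
    and "p \<ge> 0" and "q \<ge> 0" and "r \<ge> 0" and "p + q + r = 1"
    and "compound_poisson_process M (jump_measure c k u v w) (\<lambda>t \<omega>. (N t \<omega>, L t \<omega>))"
    and "\<mu> = exp_integral_law M c N L"
    and "0 < r" and "r < p"
  shows
    "((\<forall>j::int. j \<ge> \<bar>k\<bar> \<longrightarrow> 2 * c powi j \<notin> \<nat>) \<longrightarrow> \<mu> \<in> ID0)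
     \<and>
     (\<forall>(l::nat) (\<alpha>::nat) (\<beta>::nat).
        (\<exists>j::nat. j \<ge> 1 \<and> c ^ j \<in> \<nat>) \<and>
        l = (LEAST j. j \<ge> 1 \<and> c ^ j \<in> \<nat>) \<and>
        real \<alpha> = c ^ l \<and>
        \<beta> = nat \<lceil>real_of_int \<bar>k\<bar> / real l\<rceil>
        \<longrightarrow> (\<mu> \<in> ID \<longleftrightarrow> q > 0 \<and> h_fun \<alpha> \<beta> (q ^ (\<alpha> ^ \<beta>)) \<ge> r / p))
     \<and>
     (\<forall>(j::nat) (\<alpha>::real) (n::nat).
        int j \<ge> \<bar>k\<bar> \<and> j \<ge> 1 \<and> 2 * c ^ j \<in> odd_naturals \<and> \<alpha> = c ^ j \<and> real n = 2 * \<alpha>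
        \<longrightarrow>
          (\<forall>j'::nat. j' \<ge> 1 \<longrightarrow> c ^ j' \<notin> \<nat>) \<and>
          (\<forall>j'::nat. j' \<ge> 1 \<and> 2 * c ^ j' \<in> odd_naturals \<longrightarrow> j' = j) \<and>
          2 * \<alpha> \<in> odd_naturals \<and> 2 * \<alpha> \<ge> 3 \<and>
          (2 * \<alpha> \<ge> 5 \<longrightarrow>
             (\<mu> \<in> ID \<longleftrightarrow> q ^ n + (r / p) ^ n \<ge> \<alpha> * (r / p)\<^sup>2)) \<and>
          (2 * \<alpha> = 3 \<longrightarrow>
             (\<mu> \<in> ID \<longleftrightarrow>
               (\<forall>m::nat \<in> {1..149}.
                  (\<Sum>s = 0..multiplicity 2 m. a_seq p q r (3 ^ (s + 1) * m div 2 ^ s))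
                    \<ge> (r / p) ^ (2 * m) / (2 * real m)))))"
proof -
  define \<kappa> where "\<kappa> = nat (- k)"
  have abs_k: "\<kappa> \<ge> 1" "k = - int \<kappa>" "\<bar>k\<bar> = int \<kappa>" using \<open>k < 0\<close> by (auto simp: \<kappa>_def)
  have wu: "0 < w" "w < u"
    using assms(6,7,9,16,17) by (auto simp: divide_less_cancel zero_less_divide_iff)
  have rp: "r / p = w / u" using assms(6,7,9) by simp
  interpret ou_process M N L c u v w \<kappa>
    using assms(2,4,14) abs_k wu by unfold_locales auto
  have distr: "real_distribution \<mu>" and char: "\<And>z. char \<mu> z = phi (\<i> * of_real z)"
    using exp_integral_law_char by (simp_all add: \<open>\<mu> = _\<close>)
  have ID: "\<mu> \<in> ID \<longleftrightarrow> (\<forall>m::nat\<ge>1. mass (real m) \<ge> 0)"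
    using infinitely_divisible_iff_mass[OF distr char] by (simp add: ID_def)
  have QID: "quasi_infinitely_divisible \<mu>" by (rule quasi_infinitely_divisible_phi[OF distr char])
  have q_eq: "v / (u + v + w) = q" using assms(8) by simp
  have a_seq: "a_seq p q r m = a_seq 1 q (w / u) m" for m by (simp add: a_seq_def rp)
  show ?thesis
  proof (intro conjI allI impI)
    assume no: "\<forall>j::int. j \<ge> \<bar>k\<bar> \<longrightarrow> 2 * c powi j \<notin> \<nat>"
    have "2 * c ^ i \<notin> \<nat>" if "i \<ge> \<kappa>" for i
      using no[rule_format, of "int i"] that by (simp add: abs_k(3))
    hence "mass (real 2) < 0" using mass_2_neg[OF abs_k(1)] by simp
    hence "\<mu> \<notin> ID" unfolding ID by (metis not_le one_le_numeral)
    thus "\<mu> \<in> ID0" using QID by (simp add: ID_def ID0_def)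
  next
    fix l \<alpha> \<beta> :: nat
    assume h: "(\<exists>j::nat. j \<ge> 1 \<and> c ^ j \<in> \<nat>) \<and> l = (LEAST j. j \<ge> 1 \<and> c ^ j \<in> \<nat>) \<and>
        real \<alpha> = c ^ l \<and> \<beta> = nat \<lceil>real_of_int \<bar>k\<bar> / real l\<rceil>"
    have l: "l \<ge> 1" using h LeastI_ex[of "\<lambda>j. j \<ge> 1 \<and> c ^ j \<in> \<nat>"] by blast
    have min: "c ^ i \<notin> \<nat>" if "1 \<le> i" "i < l" for i
      using h that not_less_Least[of i "\<lambda>j. j \<ge> 1 \<and> c ^ j \<in> \<nat>"] by blast
    have \<alpha>: "real \<alpha> = c ^ l" and \<beta>: "\<beta> = nat \<lceil>real \<kappa> / real l\<rceil>" using h by (simp_all add: abs_k(3))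
    show "\<mu> \<in> ID \<longleftrightarrow> q > 0 \<and> h_fun \<alpha> \<beta> (q ^ (\<alpha> ^ \<beta>)) \<ge> r / p"
      unfolding ID rp using mass_integer_base_nonneg_iff[OF l min \<alpha> abs_k(1) \<beta>] by (simp only: q_eq)
  next
    fix j :: nat and \<alpha> :: real and n :: nat
    assume "int j \<ge> \<bar>k\<bar> \<and> j \<ge> 1 \<and> 2 * c ^ j \<in> odd_naturals \<and> \<alpha> = c ^ j \<and> real n = 2 * \<alpha>"
    hence j: "j \<ge> 1" "j \<ge> \<kappa>" and odd_nat: "2 * c ^ j \<in> odd_naturals"
      and \<alpha>: "\<alpha> = c ^ j" and n2: "2 * c ^ j = real n" by (auto simp: abs_k(3))
    have n: "odd n" using odd_nat n2 by (auto simp: odd_naturals_def)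
    have \<alpha>n: "\<alpha> = real n / 2" using \<alpha> n2 by simp
    show "c ^ j' \<notin> \<nat>" if "j' \<ge> 1" for j' by (rule half_odd_power_not_Nats[OF n n2 that])
    show "j' = j" if "j' \<ge> 1 \<and> 2 * c ^ j' \<in> odd_naturals" for j'
      using that half_odd_power_unique[OF _ _ n n2] by (auto simp: odd_naturals_def)
    show "2 * \<alpha> \<in> odd_naturals" using odd_nat \<alpha> by simp
    have "c ^ j > 1" using c j by (intro one_less_power) auto
    hence "n > 2" using n2 by simp
    thus "2 * \<alpha> \<ge> 3" using \<alpha>n by simp
    note ID_iff = ID mass_half_odd_base_nonneg_iff[OF n n2 j abs_k(1)]
    show "\<mu> \<in> ID \<longleftrightarrow> q ^ n + (r / p) ^ n \<ge> \<alpha> * (r / p)\<^sup>2" if "2 * \<alpha> \<ge> 5"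
    proof -
      have "n \<ge> 5" using that \<alpha>n by simp
      thus ?thesis unfolding ID_iff rp \<alpha>n using atom_sum_condition_ge_5[OF n] by (simp only: q_eq)
    qed
    show "\<mu> \<in> ID \<longleftrightarrow> (\<forall>m::nat \<in> {1..149}.
        (\<Sum>s = 0..multiplicity 2 m. a_seq p q r (3 ^ (s + 1) * m div 2 ^ s))
          \<ge> (r / p) ^ (2 * m) / (2 * real m))" if "2 * \<alpha> = 3"
    proof -
      have n3: "n = 3" using that \<alpha>n by simp
      show ?thesis unfolding ID_iff n3 atom_sum_condition_3 unfolding rp a_seq atom_sum_def[unfolded q_eq] q_eq ..
    qed
  qed
qed

end
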